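(* Let $\Bbbk$ be an integral domain and let $A=(TV,d)$ be a free model over $\Bbbk$. There exist two injective quasi-isomorphisms of differential graded Lie algebras $$s\mathbf C^*(A;A)\xleftarrow{\ \simeq\ }\widetilde{\mathrm{Der}}\,A\xrightarrow{\ \simeq\ }\mathrm{Der}\,\widetilde A,$$ where $\widetilde A$ is the differential graded algebra $\widetilde A=(T(V\oplus\Bbbk\epsilon),\tilde d)$ with $|\epsilon|=-1$, $\tilde d\epsilon=\epsilon^2$ and $\tilde dv=dv+\epsilon v-(-1)^{|v|}v\epsilon$ for $v\in V$.
   Context: Conventions. Graded modules are $\mathbb Z$-graded with lower degrees; differentials have degree $-1$; $(sV)_i=V_{i-1}$; Koszul signs are used; $\mathrm{Hom}(M,N)$ is graded by $\mathrm{Hom}_n(M,N)=\prod_{k-l=n}\mathrm{Hom}(M_l,N_k)$. A free model is a tensor algebra $TV$ on a graded module $V$, with a differential $d$ making it a differential graded algebra, such that $V=\bigcup_{k\ge0}V(k)$ for an increasing family $V(0)\subset V(1)\subset\cdots$ with $d(V(0))=0$ and $d(V(k))\subset T(V(k-1))$. $\mathrm{Der}\,A$ is the differential graded Lie algebra of (graded) derivations of the differential graded algebra $A$, with commutator bracket and differential $D=[d,-]$. The differential graded Lie algebra $\widetilde{\mathrm{Der}}\,A=\mathrm{Der}\,A\oplus sA$ has, for $\theta,\theta'\in\mathrm{Der}\,A$ and $x,y\in A$: differential $\widetilde D(\theta+sx)=D(\theta)-\mathrm{ad}_x-s\,d(x)$, where $\mathrm{ad}_x(y)=xy-(-1)^{|x||y|}yx$;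 bracket $[\theta,\theta'+sx]=[\theta,\theta']+(-1)^{|\theta|}s\theta(x)$ and $[sx,sy]=0$. $TC(sA)=\bigoplus_n(sA)^{\otimes n}$ is the tensor coalgebra (deconcatenation coproduct), with elements written $[a_1|\dots|a_k]$. The Hochschild complex is $\mathbf C^*(A;A)=(\mathrm{Hom}(TC(sA),A),D_0+D_1)$ with, for $\bar\epsilon_i=|f|+|sa_1|+\dots+|sa_{i-1}|$, $$D_0(f)[a_1|\dots|a_k]=d(f[a_1|\dots|a_k])-\sum_{i=1}^k(-1)^{\bar\epsilon_i}f[a_1|\dots|da_i|\dots|a_k],$$ $$D_1(f)[a_1|\dots|a_k]=-(-1)^{|sa_1||f|}a_1f[a_2|\dots|a_k]-\sum_{i=2}^k(-1)^{\bar\epsilon_i}f[a_1|\dots|a_{i-1}a_i|\dots|a_k]+(-1)^{\bar\epsilon_k}f[a_1|\dots|a_{k-1}]a_k.$$ The suspension $s\mathbf C^*(A;A)$ is a differential graded Lie algebra with differential $sf\mapsto -s(D_0+D_1)(f)$ and (Gerstenhaber) bracket $[sf,sg]=s(f\circ\beta_A(g))-(-1)^{|sf||sg|}s(g\circ\beta_A(f))$, where $\beta_A(g)$ is the unique coderivation of $TC(sA)$ whose projection onto $sA$ is $s\circ g$.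
   Formalization: In D_0 the entry da_i is taken as the differential of the suspension, d(sa_i) = -s(da_i), since with +s(da_i) the displayed D_0+D_1 does not square to zero (for f[]=x one gets 2x·da). *)

theory Defs
  imports
    Complex_Main
    "HOL-Library.Poly_Mapping"
    "HOL-Library.Function_Algebras"
    "HOL-Library.Product_Plus"
begin

section \<open>Graded modules\<close>

text \<open>
  A \<open>\<int>\<close>-graded module is a module (a whole type) that is the internal direct sum of
  its homogeneous components.
\<close>

record ('k, 'a) gmod =
  smul :: "'k \<Rightarrow> 'a \<Rightarrow> 'a"
  gr :: "int \<Rightarrow> 'a set"

definition graded_module :: "('k::comm_ring_1, 'a::ab_group_add, 'm) gmod_scheme \<Rightarrow> bool" where
  "graded_module M \<longleftrightarrow>
     module (smul M) \<and>
     (\<forall>i. module.subspace (smul M) (gr M i)) \<and>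
     (\<forall>x. \<exists>!c :: int \<Rightarrow>\<^sub>0 'a.
        (\<forall>i. Poly_Mapping.lookup c i \<in> gr M i) \<and> x = (\<Sum>i\<in>Poly_Mapping.keys c. Poly_Mapping.lookup c i))"

definition ksign :: "int \<Rightarrow> 'a::group_add \<Rightarrow> 'a" where
  "ksign n x = (if even n then x else - x)"

text \<open>
  The suspension \<open>sM\<close>; the element \<open>s x\<close> is represented by \<open>x\<close> itself.
\<close>

definition susp :: "('k, 'a, 'm) gmod_scheme \<Rightarrow> ('k, 'a) gmod" where
  "susp M = \<lparr>smul = smul M, gr = (\<lambda>i. gr M (i - 1))\<rparr>"

text \<open>
  As \<open>M\<close> is the direct sum of its components \<open>M\<^sub>l\<close>, the linear maps \<open>f\<close> on \<open>M\<close> with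
  \<open>f(M\<^sub>l) \<subseteq> N\<^bsub>l+n\<^esub>\<close> are exactly the families in the product of the modules
  \<open>Hom(M\<^sub>l, N\<^bsub>l+n\<^esub>)\<close> over all \<open>l\<close>.
\<close>

definition Hom ::
  "int \<Rightarrow> ('k::comm_ring_1, 'a::ab_group_add, 'm) gmod_scheme
     \<Rightarrow> ('k, 'b::ab_group_add, 'n) gmod_scheme \<Rightarrow> ('a \<Rightarrow> 'b) set" where
  "Hom n M N = {f. module_hom (smul M) (smul N) f \<and> (\<forall>l. f ` gr M l \<subseteq> gr N (l + n))}"

text \<open>\<open>homog M is xs\<close>: the letters of \<open>xs\<close> are homogeneous, of degrees listed by \<open>is\<close>.\<close>

definition homog :: "('k, 'a, 'm) gmod_scheme \<Rightarrow> int list \<Rightarrow> 'a list \<Rightarrow> bool" where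
  "homog M is xs \<longleftrightarrow> list_all2 (\<lambda>i x. x \<in> gr M i) is xs"


section \<open>Tensor products, tensor powers, tensor algebras\<close>

text \<open>
  Tensor constructions are quotients of free modules, \<open>'x \<Rightarrow>\<^sub>0 'k\<close> being the free module on
  \<open>'x\<close>. The predicate \<open>presented_by sc w R\<close> says that the linear extension of \<open>w\<close>
  induces an isomorphism from the quotient of the free module by the submodule spanned by
  \<open>R\<close> onto the module with scalar multiplication \<open>sc\<close>.
\<close>

definition fscale :: "'k::comm_ring_1 \<Rightarrow> ('x \<Rightarrow>\<^sub>0 'k) \<Rightarrow> ('x \<Rightarrow>\<^sub>0 'k)" where
  "fscale c p = Poly_Mapping.map ((*) c) p"

definition lincomb ::
  "('k::comm_ring_1 \<Rightarrow> 'm::ab_group_add \<Rightarrow> 'm) \<Rightarrow> ('x \<Rightarrow> 'm) \<Rightarrow> ('x \<Rightarrow>\<^sub>0 'k) \<Rightarrow> 'm" where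
  "lincomb sc w p = (\<Sum>x\<in>Poly_Mapping.keys p. sc (Poly_Mapping.lookup p x) (w x))"

definition presented_by ::
  "('k::comm_ring_1 \<Rightarrow> 'm::ab_group_add \<Rightarrow> 'm) \<Rightarrow> ('x \<Rightarrow> 'm) \<Rightarrow> ('x \<Rightarrow>\<^sub>0 'k) set \<Rightarrow> bool" where
  "presented_by sc w R \<longleftrightarrow>
     module sc \<and> range (lincomb sc w) = UNIV \<and>
     {p. lincomb sc w p = 0} = module.span fscale R"

definition bilinear_relators ::
  "('k::comm_ring_1 \<Rightarrow> 'a::ab_group_add \<Rightarrow> 'a) \<Rightarrow> ('k \<Rightarrow> 'b::ab_group_add \<Rightarrow> 'b)
     \<Rightarrow> ('a \<times> 'b \<Rightarrow>\<^sub>0 'k) set" where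
  "bilinear_relators scM scN =
     {Poly_Mapping.single (x + x', y) 1 - Poly_Mapping.single (x, y) 1
        - Poly_Mapping.single (x', y) 1 | x x' y. True} \<union>
     {Poly_Mapping.single (x, y + y') 1 - Poly_Mapping.single (x, y) 1
        - Poly_Mapping.single (x, y') 1 | x y y'. True} \<union>
     {Poly_Mapping.single (scM c x, y) 1 - Poly_Mapping.single (x, y) c | c x y. True} \<union>
     {Poly_Mapping.single (x, scN c y) 1 - Poly_Mapping.single (x, y) c | c x y. True}"

definition tensor_product ::
  "('k::comm_ring_1 \<Rightarrow> 'a::ab_group_add \<Rightarrow> 'a) \<Rightarrow> ('k \<Rightarrow> 'b::ab_group_add \<Rightarrow> 'b)
     \<Rightarrow> ('k \<Rightarrow> 'c::ab_group_add \<Rightarrow> 'c) \<Rightarrow> ('a \<Rightarrow> 'b \<Rightarrow> 'c) \<Rightarrow> bool" where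
  "tensor_product scM scN scP t \<longleftrightarrow>
     presented_by scP (\<lambda>(x, y). t x y) (bilinear_relators scM scN)"

definition multilinear_relators ::
  "('k::comm_ring_1 \<Rightarrow> 'v::ab_group_add \<Rightarrow> 'v) \<Rightarrow> ('v list \<Rightarrow>\<^sub>0 'k) set" where
  "multilinear_relators sc =
     {Poly_Mapping.single (xs @ (u + v) # ys) 1 - Poly_Mapping.single (xs @ u # ys) 1
        - Poly_Mapping.single (xs @ v # ys) 1 | xs u v ys. True} \<union>
     {Poly_Mapping.single (xs @ sc c v # ys) 1 - Poly_Mapping.single (xs @ v # ys) c
        | xs c v ys. True}"

text \<open>
  \<open>T\<close> is the graded module \<open>\<Oplus>\<^sub>n V\<^bsup>\<otimes>n\<^esup>\<close>, and \<open>w [v\<^sub>1, \<dots>, v\<^sub>n]\<close> is the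
  elementary tensor \<open>v\<^sub>1 \<otimes> \<dots> \<otimes> v\<^sub>n\<close>.
\<close>

definition tensor_powers ::
  "('k::comm_ring_1, 'v::ab_group_add, 'm) gmod_scheme
     \<Rightarrow> ('k, 't::ab_group_add, 'n) gmod_scheme \<Rightarrow> ('v list \<Rightarrow> 't) \<Rightarrow> bool" where
  "tensor_powers V T w \<longleftrightarrow>
     presented_by (smul T) w (multilinear_relators (smul V)) \<and>
     gr T = (\<lambda>p. module.span (smul T) {w vs | vs is. homog V is vs \<and> sum_list is = p})"

definition algebra_scale :: "('k::comm_ring_1 \<Rightarrow> 'a::ring_1 \<Rightarrow> 'a) \<Rightarrow> bool" where
  "algebra_scale sc \<longleftrightarrow>
     module sc \<and> (\<forall>c x y. sc c (x * y) = sc c x * y \<and> sc c (x * y) = x * sc c y)"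

text \<open>\<open>T\<close> is the tensor algebra \<open>TV\<close> with canonical map \<open>\<iota> : V \<rightarrow> TV\<close>.\<close>

definition tensor_algebra ::
  "('k::comm_ring_1, 'v::ab_group_add, 'm) gmod_scheme
     \<Rightarrow> ('k, 'a::ring_1, 'n) gmod_scheme \<Rightarrow> ('v \<Rightarrow> 'a) \<Rightarrow> bool" where
  "tensor_algebra V T \<iota> \<longleftrightarrow>
     algebra_scale (smul T) \<and> tensor_powers V T (\<lambda>vs. prod_list (map \<iota> vs))"


section \<open>Differential graded algebras, derivations, free models\<close>

record ('k, 'a) dga = "('k, 'a) gmod" +
  diff :: "'a \<Rightarrow> 'a"

definition Der ::
  "int \<Rightarrow> ('k::comm_ring_1, 'a::ring_1, 'm) gmod_scheme \<Rightarrow> ('a \<Rightarrow> 'a) set" where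
  "Der n A = {\<theta> \<in> Hom n A A.
     \<forall>i. \<forall>x\<in>gr A i. \<forall>y. \<theta> (x * y) = \<theta> x * y + ksign (n * i) (x * \<theta> y)}"

definition is_dga :: "('k::comm_ring_1, 'a::ring_1) dga \<Rightarrow> bool" where
  "is_dga A \<longleftrightarrow>
     graded_module A \<and> algebra_scale (smul A) \<and>
     1 \<in> gr A 0 \<and> (\<forall>i j. \<forall>x\<in>gr A i. \<forall>y\<in>gr A j. x * y \<in> gr A (i + j)) \<and>
     diff A \<in> Der (- 1) A \<and> (\<forall>x. diff A (diff A x) = 0)"

definition free_model ::
  "('k::comm_ring_1, 'v::ab_group_add) gmod \<Rightarrow> ('k, 'a::ring_1) dga \<Rightarrow> ('v \<Rightarrow> 'a) \<Rightarrow> bool" where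
  "free_model V A \<iota> \<longleftrightarrow>
     graded_module V \<and> tensor_algebra V A \<iota> \<and> is_dga A \<and>
     (\<exists>F :: nat \<Rightarrow> int \<Rightarrow> 'v set.
        (\<forall>k i. module.subspace (smul V) (F k i)) \<and>
        (\<forall>k i. F k i \<subseteq> F (Suc k) i) \<and>
        (\<forall>i. gr V i = (\<Union>k. F k i)) \<and>
        (\<forall>i. \<forall>v\<in>F 0 i. diff A (\<iota> v) = 0) \<and>
        (\<forall>k i. \<forall>v\<in>F (Suc k) i.
           diff A (\<iota> v) \<in> module.span (smul A)
             {prod_list (map \<iota> vs) | vs. set vs \<subseteq> (\<Union>j. F k j)}))"


section \<open>Differential graded Lie algebras\<close>

text \<open>
  A differential graded Lie algebra is given by the family of its homogeneous components,
  submodules of an ambient type on which the module operations live. The differential and the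
  bracket take the degrees of their arguments as extra parameters, since their defining formulas
  involve signs depending on these degrees. The alternating conditions
  \<open>[x, x] = 0\<close> for even \<open>x\<close> and \<open>[x, [x, x]] = 0\<close> for odd \<open>x\<close> are part of the
  definition because 2 and 3 need not be invertible in the ground ring.
\<close>

record ('k, 'l) dgl =
  lscale :: "'k \<Rightarrow> 'l \<Rightarrow> 'l"
  lcar :: "int \<Rightarrow> 'l set"
  ldiff :: "int \<Rightarrow> 'l \<Rightarrow> 'l"
  lbr :: "int \<Rightarrow> int \<Rightarrow> 'l \<Rightarrow> 'l \<Rightarrow> 'l"

definition is_dgl :: "('k::comm_ring_1, 'l::ab_group_add) dgl \<Rightarrow> bool" where
  "is_dgl L \<longleftrightarrow>
     module (lscale L) \<and>
     (\<forall>n. module.subspace (lscale L) (lcar L n)) \<and>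
     (\<forall>n. \<forall>x\<in>lcar L n. ldiff L n x \<in> lcar L (n - 1)) \<and>
     (\<forall>n. \<forall>x\<in>lcar L n. \<forall>y\<in>lcar L n. ldiff L n (x + y) = ldiff L n x + ldiff L n y) \<and>
     (\<forall>n c. \<forall>x\<in>lcar L n. ldiff L n (lscale L c x) = lscale L c (ldiff L n x)) \<and>
     (\<forall>n. \<forall>x\<in>lcar L n. ldiff L (n - 1) (ldiff L n x) = 0) \<and>
     (\<forall>m n. \<forall>x\<in>lcar L m. \<forall>y\<in>lcar L n. lbr L m n x y \<in> lcar L (m + n)) \<and>
     (\<forall>m n. \<forall>x\<in>lcar L m. \<forall>x'\<in>lcar L m. \<forall>y\<in>lcar L n.
        lbr L m n (x + x') y = lbr L m n x y + lbr L m n x' y) \<and>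
     (\<forall>m n c. \<forall>x\<in>lcar L m. \<forall>y\<in>lcar L n.
        lbr L m n (lscale L c x) y = lscale L c (lbr L m n x y)) \<and>
     (\<forall>m n. \<forall>x\<in>lcar L m. \<forall>y\<in>lcar L n.
        lbr L m n x y = - ksign (m * n) (lbr L n m y x)) \<and>
     (\<forall>m. \<forall>x\<in>lcar L m. even m \<longrightarrow> lbr L m m x x = 0) \<and>
     (\<forall>m. \<forall>x\<in>lcar L m. odd m \<longrightarrow> lbr L m (m + m) x (lbr L m m x x) = 0) \<and>
     (\<forall>m n p. \<forall>x\<in>lcar L m. \<forall>y\<in>lcar L n. \<forall>z\<in>lcar L p.
        lbr L m (n + p) x (lbr L n p y z) =
          lbr L (m + n) p (lbr L m n x y) z
            + ksign (m * n) (lbr L n (m + p) y (lbr L m p x z))) \<and>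
     (\<forall>m n. \<forall>x\<in>lcar L m. \<forall>y\<in>lcar L n.
        ldiff L (m + n) (lbr L m n x y) =
          lbr L (m - 1) n (ldiff L m x) y + ksign m (lbr L m (n - 1) x (ldiff L n y)))"

definition is_dgl_hom ::
  "('k::comm_ring_1, 'l::ab_group_add) dgl \<Rightarrow> ('k, 'l2::ab_group_add) dgl
     \<Rightarrow> (int \<Rightarrow> 'l \<Rightarrow> 'l2) \<Rightarrow> bool" where
  "is_dgl_hom L L' \<phi> \<longleftrightarrow>
     (\<forall>n. \<forall>x\<in>lcar L n. \<phi> n x \<in> lcar L' n) \<and>
     (\<forall>n. \<forall>x\<in>lcar L n. \<forall>y\<in>lcar L n. \<phi> n (x + y) = \<phi> n x + \<phi> n y) \<and>
     (\<forall>n c. \<forall>x\<in>lcar L n. \<phi> n (lscale L c x) = lscale L' c (\<phi> n x)) \<and>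
     (\<forall>n. \<forall>x\<in>lcar L n. \<phi> (n - 1) (ldiff L n x) = ldiff L' n (\<phi> n x)) \<and>
     (\<forall>m n. \<forall>x\<in>lcar L m. \<forall>y\<in>lcar L n.
        \<phi> (m + n) (lbr L m n x y) = lbr L' m n (\<phi> m x) (\<phi> n y))"

definition cycles :: "('k, 'l::ab_group_add) dgl \<Rightarrow> int \<Rightarrow> 'l set" where
  "cycles L n = {x \<in> lcar L n. ldiff L n x = 0}"

definition boundaries :: "('k, 'l::ab_group_add) dgl \<Rightarrow> int \<Rightarrow> 'l set" where
  "boundaries L n = ldiff L (n + 1) ` lcar L (n + 1)"

definition homologous :: "('k, 'l::ab_group_add) dgl \<Rightarrow> int \<Rightarrow> ('l \<times> 'l) set" where
  "homologous L n = {(x, y). x \<in> cycles L n \<and> y \<in> cycles L n \<and> x - y \<in> boundaries L n}"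

definition homology :: "('k, 'l::ab_group_add) dgl \<Rightarrow> int \<Rightarrow> 'l set set" where
  "homology L n = cycles L n // homologous L n"

definition homology_map ::
  "('k, 'l2::ab_group_add) dgl \<Rightarrow> (int \<Rightarrow> 'l \<Rightarrow> 'l2) \<Rightarrow> int \<Rightarrow> 'l set \<Rightarrow> 'l2 set" where
  "homology_map L' \<phi> n X = homologous L' n `` (\<phi> n ` X)"

definition injective_quasi_iso ::
  "('k::comm_ring_1, 'l::ab_group_add) dgl \<Rightarrow> ('k, 'l2::ab_group_add) dgl
     \<Rightarrow> (int \<Rightarrow> 'l \<Rightarrow> 'l2) \<Rightarrow> bool" where
  "injective_quasi_iso L L' \<phi> \<longleftrightarrow>
     is_dgl L \<and> is_dgl L' \<and> is_dgl_hom L L' \<phi> \<and>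
     (\<forall>n. inj_on (\<phi> n) (lcar L n)) \<and>
     (\<forall>n. bij_betw (homology_map L' \<phi> n) (homology L n) (homology L' n))"


section \<open>The differential graded Lie algebras of derivations\<close>

definition comm_br ::
  "int \<Rightarrow> int \<Rightarrow> ('a \<Rightarrow> 'a) \<Rightarrow> ('a \<Rightarrow> 'a) \<Rightarrow> 'a \<Rightarrow> 'a::ab_group_add" where
  "comm_br m n \<theta> \<theta>' = (\<lambda>x. \<theta> (\<theta>' x) - ksign (m * n) (\<theta>' (\<theta> x)))"

definition Der_dgl :: "('k::comm_ring_1, 'a::ring_1) dga \<Rightarrow> ('k, 'a \<Rightarrow> 'a) dgl" where
  "Der_dgl A =
     \<lparr>lscale = (\<lambda>c \<theta> x. smul A c (\<theta> x)),
      lcar = (\<lambda>n. Der n A),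
      ldiff = (\<lambda>n \<theta>. comm_br (- 1) n (diff A) \<theta>),
      lbr = comm_br\<rparr>"

definition is_ad ::
  "('k::comm_ring_1, 'a::ring_1) dga \<Rightarrow> int \<Rightarrow> 'a \<Rightarrow> ('a \<Rightarrow> 'a) \<Rightarrow> bool" where
  "is_ad A n x h \<longleftrightarrow>
     h \<in> Hom n A A \<and> (\<forall>i. \<forall>y\<in>gr A i. h y = x * y - ksign (n * i) (y * x))"

text \<open>\<open>ad A n x\<close> is \<open>ad\<^sub>x\<close> for \<open>x\<close> homogeneous of degree \<open>n\<close>.\<close>

definition ad :: "('k::comm_ring_1, 'a::ring_1) dga \<Rightarrow> int \<Rightarrow> 'a \<Rightarrow> 'a \<Rightarrow> 'a" where
  "ad A n x = (THE h. is_ad A n x h)"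

text \<open>
  The pair \<open>(\<theta>, x)\<close> represents \<open>\<theta> + sx\<close>; in degree \<open>n\<close> the element \<open>x\<close> has degree
  \<open>n - 1\<close>. The last summand of the bracket is \<open>[sx, \<theta>'] = -(-1)\<^bsup>mn\<^esup> [\<theta>', sx]\<close>, as
  forced by graded antisymmetry.
\<close>

definition tDer_dgl ::
  "('k::comm_ring_1, 'a::ring_1) dga \<Rightarrow> ('k, ('a \<Rightarrow> 'a) \<times> 'a) dgl" where
  "tDer_dgl A =
     \<lparr>lscale = (\<lambda>c (\<theta>, x). (\<lambda>y. smul A c (\<theta> y), smul A c x)),
      lcar = (\<lambda>n. Der n A \<times> gr A (n - 1)),
      ldiff = (\<lambda>n (\<theta>, x).
        (\<lambda>y. comm_br (- 1) n (diff A) \<theta> y - ad A (n - 1) x y, - diff A x)),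
      lbr = (\<lambda>m n (\<theta>, x) (\<theta>', x').
        (comm_br m n \<theta> \<theta>',
         ksign m (\<theta> x') - ksign (m * n) (ksign n (\<theta>' x))))\<rparr>"


section \<open>The Hochschild complex\<close>

text \<open>
  Below, \<open>C\<close> with \<open>bar [a\<^sub>1, \<dots>, a\<^sub>k] = [a\<^sub>1|\<dots>|a\<^sub>k]\<close> is \<open>TC(sA)\<close>, that is,
  \<open>tensor_powers (susp A) C bar\<close>. The formulas for \<open>D\<^sub>0\<close> and \<open>D\<^sub>1\<close> are given on words
  of homogeneous elements and determine linear maps. List positions start at 0, so
  \<open>epsbar n is i\<close> is the exponent attached to \<open>a\<^bsub>i+1\<^esub>\<close> when \<open>|f| = n\<close> and
  \<open>is\<close> lists the degrees of the letters in \<open>A\<close> (each \<open>sa\<close> has degree \<open>|a| + 1\<close>).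

  In \<open>D\<^sub>0\<close> the differential in the \<open>i\<close>-th slot is the one of \<open>sA\<close>, which is
  \<open>d(sa) = -s(da)\<close> by the Koszul rule; thus \<open>D\<^sub>0 f = d \<circ> f - (-1)\<^bsup>|f|\<^esup> f \<circ> d\<close> with the
  tensor differential of \<open>TC(sA)\<close>. With \<open>+s(da)\<close> in its place \<open>D\<^sub>0 + D\<^sub>1\<close> would not
  square to zero.
\<close>

definition epsbar :: "int \<Rightarrow> int list \<Rightarrow> nat \<Rightarrow> int" where
  "epsbar n is i = n + (\<Sum>j<i. is ! j + 1)"

definition susp_diff :: "('k, 'a::ring_1) dga \<Rightarrow> 'a \<Rightarrow> 'a" where
  "susp_diff A a = - diff A a"

definition hoch_D0 ::
  "('k::comm_ring_1, 'a::ring_1) dga \<Rightarrow> ('k, 'c::ab_group_add) gmod \<Rightarrow> ('a list \<Rightarrow> 'c)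
     \<Rightarrow> int \<Rightarrow> ('c \<Rightarrow> 'a) \<Rightarrow> 'c \<Rightarrow> 'a" where
  "hoch_D0 A C bar n f = (THE g. g \<in> Hom (n - 1) C A \<and>
     (\<forall>is as. homog A is as \<longrightarrow>
        g (bar as) = diff A (f (bar as))
          - (\<Sum>i<length as. ksign (epsbar n is i) (f (bar (as[i := susp_diff A (as ! i)]))))))"

definition hoch_D1 ::
  "('k::comm_ring_1, 'a::ring_1) dga \<Rightarrow> ('k, 'c::ab_group_add) gmod \<Rightarrow> ('a list \<Rightarrow> 'c)
     \<Rightarrow> int \<Rightarrow> ('c \<Rightarrow> 'a) \<Rightarrow> 'c \<Rightarrow> 'a" where
  "hoch_D1 A C bar n f = (THE g. g \<in> Hom (n - 1) C A \<and>
     g (bar []) = 0 \<and>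
     (\<forall>is as. homog A is as \<and> as \<noteq> [] \<longrightarrow>
        g (bar as) =
          - ksign ((hd is + 1) * n) (hd as * f (bar (tl as)))
          - (\<Sum>i\<in>{1..<length as}. ksign (epsbar n is i)
               (f (bar (take (i - 1) as @ [as ! (i - 1) * as ! i] @ drop (i + 1) as))))
          + ksign (epsbar n is (length as - 1)) (f (bar (butlast as)) * last as)))"

text \<open>
  \<open>t\<close> exhibits a tensor product \<open>TC(sA) \<otimes> TC(sA)\<close>; the coproduct is deconcatenation.
\<close>

definition deconcat ::
  "('k::comm_ring_1, 'c::ab_group_add) gmod \<Rightarrow> ('a list \<Rightarrow> 'c)
     \<Rightarrow> ('k \<Rightarrow> 'e::ab_group_add \<Rightarrow> 'e) \<Rightarrow> ('c \<Rightarrow> 'c \<Rightarrow> 'e) \<Rightarrow> 'c \<Rightarrow> 'e" where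
  "deconcat C bar sc2 t = (THE \<Delta>. module_hom (smul C) sc2 \<Delta> \<and>
     (\<forall>as. \<Delta> (bar as) = (\<Sum>i\<le>length as. t (bar (take i as)) (bar (drop i as)))))"

text \<open>
  Coderivations \<open>\<beta>\<close> of degree \<open>m\<close>:
  \<open>\<Delta> \<circ> \<beta> = (\<beta> \<otimes> 1 + 1 \<otimes> \<beta>) \<circ> \<Delta>\<close>, where
  \<open>(1 \<otimes> \<beta>)(x \<otimes> y) = (-1)\<^bsup>m|x|\<^esup> x \<otimes> \<beta> y\<close>, evaluated on words of homogeneous elements.
\<close>

definition coderivation ::
  "('k::comm_ring_1, 'a::ring_1) dga \<Rightarrow> ('k, 'c::ab_group_add) gmod \<Rightarrow> ('a list \<Rightarrow> 'c)
     \<Rightarrow> ('k \<Rightarrow> 'e::ab_group_add \<Rightarrow> 'e) \<Rightarrow> ('c \<Rightarrow> 'c \<Rightarrow> 'e) \<Rightarrow> int \<Rightarrow> ('c \<Rightarrow> 'c) \<Rightarrow> bool" where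
  "coderivation A C bar sc2 t m \<beta> \<longleftrightarrow>
     \<beta> \<in> Hom m C C \<and>
     (\<forall>is as. homog (susp A) is as \<longrightarrow>
        deconcat C bar sc2 t (\<beta> (bar as)) =
          (\<Sum>i\<le>length as.
             t (\<beta> (bar (take i as))) (bar (drop i as))
             + ksign (m * sum_list (take i is)) (t (bar (take i as)) (\<beta> (bar (drop i as))))))"

definition bar_proj ::
  "('k::comm_ring_1, 'a::ring_1) dga \<Rightarrow> ('k, 'c::ab_group_add) gmod \<Rightarrow> ('a list \<Rightarrow> 'c)
     \<Rightarrow> 'c \<Rightarrow> 'a" where
  "bar_proj A C bar = (THE p. module_hom (smul C) (smul (susp A)) p \<and>
     (\<forall>a. p (bar [a]) = a) \<and> (\<forall>as. length as \<noteq> 1 \<longrightarrow> p (bar as) = 0))"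

text \<open>
  The coderivation \<open>\<beta>\<^sub>A(g)\<close> for \<open>|g| = n\<close>; the suspension \<open>s : A \<rightarrow> sA\<close> is the identity
  on underlying elements.
\<close>

definition hoch_beta ::
  "('k::comm_ring_1, 'a::ring_1) dga \<Rightarrow> ('k, 'c::ab_group_add) gmod \<Rightarrow> ('a list \<Rightarrow> 'c)
     \<Rightarrow> ('k \<Rightarrow> 'e::ab_group_add \<Rightarrow> 'e) \<Rightarrow> ('c \<Rightarrow> 'c \<Rightarrow> 'e) \<Rightarrow> int \<Rightarrow> ('c \<Rightarrow> 'a) \<Rightarrow> 'c \<Rightarrow> 'c" where
  "hoch_beta A C bar sc2 t n g = (THE \<beta>. coderivation A C bar sc2 t (n + 1) \<beta> \<and>
     (\<forall>x. bar_proj A C bar (\<beta> x) = g x))"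

text \<open>
  \<open>s\<^bold>C\<^sup>*(A; A)\<close>: the element \<open>sf\<close> of degree \<open>n\<close> is represented by \<open>f\<close>, of degree
  \<open>n - 1\<close>.
\<close>

definition hoch_dgl ::
  "('k::comm_ring_1, 'a::ring_1) dga \<Rightarrow> ('k, 'c::ab_group_add) gmod \<Rightarrow> ('a list \<Rightarrow> 'c)
     \<Rightarrow> ('k \<Rightarrow> 'e::ab_group_add \<Rightarrow> 'e) \<Rightarrow> ('c \<Rightarrow> 'c \<Rightarrow> 'e) \<Rightarrow> ('k, 'c \<Rightarrow> 'a) dgl" where
  "hoch_dgl A C bar sc2 t =
     \<lparr>lscale = (\<lambda>c f x. smul A c (f x)),
      lcar = (\<lambda>n. Hom (n - 1) C A),
      ldiff = (\<lambda>n f x. - (hoch_D0 A C bar (n - 1) f x + hoch_D1 A C bar (n - 1) f x)),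
      lbr = (\<lambda>m n f g x.
        f (hoch_beta A C bar sc2 t (n - 1) g x)
          - ksign (m * n) (g (hoch_beta A C bar sc2 t (m - 1) f x)))\<rparr>"


section \<open>The algebra on \<open>V \<oplus> \<k>\<epsilon>\<close>\<close>

text \<open>
  \<open>V \<oplus> \<k>\<epsilon>\<close> with \<open>|\<epsilon>| = -1\<close>; here \<open>\<epsilon> = (0, 1)\<close>.
\<close>

definition add_eps ::
  "('k::comm_ring_1, 'v::ab_group_add) gmod \<Rightarrow> ('k, 'v \<times> 'k) gmod" where
  "add_eps V =
     \<lparr>smul = (\<lambda>c (v, r). (smul V c v, c * r)),
      gr = (\<lambda>i. gr V i \<times> (if i = - 1 then UNIV else {0}))\<rparr>"

text \<open>
  For tensor algebras \<open>A = TV\<close> and \<open>B = T(V \<oplus> \<k>\<epsilon>)\<close> with canonical maps \<open>\<iota>\<close> and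
  \<open>\<iota>'\<close>: the map \<open>A \<rightarrow> B\<close> induced by the inclusion of \<open>V\<close>.
\<close>

definition tensor_incl ::
  "('k::comm_ring_1, 'a::ring_1) dga \<Rightarrow> ('v \<Rightarrow> 'a) \<Rightarrow> ('k, 'b::ring_1) gmod
     \<Rightarrow> ('v \<times> 'k \<Rightarrow> 'b) \<Rightarrow> 'a \<Rightarrow> 'b" where
  "tensor_incl A \<iota> B \<iota>' = (THE j. module_hom (smul A) (smul B) j \<and>
     (\<forall>vs. j (prod_list (map \<iota> vs)) = prod_list (map (\<lambda>v. \<iota>' (v, 0)) vs)))"

definition tilde_diff ::
  "('k::comm_ring_1, 'v::ab_group_add) gmod \<Rightarrow> ('k, 'a::ring_1) dga \<Rightarrow> ('v \<Rightarrow> 'a)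
     \<Rightarrow> ('k, 'b::ring_1) gmod \<Rightarrow> ('v \<times> 'k \<Rightarrow> 'b) \<Rightarrow> 'b \<Rightarrow> 'b" where
  "tilde_diff V A \<iota> B \<iota>' = (THE \<delta>. \<delta> \<in> Der (- 1) B \<and>
     \<delta> (\<iota>' (0, 1)) = \<iota>' (0, 1) * \<iota>' (0, 1) \<and>
     (\<forall>i. \<forall>v\<in>gr V i. \<delta> (\<iota>' (v, 0)) =
        tensor_incl A \<iota> B \<iota>' (diff A (\<iota> v))
          + \<iota>' (0, 1) * \<iota>' (v, 0) - ksign i (\<iota>' (v, 0) * \<iota>' (0, 1))))"

definition tilde_dga ::
  "('k::comm_ring_1, 'v::ab_group_add) gmod \<Rightarrow> ('k, 'a::ring_1) dga \<Rightarrow> ('v \<Rightarrow> 'a)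
     \<Rightarrow> ('k, 'b::ring_1) gmod \<Rightarrow> ('v \<times> 'k \<Rightarrow> 'b) \<Rightarrow> ('k, 'b) dga" where
  "tilde_dga V A \<iota> B \<iota>' =
     \<lparr>smul = smul B, gr = gr B, diff = tilde_diff V A \<iota> B \<iota>'\<rparr>"

end

theory Submission
  imports Defs
begin

text \<open>
  Both maps are injective maps of differential graded Lie algebras, so each is a
  quasi-isomorphism as soon as its cokernel is acyclic (\<open>injective_quasi_isoI\<close>).

  For the first map, a cochain on \<open>TC(sA)\<close> is the same as a coderivation of \<open>TC(sA)\<close>. The Gerstenhaber
  bracket becomes the commutator and the Hochschild differential becomes the commutator with the bar
  differential, so the Lie axioms hold because they hold for commutators. The map sends \<open>\<theta> + sx\<close> to the
  cochain that is \<open>x\<close> in length 0, \<open>\<plusminus>\<theta>\<close> in length 1 and zero in higher lengths. If \<open>A = TV\<close>, the bar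
  resolution of \<open>A\<close> by bimodules retracts onto the two-term resolution \<open>A \<otimes> V \<otimes> A \<rightarrow> A \<otimes> A\<close>, whose
  cochains are those of \<open>Der A \<oplus> sA\<close>; the contraction splits off one generator of the first letter at a
  time. The internal differential perturbs it: the perturbed contraction \<open>ghat\<close> satisfies a recursion
  that refers to \<open>ghat (d v)\<close> for generators \<open>v\<close>. As \<open>d v\<close> involves generators of lower level only,
  this recursion has a solution, obtained as the stationary limit of an iteration that consists of
  linear maps defined on all of \<open>V\<close> (\<open>solves\<close>, \<open>injective_quasi_iso_\<Phi>\<close>).

  For the second map, \<open>\<theta> + sx\<close> goes to the derivation of \<open>T(V \<oplus> \<k>\<epsilon>)\<close> that extends \<open>\<theta>\<close> and sends \<open>\<epsilon>\<close> to
  \<open>\<plusminus>x\<close>. Subtracting the inner derivation \<open>[\<epsilon>, -]\<close> from the differential leaves a differential \<open>dp\<close> that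
  extends \<open>d\<close> and has \<open>dp \<epsilon> = -\<epsilon>\<^sup>2\<close>. The ideal generated by \<open>\<epsilon>\<close> then is a differential graded
  \<open>A\<close>-bimodule with a contraction \<open>h\<close> that is linear over \<open>A\<close> (\<open>dp_h\<close>). A derivation with values in this
  ideal is contracted by composing its values on \<open>V\<close> and \<open>\<epsilon>\<close> with \<open>h\<close> (\<open>injective_quasi_iso_\<Psi>\<close>).

  Linear maps out of tensor powers are defined by recursion on the first letter (\<open>tfold\<close>), and Koszul
  signs are handled by the parity involution \<open>tw\<close>, which makes graded identities statements about all
  elements instead of homogeneous ones.
\<close>

section \<open>Modules given by generators and relators\<close>

lemma module_homI:
  assumes "module s1" "module s2"
    and "\<And>x y. f (x + y) = f x + f y" and "\<And>c x. f (s1 c x) = s2 c (f x)"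
  shows "module_hom s1 s2 f"
  using assms by (simp add: module_hom_iff)

lemma module_hom_comp:
  assumes "module_hom s2 s3 g" "module_hom s1 s2 f"
  shows "module_hom s1 s3 (\<lambda>x. g (f x))"
  using assms by (simp add: module_hom_iff)

lemma module_hom_plus:
  assumes f: "module_hom s1 s2 f" and g: "module_hom s1 s2 g"
  shows "module_hom s1 s2 (\<lambda>x. f x + g x)" "module_hom s1 s2 (\<lambda>x. f x - g x)"
proof -
  interpret f: module_hom s1 s2 f by fact
  interpret g: module_hom s1 s2 g by fact
  show "module_hom s1 s2 (\<lambda>x. f x + g x)" "module_hom s1 s2 (\<lambda>x. f x - g x)"
    by (unfold_locales, simp_all add: f.add g.add f.scale g.scale f.m2.scale_right_distrib
        f.m2.scale_right_diff_distrib)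
qed

lemma module_hom_multiple:
  assumes f: "module_hom s1 s2 f"
  shows "module_hom s1 s2 (\<lambda>x. - f x)" "module_hom s1 s2 (\<lambda>x. s2 c (f x))"
proof -
  interpret f: module_hom s1 s2 f by fact
  show "module_hom s1 s2 (\<lambda>x. - f x)" "module_hom s1 s2 (\<lambda>x. s2 c (f x))"
    by (unfold_locales, simp_all add: f.add f.scale f.m2.scale_right_distrib mult.commute)
qed

lemma module_pointwise:
  fixes s :: "'k::comm_ring_1 \<Rightarrow> 'b::ab_group_add \<Rightarrow> 'b"
  assumes "module s"
  shows "module (\<lambda>c (f :: 'a \<Rightarrow> 'b) x. s c (f x))"
proof -
  interpret module s by fact
  show ?thesis by standard (auto simp: fun_eq_iff scale_right_distrib scale_left_distrib)
qed

lemma module_times: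
  assumes "module s1" "module s2"
  shows "module (\<lambda>c (x, y). (s1 c x, s2 c y))"
proof -
  interpret s1: module s1 by fact
  interpret s2: module s2 by fact
  show ?thesis
    by standard (auto simp: s1.scale_right_distrib s1.scale_left_distrib
        s2.scale_right_distrib s2.scale_left_distrib)
qed

lemma module_self: "module ((*) :: 'k::comm_ring_1 \<Rightarrow> 'k \<Rightarrow> 'k)"
  by standard (auto simp: algebra_simps)

definition bilin where
  "bilin sM sN sP f \<longleftrightarrow>
     module sM \<and> (\<forall>x. module_hom sN sP (f x)) \<and> (\<forall>y. module_hom sM sP (\<lambda>x. f x y))"

lemma bilinI:
  assumes "module sM" "module sN" "module sP"
    and "\<And>x x' y. f (x + x') y = f x y + f x' y" "\<And>c x y. f (sM c x) y = sP c (f x y)"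
    and "\<And>x y y'. f x (y + y') = f x y + f x y'" "\<And>c x y. f x (sN c y) = sP c (f x y)"
  shows "bilin sM sN sP f"
  using assms by (simp add: bilin_def module_hom_iff)

lemma bilin_modules:
  assumes "bilin sM sN sP f"
  shows "module sM" "module sN" "module sP"
  using assms by (auto simp: bilin_def module_hom_iff)

lemma bilin_hom:
  assumes "bilin sM sN sP f"
  shows "module_hom sN sP (f x)" "module_hom sM sP (\<lambda>x. f x y)"
  using assms by (auto simp: bilin_def)

lemma bilin_simps:
  assumes "bilin sM sN sP f"
  shows "f (x + x') y = f x y + f x' y" "f (sM c x) y = sP c (f x y)"
    "f x (y + y') = f x y + f x y'" "f x (sN c y) = sP c (f x y)"
    "f 0 y = 0" "f x 0 = 0" "f (- x) y = - f x y" "f x (- y) = - f x y"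
    "f (x - x') y = f x y - f x' y" "f x (y - y') = f x y - f x y'"
  by (fact module_hom.add[OF bilin_hom(2)[OF assms]] module_hom.scale[OF bilin_hom(2)[OF assms]]
      module_hom.add[OF bilin_hom(1)[OF assms]] module_hom.scale[OF bilin_hom(1)[OF assms]]
      module_hom.zero[OF bilin_hom(2)[OF assms]] module_hom.zero[OF bilin_hom(1)[OF assms]]
      module_hom.neg[OF bilin_hom(2)[OF assms]] module_hom.neg[OF bilin_hom(1)[OF assms]]
      module_hom.diff[OF bilin_hom(2)[OF assms]] module_hom.diff[OF bilin_hom(1)[OF assms]])+

lemma bilin_sum_right:
  assumes "bilin sM sN sP f" shows "f x (sum g S) = (\<Sum>i\<in>S. f x (g i))"
  using bilin_hom(1)[OF assms] by (rule module_hom.sum)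

lemma lookup_fscale: "Poly_Mapping.lookup (fscale c p) x = c * Poly_Mapping.lookup p x"
  by (simp add: fscale_def Poly_Mapping.map.rep_eq when_def)

lemma module_fscale: "module (fscale :: 'k::comm_ring_1 \<Rightarrow> _)"
  by standard (auto intro!: poly_mapping_eqI simp: lookup_fscale lookup_add algebra_simps)

lemma lincomb_superset:
  assumes "module sc" "finite S" "Poly_Mapping.keys p \<subseteq> S"
  shows "lincomb sc w p = (\<Sum>x\<in>S. sc (Poly_Mapping.lookup p x) (w x))"
proof -
  interpret module sc by fact
  show ?thesis unfolding lincomb_def
    by (rule sum.mono_neutral_left) (use assms in \<open>auto simp: in_keys_iff\<close>)
qed

lemma lincomb_single: "module sc \<Longrightarrow> lincomb sc w (Poly_Mapping.single x c) = sc c (w x)"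
  by (simp add: lincomb_superset[where S = "{x}"])

lemma lincomb_hom:
  fixes w :: "'x \<Rightarrow> 'm::ab_group_add"
  assumes "module sc"
  shows "module_hom fscale sc (lincomb sc w)"
proof (rule module_homI[OF module_fscale assms])
  interpret module sc by fact
  fix p q :: "'x \<Rightarrow>\<^sub>0 'a" and c
  let ?S = "Poly_Mapping.keys p \<union> Poly_Mapping.keys q \<union> Poly_Mapping.keys (p + q)
     \<union> Poly_Mapping.keys (fscale c p)"
  have *: "lincomb sc w r = (\<Sum>x\<in>?S. sc (Poly_Mapping.lookup r x) (w x))"
    if "Poly_Mapping.keys r \<subseteq> ?S" for r
    by (rule lincomb_superset[OF assms _ that]) simp
  show "lincomb sc w (p + q) = lincomb sc w p + lincomb sc w q"
    by (subst (1 2 3) *) (auto simp: lookup_add scale_left_distrib sum.distrib)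
  show "lincomb sc w (fscale c p) = sc c (lincomb sc w p)"
    by (subst (1 2) *) (auto simp: lookup_fscale scale_sum_right)
qed

text \<open>
  The kernel of the linear extension of \<open>w\<close> is spanned by \<open>R\<close>, so the linear extension of \<open>\<Phi>\<close>, which
  kills \<open>R\<close>, factors through it.
\<close>

lemma presented_lift:
  assumes pres: "presented_by sT w R" and N: "module sN"
    and R: "\<And>r. r \<in> R \<Longrightarrow> lincomb sN \<Phi> r = 0"
  shows "\<exists>\<phi>. module_hom sT sN \<phi> \<and> (\<forall>x. \<phi> (w x) = \<Phi> x)"
proof -
  have T: "module sT" and surj: "range (lincomb sT w) = UNIV"
    and ker: "{p. lincomb sT w p = 0} = module.span fscale R"
    using pres by (auto simp: presented_by_def)
  interpret T: module sT by fact
  interpret lT: module_hom fscale sT "lincomb sT w" by (rule lincomb_hom[OF T])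
  interpret lN: module_hom fscale sN "lincomb sN \<Phi>" by (rule lincomb_hom[OF N])
  have kill: "lincomb sN \<Phi> p = 0" if "lincomb sT w p = 0" for p
  proof (rule lN.eq_0_on_span[OF R])
    show "p \<in> module.span fscale R" unfolding ker[symmetric] using that by simp
  qed
  define pre where "pre x = (SOME p. lincomb sT w p = x)" for x
  have pre: "lincomb sT w (pre x) = x" for x
  proof -
    have "x \<in> range (lincomb sT w)" by (simp add: surj)
    then have "\<exists>p. lincomb sT w p = x" by auto
    then show ?thesis unfolding pre_def by (rule someI_ex)
  qed
  have indep: "lincomb sN \<Phi> (pre x) = lincomb sN \<Phi> p" if "lincomb sT w p = x" for x p
    using kill[of "pre x - p"] that pre[of x] by (simp add: lT.diff lN.diff)
  have "module_hom sT sN (\<lambda>x. lincomb sN \<Phi> (pre x))"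
  proof (rule module_homI[OF T N])
    fix x y c
    show "lincomb sN \<Phi> (pre (x + y)) = lincomb sN \<Phi> (pre x) + lincomb sN \<Phi> (pre y)"
      using indep[of "pre x + pre y" "x + y"] by (simp add: lT.add lN.add pre)
    show "lincomb sN \<Phi> (pre (sT c x)) = sN c (lincomb sN \<Phi> (pre x))"
      using indep[of "fscale c (pre x)" "sT c x"] by (simp add: lT.scale lN.scale pre)
  qed
  moreover have "lincomb sN \<Phi> (pre (w x)) = \<Phi> x" for x
    using indep[of "Poly_Mapping.single x 1" "w x"] lN.m2.scale_one
    by (simp add: lincomb_single[OF T] lincomb_single[OF N])
  ultimately show ?thesis by blast
qed

lemma presented_induct:
  assumes pres: "presented_by sT w R"
    and w: "\<And>x. P (w x)" and add: "\<And>x y. P x \<Longrightarrow> P y \<Longrightarrow> P (x + y)"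
    and scale: "\<And>c x. P x \<Longrightarrow> P (sT c x)"
  shows "P t"
proof -
  have T: "module sT" and surj: "range (lincomb sT w) = UNIV"
    using pres by (auto simp: presented_by_def)
  interpret T: module sT by fact
  have 0: "P 0" using scale[OF w, of 0] by simp
  obtain p where p: "t = lincomb sT w p" using surj by blast
  have "P (\<Sum>x\<in>S. sT (Poly_Mapping.lookup p x) (w x))" if "finite S" for S
    using that by induction (auto intro: 0 add scale w)
  then show ?thesis by (simp add: p lincomb_def)
qed

lemma presented_hom_eq:
  assumes "presented_by sT w R" "module_hom sT sN f" "module_hom sT sN g"
    and "\<And>x. f (w x) = g (w x)"
  shows "f t = g t"
  by (rule presented_induct[OF assms(1)])
     (auto simp: assms(4) module_hom.add[OF assms(2)] module_hom.add[OF assms(3)]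
        module_hom.scale[OF assms(2)] module_hom.scale[OF assms(3)])

lemma presented_relator:
  assumes "presented_by sT w R" "r \<in> R"
  shows "lincomb sT w r = 0"
  using assms module.span_base[OF module_fscale assms(2)] by (auto simp: presented_by_def)

lemma lincomb_relator_simps:
  assumes "module sc"
  shows "lincomb sc w (p - q) = lincomb sc w p - lincomb sc w q"
    "lincomb sc w (Poly_Mapping.single x c) = sc c (w x)" "sc 1 y = y"
  using module_hom.diff[OF lincomb_hom[OF assms]] lincomb_single[OF assms] assms
  by (auto simp: module_def)

lemma tensor_product_bilin:
  assumes M: "module sM" and N: "module sN" and "tensor_product sM sN sP t"
  shows "bilin sM sN sP t"
proof -
  have pres: "presented_by sP (\<lambda>(x, y). t x y) (bilinear_relators sM sN)"
    using assms by (simp add: tensor_product_def)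
  then have P: "module sP" by (simp add: presented_by_def)
  note rel = presented_relator[OF pres]
  show ?thesis
  proof (rule bilinI[OF M N P])
    fix x x' y y' c
    have "Poly_Mapping.single (x + x', y) 1 - Poly_Mapping.single (x, y) 1
        - Poly_Mapping.single (x', y) 1 \<in> bilinear_relators sM sN"
      unfolding bilinear_relators_def by blast
    from rel[OF this] show "t (x + x') y = t x y + t x' y"
      by (simp add: lincomb_relator_simps[OF P] diff_eq_eq add.commute)
    have "Poly_Mapping.single (x, y + y') 1 - Poly_Mapping.single (x, y) 1
        - Poly_Mapping.single (x, y') 1 \<in> bilinear_relators sM sN"
      unfolding bilinear_relators_def by blast
    from rel[OF this] show "t x (y + y') = t x y + t x y'"
      by (simp add: lincomb_relator_simps[OF P] diff_eq_eq add.commute)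
    have "Poly_Mapping.single (sM c x, y) 1 - Poly_Mapping.single (x, y) c
        \<in> bilinear_relators sM sN"
      unfolding bilinear_relators_def by blast
    from rel[OF this] show "t (sM c x) y = sP c (t x y)"
      by (simp add: lincomb_relator_simps[OF P])
    have "Poly_Mapping.single (x, sN c y) 1 - Poly_Mapping.single (x, y) c
        \<in> bilinear_relators sM sN"
      unfolding bilinear_relators_def by blast
    from rel[OF this] show "t x (sN c y) = sP c (t x y)"
      by (simp add: lincomb_relator_simps[OF P])
  qed
qed

lemma tensor_product_lift:
  assumes "tensor_product sM sN sP t" and f: "bilin sM sN sQ f"
  shows "\<exists>\<phi>. module_hom sP sQ \<phi> \<and> (\<forall>x y. \<phi> (t x y) = f x y)"
proof -
  note Q = bilin_modules(3)[OF f]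
  interpret Q: module sQ by fact
  have "\<exists>\<phi>. module_hom sP sQ \<phi> \<and> (\<forall>p. \<phi> ((\<lambda>(x, y). t x y) p) = (\<lambda>(x, y). f x y) p)"
    by (rule presented_lift[OF _ Q, where R = "bilinear_relators sM sN"])
       (use assms(1) in \<open>auto simp: tensor_product_def bilinear_relators_def
          lincomb_relator_simps[OF Q] bilin_simps(1-4)[OF f]\<close>)
  then show ?thesis by auto
qed

lemma tensor_product_hom_eq:
  assumes "tensor_product sM sN sP t" "module_hom sP sQ f" "module_hom sP sQ g"
    and "\<And>x y. f (t x y) = g (t x y)"
  shows "f e = g e"
  by (rule presented_hom_eq[OF _ assms(2,3)]) (use assms(1,4) in \<open>auto simp: tensor_product_def\<close>)


section \<open>Graded modules and their parity involution\<close>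

lemma ksign_simps [simp]:
  "ksign n (0 :: 'a::group_add) = 0"
  "ksign 0 x = x"
  "ksign n (- x) = - ksign n (x :: 'a)"
  "ksign m (ksign n x) = ksign (m + n) (x :: 'a)"
  by (auto simp: ksign_def)

lemma ksign_add: "ksign n (x + y) = ksign n x + ksign n (y :: 'a::ab_group_add)"
  by (simp add: ksign_def)

lemma ksign_diff: "ksign n (x - y) = ksign n x - ksign n (y :: 'a::ab_group_add)"
  by (simp add: ksign_def)

lemma ksign_hom: "module_hom s1 s2 f \<Longrightarrow> f (ksign n x) = ksign n (f x)"
  by (simp add: ksign_def module_hom.neg)

lemma ksign_scale: "module s \<Longrightarrow> s c (ksign n x) = ksign n (s c x)"
  by (simp add: ksign_def module.scale_minus_right)

lemma ksign_mult:
  "ksign n x * y = ksign n (x * y)" "x * ksign n y = ksign n (x * (y :: 'a::ring))"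
  by (auto simp: ksign_def)

lemma ksign_subspace: "module s \<Longrightarrow> module.subspace s S \<Longrightarrow> x \<in> S \<Longrightarrow> ksign n x \<in> S"
  by (simp add: ksign_def module.subspace_neg)

lemma module_hom_ksign: "module_hom s1 s2 f \<Longrightarrow> module_hom s1 s2 (\<lambda>x. ksign n (f x))"
  by (cases "even n") (simp_all add: ksign_def module_hom_multiple)

lemma graded_module_module: "graded_module M \<Longrightarrow> module (smul M)"
  by (simp add: graded_module_def)

lemma graded_module_subspace: "graded_module M \<Longrightarrow> module.subspace (smul M) (gr M i)"
  by (simp add: graded_module_def)

definition dec :: "('k::comm_ring_1, 'a::ab_group_add, 'm) gmod_scheme \<Rightarrow> 'a \<Rightarrow> int \<Rightarrow>\<^sub>0 'a" where
  "dec M x = (THE c. (\<forall>i. Poly_Mapping.lookup c i \<in> gr M i) \<and>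
     x = (\<Sum>i\<in>Poly_Mapping.keys c. Poly_Mapping.lookup c i))"

lemma dec:
  assumes "graded_module M"
  shows "Poly_Mapping.lookup (dec M x) i \<in> gr M i"
    "(\<Sum>i\<in>Poly_Mapping.keys (dec M x). Poly_Mapping.lookup (dec M x) i) = x"
proof -
  have "\<exists>!c. (\<forall>i. Poly_Mapping.lookup c i \<in> gr M i) \<and>
     x = (\<Sum>i\<in>Poly_Mapping.keys c. Poly_Mapping.lookup c i)"
    using assms by (simp add: graded_module_def)
  from theI'[OF this] show "Poly_Mapping.lookup (dec M x) i \<in> gr M i"
    "(\<Sum>i\<in>Poly_Mapping.keys (dec M x). Poly_Mapping.lookup (dec M x) i) = x"
    unfolding dec_def by auto
qed

lemma dec_unique:
  assumes "graded_module M" "\<And>i. Poly_Mapping.lookup c i \<in> gr M i"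
    "finite S" "Poly_Mapping.keys c \<subseteq> S" "(\<Sum>i\<in>S. Poly_Mapping.lookup c i) = x"
  shows "dec M x = c"
proof -
  have "\<exists>!c. (\<forall>i. Poly_Mapping.lookup c i \<in> gr M i) \<and>
     x = (\<Sum>i\<in>Poly_Mapping.keys c. Poly_Mapping.lookup c i)"
    using assms by (simp add: graded_module_def)
  moreover have "(\<Sum>i\<in>Poly_Mapping.keys c. Poly_Mapping.lookup c i) = x"
    unfolding assms(5)[symmetric]
    by (rule sum.mono_neutral_left) (use assms in \<open>auto simp: in_keys_iff\<close>)
  ultimately show ?thesis unfolding dec_def using assms(2)
    by (intro the1_equality) auto
qed

lemma graded_induct:
  assumes "graded_module M"
    and "\<And>i x. x \<in> gr M i \<Longrightarrow> P x" and "\<And>x y. P x \<Longrightarrow> P y \<Longrightarrow> P (x + y)"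
  shows "P x"
proof -
  have 0: "P 0"
    using assms(2)[of 0 0] assms(1) module.subspace_0
    by (blast dest: graded_module_module graded_module_subspace)
  have "P (\<Sum>i\<in>S. Poly_Mapping.lookup (dec M x) i)" if "finite S" for S
    using that by induction (auto intro: 0 assms(3) assms(2) dec(1)[OF assms(1)])
  from this[of "Poly_Mapping.keys (dec M x)"] show ?thesis using dec(2)[OF assms(1)] by simp
qed

text \<open>
  A linear map may be defined by a different formula in each degree. This is how signs depending on
  the degree of an element become linear maps.
\<close>

lemma graded_lift:
  assumes gM: "graded_module M" and N: "module sN"
    and add: "\<And>i x y. x \<in> gr M i \<Longrightarrow> y \<in> gr M i \<Longrightarrow> f i (x + y) = f i x + f i y"
    and scale: "\<And>i c x. x \<in> gr M i \<Longrightarrow> f i (smul M c x) = sN c (f i x)"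
  shows "\<exists>\<phi>. module_hom (smul M) sN \<phi> \<and> (\<forall>i. \<forall>x\<in>gr M i. \<phi> x = f i x)"
proof -
  note M = graded_module_module[OF gM] and sub = graded_module_subspace[OF gM]
  interpret M: module "smul M" by (rule M)
  note l = dec(1)[OF gM]
  have f0: "f i 0 = 0" for i using add[of 0 i 0] M.subspace_0[OF sub[of i]] by simp
  define \<phi> where "\<phi> x = (\<Sum>i\<in>Poly_Mapping.keys (dec M x). f i (Poly_Mapping.lookup (dec M x) i))" for x
  have sup: "\<phi> x = (\<Sum>i\<in>S. f i (Poly_Mapping.lookup (dec M x) i))"
    if "finite S" "Poly_Mapping.keys (dec M x) \<subseteq> S" for x S
    unfolding \<phi>_def by (rule sum.mono_neutral_left) (use that f0 in \<open>auto simp: in_keys_iff\<close>)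
  \<comment> \<open>Sums over the support may be taken over any larger finite set, whence additivity.\<close>
  have dsup: "(\<Sum>i\<in>S. Poly_Mapping.lookup (dec M x) i) = x"
    if "finite S" "Poly_Mapping.keys (dec M x) \<subseteq> S" for x S
    by (rule trans[OF sum.mono_neutral_right dec(2)[OF gM, of x]])
       (use that in \<open>auto simp: in_keys_iff\<close>)
  have dadd: "dec M (x + y) = dec M x + dec M y" for x y
  proof (rule dec_unique[OF gM])
    let ?S = "Poly_Mapping.keys (dec M x) \<union> Poly_Mapping.keys (dec M y)"
    show "Poly_Mapping.lookup (dec M x + dec M y) i \<in> gr M i" for i
      unfolding lookup_add by (rule M.subspace_add[OF sub l l])
    show "finite ?S" "Poly_Mapping.keys (dec M x + dec M y) \<subseteq> ?S"
      using keys_add[of "dec M x" "dec M y"] by auto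
    show "(\<Sum>i\<in>?S. Poly_Mapping.lookup (dec M x + dec M y) i) = x + y"
      by (simp add: lookup_add sum.distrib dsup)
  qed
  define sd where "sd c x = Poly_Mapping.map (smul M c) (dec M x)" for c x
  have lsd: "Poly_Mapping.lookup (sd c x) i = smul M c (Poly_Mapping.lookup (dec M x) i)" for c x i
    by (simp add: sd_def Poly_Mapping.map.rep_eq when_def)
  have ksd: "Poly_Mapping.keys (sd c x) \<subseteq> Poly_Mapping.keys (dec M x)" for c x
    by (auto simp: in_keys_iff lsd)
  have dscale: "dec M (smul M c x) = sd c x" for c x
  proof (rule dec_unique[OF gM _ finite_keys ksd])
    show "Poly_Mapping.lookup (sd c x) i \<in> gr M i" for i
      unfolding lsd by (rule M.subspace_scale[OF sub l])
    show "(\<Sum>i\<in>Poly_Mapping.keys (dec M x). Poly_Mapping.lookup (sd c x) i) = smul M c x"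
      by (simp add: lsd M.scale_sum_right[symmetric] dec(2)[OF gM])
  qed
  have dhom: "dec M x = Poly_Mapping.single i x" if "x \<in> gr M i" for x i
    by (rule dec_unique[OF gM, where S = "{i}"])
       (use that in \<open>auto simp: lookup_single when_def M.subspace_0 sub\<close>)
  interpret N: module sN by fact
  have "module_hom (smul M) sN \<phi>"
  proof (rule module_homI[OF M N])
    fix x y c
    let ?S = "Poly_Mapping.keys (dec M x) \<union> Poly_Mapping.keys (dec M y) \<union>
       Poly_Mapping.keys (dec M x + dec M y)"
    show "\<phi> (x + y) = \<phi> x + \<phi> y"
      by (subst (1 2 3) sup[where S = ?S]) (auto simp: dadd lookup_add add l sum.distrib)
    show "\<phi> (smul M c x) = sN c (\<phi> x)"
      by (subst (1 2) sup[where S = "Poly_Mapping.keys (dec M x)"])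
         (use ksd[of c x] in \<open>auto simp: dscale lsd scale l N.scale_sum_right\<close>)
  qed
  moreover have "\<phi> x = f i x" if "x \<in> gr M i" for i x
    using f0 by (simp add: \<phi>_def dhom[OF that])
  ultimately show ?thesis by blast
qed

text \<open>
  The projections \<open>\<pi> p\<close> read off the components of any decomposition, which gives uniqueness. Existence
  is expressed by sums over all large finite sets of degrees, as this form is stable under addition.
\<close>

lemma graded_moduleI:
  assumes M: "module (smul M)" and sub: "\<And>i. module.subspace (smul M) (gr M i)"
    and \<pi>: "\<And>p. module_hom (smul M) (smul M) (\<pi> p)"
    and \<pi>_gr: "\<And>p q x. x \<in> gr M q \<Longrightarrow> \<pi> p x = (if p = q then x else 0)"
    and \<pi>_in: "\<And>p x. \<pi> p x \<in> gr M p"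
    and fin: "\<And>x. \<exists>S. finite S \<and> (\<forall>S'. finite S' \<longrightarrow> S \<subseteq> S' \<longrightarrow> (\<Sum>p\<in>S'. \<pi> p x) = x)"
  shows "graded_module M"
proof -
  interpret M: module "smul M" by fact
  have ex: "\<exists>c. (\<forall>i. Poly_Mapping.lookup c i \<in> gr M i) \<and>
       x = (\<Sum>i\<in>Poly_Mapping.keys c. Poly_Mapping.lookup c i)" for x
  proof -
    obtain S where S0: "finite S \<and> (\<forall>S'. finite S' \<longrightarrow> S \<subseteq> S' \<longrightarrow> (\<Sum>p\<in>S'. \<pi> p x) = x)"
      using fin[of x] ..
    then have S: "finite S" "\<And>S'. finite S' \<Longrightarrow> S \<subseteq> S' \<Longrightarrow> (\<Sum>p\<in>S'. \<pi> p x) = x"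
      by simp_all
    have supp: "\<pi> p x = 0" if "p \<notin> S" for p
    proof -
      have "(\<Sum>q\<in>insert p S. \<pi> q x) = (\<Sum>q\<in>S. \<pi> q x)"
        by (rule trans[OF S(2) S(2)[symmetric]]) (use S(1) in auto)
      then show ?thesis using S(1) that by simp
    qed
    then have "{p. \<pi> p x \<noteq> 0} \<subseteq> S" by blast
    then have fs: "finite {p. \<pi> p x \<noteq> 0}" using S(1) finite_subset by blast
    define c where "c = Abs_poly_mapping (\<lambda>p. \<pi> p x)"
    have c: "Poly_Mapping.lookup c p = \<pi> p x" for p unfolding c_def using fs by simp
    have "(\<Sum>p\<in>Poly_Mapping.keys c. \<pi> p x) = (\<Sum>p\<in>S. \<pi> p x)"
    proof (rule sum.mono_neutral_left[OF S(1)])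
      show "Poly_Mapping.keys c \<subseteq> S"
      proof
        fix p assume "p \<in> Poly_Mapping.keys c"
        then show "p \<in> S" using supp[of p] by (cases "p \<in> S") (auto simp: c in_keys_iff)
      qed
      show "\<forall>p\<in>S - Poly_Mapping.keys c. \<pi> p x = 0" by (simp add: in_keys_iff c)
    qed
    then have "x = (\<Sum>p\<in>Poly_Mapping.keys c. Poly_Mapping.lookup c p)"
      unfolding c by (rule trans[OF S(2)[OF S(1) subset_refl, symmetric] sym])
    moreover have "\<forall>p. Poly_Mapping.lookup c p \<in> gr M p" using \<pi>_in by (simp add: c)
    ultimately show ?thesis by (intro exI[of _ c] conjI)
  qed
  have *: "Poly_Mapping.lookup c p = \<pi> p x" if "\<forall>i. Poly_Mapping.lookup c i \<in> gr M i"
    "x = (\<Sum>i\<in>Poly_Mapping.keys c. Poly_Mapping.lookup c i)" for c x p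
  proof -
    have "\<pi> p x = (\<Sum>i\<in>Poly_Mapping.keys c. \<pi> p (Poly_Mapping.lookup c i))"
      unfolding that(2) by (rule module_hom.sum[OF \<pi>])
    also have "\<dots> = (\<Sum>i\<in>Poly_Mapping.keys c. if p = i then Poly_Mapping.lookup c i else 0)"
      using that(1) by (intro sum.cong) (auto simp: \<pi>_gr)
    also have "\<dots> = Poly_Mapping.lookup c p" by (simp add: in_keys_iff)
    finally show ?thesis by simp
  qed
  have "\<exists>!c. (\<forall>i. Poly_Mapping.lookup c i \<in> gr M i) \<and>
       x = (\<Sum>i\<in>Poly_Mapping.keys c. Poly_Mapping.lookup c i)" for x
  proof (rule ex_ex1I[OF ex])
    fix c c' assume c: "(\<forall>i. Poly_Mapping.lookup c i \<in> gr M i) \<and>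
       x = (\<Sum>i\<in>Poly_Mapping.keys c. Poly_Mapping.lookup c i)"
      and c': "(\<forall>i. Poly_Mapping.lookup c' i \<in> gr M i) \<and>
       x = (\<Sum>i\<in>Poly_Mapping.keys c'. Poly_Mapping.lookup c' i)"
    show "c = c'"
      by (rule poly_mapping_eqI)
        (simp only: *[OF conjunct1[OF c] conjunct2[OF c]] *[OF conjunct1[OF c'] conjunct2[OF c']])
  qed
  then show ?thesis unfolding graded_module_def using M sub by blast
qed

lemma graded_projections:
  assumes M: "graded_module M"
  shows "\<exists>\<pi>. (\<forall>p. module_hom (smul M) (smul M) (\<pi> p)) \<and>
    (\<forall>p q. \<forall>x\<in>gr M q. \<pi> p x = (if p = q then x else 0)) \<and> (\<forall>p x. \<pi> p x \<in> gr M p) \<and>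
    (\<forall>x. \<exists>S. finite S \<and> (\<forall>S'. finite S' \<longrightarrow> S \<subseteq> S' \<longrightarrow> (\<Sum>p\<in>S'. \<pi> p x) = x))"
proof -
  note m = graded_module_module[OF M] and sub = graded_module_subspace[OF M]
  have "\<exists>\<phi>. module_hom (smul M) (smul M) \<phi> \<and> (\<forall>i. \<forall>x\<in>gr M i. \<phi> x = (if p = i then x else 0))" for p
    by (rule graded_lift[OF M m]) (simp_all add: module.scale_zero_right[OF m])
  then have "\<forall>p. \<exists>\<phi>. module_hom (smul M) (smul M) \<phi> \<and> (\<forall>i. \<forall>x\<in>gr M i. \<phi> x = (if p = i then x else 0))" ..
  from choice[OF this] obtain \<pi> where
    \<pi>: "\<forall>p. module_hom (smul M) (smul M) (\<pi> p) \<and> (\<forall>i. \<forall>x\<in>gr M i. \<pi> p x = (if p = i then x else 0))" ..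
  then have hom: "module_hom (smul M) (smul M) (\<pi> p)" and eq: "x \<in> gr M i \<Longrightarrow> \<pi> p x = (if p = i then x else 0)"
    for p i x by blast+
  have "\<pi> p x \<in> gr M p" for p x
  proof (induction x rule: graded_induct[OF M])
    case (1 i x) then show ?case by (simp add: eq module.subspace_0[OF m sub])
  next
    case (2 x y) then show ?case by (simp add: module_hom.add[OF hom] module.subspace_add[OF m sub])
  qed
  moreover have "\<exists>S. finite S \<and> (\<forall>S'. finite S' \<longrightarrow> S \<subseteq> S' \<longrightarrow> (\<Sum>p\<in>S'. \<pi> p x) = x)" for x
  proof (induction x rule: graded_induct[OF M])
    case (1 i x)
    then show ?case by (intro exI[of _ "{i}"]) (simp add: eq)
  next
    case (2 x y)
    obtain S where S: "finite S \<and> (\<forall>S'. finite S' \<longrightarrow> S \<subseteq> S' \<longrightarrow> (\<Sum>p\<in>S'. \<pi> p x) = x)" using 2(1) ..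
    obtain R where R: "finite R \<and> (\<forall>S'. finite S' \<longrightarrow> R \<subseteq> S' \<longrightarrow> (\<Sum>p\<in>S'. \<pi> p y) = y)" using 2(2) ..
    from S R show ?case
      by (intro exI[of _ "S \<union> R"]) (simp add: module_hom.add[OF hom] sum.distrib)
  qed
  ultimately show ?thesis using hom eq by (intro exI[of _ \<pi>] conjI allI ballI)
qed

text \<open>
  The involution acting on degree \<open>i\<close> by \<open>(-1)\<^bsup>n i\<^esup>\<close>. With it the Koszul signs become linear maps and
  graded identities can be stated for all elements.
\<close>

definition tw ::
  "('k::comm_ring_1, 'a::ab_group_add, 'm) gmod_scheme \<Rightarrow> int \<Rightarrow> 'a \<Rightarrow> 'a" where
  "tw M n = (SOME \<tau>. module_hom (smul M) (smul M) \<tau> \<and> (\<forall>i. \<forall>x\<in>gr M i. \<tau> x = ksign (n * i) x))"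

lemma
  assumes "graded_module M"
  shows tw_hom: "module_hom (smul M) (smul M) (tw M n)"
    and tw_gr: "x \<in> gr M i \<Longrightarrow> tw M n x = ksign (n * i) x"
proof -
  note M = graded_module_module[OF assms]
  have "\<exists>\<tau>. module_hom (smul M) (smul M) \<tau> \<and> (\<forall>i. \<forall>x\<in>gr M i. \<tau> x = ksign (n * i) x)"
    by (rule graded_lift[OF assms M]) (auto simp: ksign_add ksign_scale[OF M])
  from someI_ex[OF this, folded tw_def]
  show "module_hom (smul M) (smul M) (tw M n)"
    "x \<in> gr M i \<Longrightarrow> tw M n x = ksign (n * i) x" by auto
qed

lemma graded_hom_eq:
  assumes "graded_module M" "module_hom (smul M) sN f" "module_hom (smul M) sN g"
    and "\<And>i x. x \<in> gr M i \<Longrightarrow> f x = g x"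
  shows "f x = g x"
  by (rule graded_induct[OF assms(1)])
     (auto simp: assms(4) module_hom.add[OF assms(2)] module_hom.add[OF assms(3)])

lemma tw_tw:
  assumes M: "graded_module M" shows "tw M m (tw M n x) = tw M (m + n) x"
  by (rule graded_hom_eq[OF M module_hom_comp[OF tw_hom[OF M] tw_hom[OF M]] tw_hom[OF M]])
     (simp add: tw_gr[OF M] ksign_hom[OF tw_hom[OF M]] algebra_simps)

lemma tw_even:
  assumes M: "graded_module M" and "even n" shows "tw M n x = x"
  by (rule graded_hom_eq[OF M tw_hom[OF M] module.module_hom_ident[OF graded_module_module[OF M]]])
     (simp add: tw_gr[OF M] ksign_def assms(2))

lemma tw_parity: "graded_module M \<Longrightarrow> even (m - n) \<Longrightarrow> tw M m x = tw M n x"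
  using tw_tw[of M "m - n" n x] by (simp add: tw_even)

lemma HomD:
  assumes "f \<in> Hom n M N"
  shows "module_hom (smul M) (smul N) f" "x \<in> gr M l \<Longrightarrow> f x \<in> gr N (l + n)"
  using assms by (auto simp: Hom_def)

lemma HomI:
  assumes "module_hom (smul M) (smul N) f" "\<And>l x. x \<in> gr M l \<Longrightarrow> f x \<in> gr N (l + n)"
  shows "f \<in> Hom n M N"
  using assms by (auto simp: Hom_def)

lemma Hom_tw:
  assumes M: "graded_module M" and N: "graded_module N" and f: "f \<in> Hom n M N"
  shows "f (tw M m x) = ksign (m * n) (tw N m (f x))"
proof (rule graded_hom_eq[OF M, where sN = "smul N"])
  show "module_hom (smul M) (smul N) (\<lambda>x. f (tw M m x))"
    by (rule module_hom_comp[OF HomD(1)[OF f] tw_hom[OF M]])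
  show "module_hom (smul M) (smul N) (\<lambda>x. ksign (m * n) (tw N m (f x)))"
    by (rule module_hom_ksign[OF module_hom_comp[OF tw_hom[OF N] HomD(1)[OF f]]])
  show "f (tw M m x) = ksign (m * n) (tw N m (f x))" if "x \<in> gr M i" for i x
    using HomD(2)[OF f that] that
    by (simp add: tw_gr[OF M] tw_gr[OF N] module_hom.neg[OF HomD(1)[OF f]] ksign_def)
qed

lemma tw_in_gr: "graded_module M \<Longrightarrow> x \<in> gr M i \<Longrightarrow> tw M n x \<in> gr M i"
  by (simp add: tw_gr ksign_subspace[OF graded_module_module] graded_module_subspace)


section \<open>Tensor powers as words\<close>

lemma word_multilinear:
  assumes "tensor_powers V T w"
  shows "w (xs @ (u + v) # ys) = w (xs @ u # ys) + w (xs @ v # ys)"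
    and "w (xs @ smul V c v # ys) = smul T c (w (xs @ v # ys))"
proof -
  have pres: "presented_by (smul T) w (multilinear_relators (smul V))"
    using assms by (simp add: tensor_powers_def)
  then have T: "module (smul T)" by (simp add: presented_by_def)
  note rel = presented_relator[OF pres]
  have "Poly_Mapping.single (xs @ (u + v) # ys) 1 - Poly_Mapping.single (xs @ u # ys) 1
      - Poly_Mapping.single (xs @ v # ys) 1 \<in> multilinear_relators (smul V)"
    unfolding multilinear_relators_def by blast
  from rel[OF this] show "w (xs @ (u + v) # ys) = w (xs @ u # ys) + w (xs @ v # ys)"
    by (simp add: lincomb_relator_simps[OF T] diff_eq_eq add.commute)
  have "Poly_Mapping.single (xs @ smul V c v # ys) 1 - Poly_Mapping.single (xs @ v # ys) c
      \<in> multilinear_relators (smul V)"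
    unfolding multilinear_relators_def by blast
  from rel[OF this] show "w (xs @ smul V c v # ys) = smul T c (w (xs @ v # ys))"
    by (simp add: lincomb_relator_simps[OF T])
qed

lemma word_lift:
  assumes "tensor_powers V T w" and N: "module sN"
    and add: "\<And>xs u v ys. \<Phi> (xs @ (u + v) # ys) = \<Phi> (xs @ u # ys) + \<Phi> (xs @ v # ys)"
    and scale: "\<And>xs c v ys. \<Phi> (xs @ smul V c v # ys) = sN c (\<Phi> (xs @ v # ys))"
  shows "\<exists>\<phi>. module_hom (smul T) sN \<phi> \<and> (\<forall>vs. \<phi> (w vs) = \<Phi> vs)"
  by (rule presented_lift[OF _ N, where R = "multilinear_relators (smul V)"])
     (use assms(1) in \<open>auto simp: tensor_powers_def multilinear_relators_def
        lincomb_relator_simps[OF N] add scale\<close>)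

text \<open>
  Putting a letter in front of a word is multilinear in the word, hence defined on tensors. All later
  recursions and inductions on tensors use this operation as the list constructor.
\<close>

lemma tensor_powers_cons:
  assumes V: "module (smul V)" and tp: "tensor_powers V T w"
  shows "\<exists>cons. bilin (smul V) (smul T) (smul T) cons \<and> (\<forall>v vs. cons v (w vs) = w (v # vs))"
proof -
  have pres: "presented_by (smul T) w (multilinear_relators (smul V))"
    using tp by (simp add: tensor_powers_def)
  then have T: "module (smul T)" by (simp add: presented_by_def)
  interpret T: module "smul T" by fact
  have "\<exists>f. module_hom (smul T) (smul T) f \<and> (\<forall>vs. f (w vs) = w (v # vs))" for v
    by (rule word_lift[OF tp T]) (use word_multilinear[OF tp, of "v # xs" for xs] in simp_all)
  then obtain cons where c: "\<And>v. module_hom (smul T) (smul T) (cons v)"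
    "\<And>v vs. cons v (w vs) = w (v # vs)" by metis
  have "bilin (smul V) (smul T) (smul T) cons"
  proof (rule bilinI[OF V T T])
    fix u v x y a
    note m = word_multilinear[OF tp, of "[]", simplified]
    show "cons (u + v) y = cons u y + cons v y"
      by (rule presented_hom_eq[OF pres c(1) module_hom_plus(1)[OF c(1) c(1)]]) (simp add: c(2) m)
    show "cons (smul V a v) y = smul T a (cons v y)"
      by (rule presented_hom_eq[OF pres c(1) module_hom_multiple(2)[OF c(1)]]) (simp add: c(2) m)
  qed (simp_all add: module_hom.add[OF c(1)] module_hom.scale[OF c(1)])
  with c(2) show ?thesis by blast
qed

locale tpow =
  fixes V :: "('k::comm_ring_1, 'v::ab_group_add, 'm) gmod_scheme"
    and T :: "('k, 't::ab_group_add, 'n) gmod_scheme"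
    and w :: "'v list \<Rightarrow> 't"
    and cons :: "'v \<Rightarrow> 't \<Rightarrow> 't"
  assumes graded_V: "graded_module V"
    and tensor_powers: "tensor_powers V T w"
    and cons_bilin: "bilin (smul V) (smul T) (smul T) cons"
    and cons_word: "cons v (w vs) = w (v # vs)"
begin

lemmas module_V = graded_module_module[OF graded_V]

lemma presented: "presented_by (smul T) w (multilinear_relators (smul V))"
  using tensor_powers by (simp add: tensor_powers_def)

lemma module_T: "module (smul T)"
  using presented by (simp add: presented_by_def)

lemma gr_T: "gr T p = module.span (smul T) {w vs | vs is. homog V is vs \<and> sum_list is = p}"
  using tensor_powers by (simp add: tensor_powers_def)

lemma subspace_gr_T: "module.subspace (smul T) (gr T p)"
  unfolding gr_T by (rule module.subspace_span[OF module_T])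

lemmas cons_simps = bilin_simps[OF cons_bilin]

lemma cons_induct [case_names unit cons add scale]:
  assumes unit: "P (w [])" and cons: "\<And>v x. P x \<Longrightarrow> P (cons v x)"
    and add: "\<And>x y. P x \<Longrightarrow> P y \<Longrightarrow> P (x + y)" and scale: "\<And>c x. P x \<Longrightarrow> P (smul T c x)"
  shows "P x"
proof (rule presented_induct[OF presented _ add scale])
  show "P (w vs)" for vs
    by (induction vs) (auto simp: unit cons_word[symmetric] intro: cons)
qed

lemma hom_eq:
  assumes f: "module_hom (smul T) sN f" and g: "module_hom (smul T) sN g"
    and "f (w []) = g (w [])" and "\<And>v x. f x = g x \<Longrightarrow> f (cons v x) = g (cons v x)"
  shows "f x = g x"
  by (induction x rule: cons_induct)
     (simp_all add: assms(3,4) module_hom.add[OF f] module_hom.add[OF g]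
        module_hom.scale[OF f] module_hom.scale[OF g])

text \<open>
  A linear map out of \<open>T\<close> is defined by primitive recursion on the first letter, just as a
  function on lists, as soon as the recursion step is linear in the letter, and jointly linear in
  the remaining tensor and the value of the map on it.
\<close>

definition rec_step :: "('k \<Rightarrow> 'x::ab_group_add \<Rightarrow> 'x) \<Rightarrow> ('v \<Rightarrow> 't \<Rightarrow> 'x \<Rightarrow> 'x) \<Rightarrow> bool" where
  "rec_step sN K \<longleftrightarrow> module sN \<and>
     (\<forall>u v x y. K (u + v) x y = K u x y + K v x y) \<and>
     (\<forall>c v x y. K (smul V c v) x y = sN c (K v x y)) \<and>
     (\<forall>v x x' y y'. K v (x + x') (y + y') = K v x y + K v x' y') \<and>
     (\<forall>c v x y. K v (smul T c x) (sN c y) = sN c (K v x y))"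

definition tfold :: "('k \<Rightarrow> 'x::ab_group_add \<Rightarrow> 'x) \<Rightarrow> 'x \<Rightarrow> ('v \<Rightarrow> 't \<Rightarrow> 'x \<Rightarrow> 'x) \<Rightarrow> 't \<Rightarrow> 'x"
  where "tfold sN z K = (SOME \<phi>. module_hom (smul T) sN \<phi> \<and> \<phi> (w []) = z \<and>
     (\<forall>v x. \<phi> (cons v x) = K v x (\<phi> x)))"

lemma tfold:
  assumes K: "rec_step sN K"
  shows "module_hom (smul T) sN (tfold sN z K)"
    and "tfold sN z K (w []) = z"
    and "tfold sN z K (cons v x) = K v x (tfold sN z K x)"
proof -
  have N: "module sN" using K by (simp add: rec_step_def)
  define \<Phi> where "\<Phi> = rec_list z (\<lambda>v vs. K v (w vs))"
  have \<Phi>: "\<Phi> [] = z" "\<Phi> (v # vs) = K v (w vs) (\<Phi> vs)" for v vs by (simp_all add: \<Phi>_def)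
  note m = word_multilinear[OF tensor_powers]
  have "\<exists>\<phi>. module_hom (smul T) sN \<phi> \<and> (\<forall>vs. \<phi> (w vs) = \<Phi> vs)"
  proof (rule word_lift[OF tensor_powers N])
    fix xs u v ys c
    show "\<Phi> (xs @ (u + v) # ys) = \<Phi> (xs @ u # ys) + \<Phi> (xs @ v # ys)"
      using K by (induction xs) (simp_all add: \<Phi> m rec_step_def)
    show "\<Phi> (xs @ smul V c v # ys) = sN c (\<Phi> (xs @ v # ys))"
      using K by (induction xs) (simp_all add: \<Phi> m rec_step_def)
  qed
  then obtain \<phi> where \<phi>: "module_hom (smul T) sN \<phi>" "\<And>vs. \<phi> (w vs) = \<Phi> vs" by blast
  have "\<phi> (cons v x) = K v x (\<phi> x)" for v x
  proof (rule presented_induct[OF presented])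
    show "\<phi> (cons v (w vs)) = K v (w vs) (\<phi> (w vs))" for vs by (simp add: cons_word \<phi>(2) \<Phi>)
  qed (use K in \<open>simp_all add: cons_simps module_hom.add[OF \<phi>(1)] module_hom.scale[OF \<phi>(1)]
        rec_step_def\<close>)
  then have "\<exists>\<phi>. module_hom (smul T) sN \<phi> \<and> \<phi> (w []) = z \<and> (\<forall>v x. \<phi> (cons v x) = K v x (\<phi> x))"
    using \<phi> \<Phi>(1) by auto
  from someI_ex[OF this, folded tfold_def]
  show "module_hom (smul T) sN (tfold sN z K)" "tfold sN z K (w []) = z"
    "tfold sN z K (cons v x) = K v x (tfold sN z K x)" by auto
qed

lemma word_gr: "homog V is vs \<Longrightarrow> w vs \<in> gr T (sum_list is)"
  unfolding gr_T by (rule module.span_base[OF module_T]) blast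

lemma unit_gr: "w [] \<in> gr T 0"
  using word_gr[of "[]" "[]"] by (simp add: homog_def)

lemma homog_Cons: "homog V is (v # vs) \<longleftrightarrow> (\<exists>i js. is = i # js \<and> v \<in> gr V i \<and> homog V js vs)"
  by (simp add: homog_def list_all2_Cons2)

lemma gr_word_induct:
  assumes "x \<in> gr T p" and S: "module.subspace (smul T) {x. P x}"
    and "\<And>is vs. homog V is vs \<Longrightarrow> sum_list is = p \<Longrightarrow> P (w vs)"
  shows "P x"
  using assms(1) unfolding gr_T
  by (rule module.span_induct[OF module_T _ S]) (use assms(3) in auto)

lemma cons_gr:
  assumes "v \<in> gr V i" "x \<in> gr T p"
  shows "cons v x \<in> gr T (i + p)"
proof (rule gr_word_induct[OF assms(2)])
  show "module.subspace (smul T) {x. cons v x \<in> gr T (i + p)}"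
    using module_hom.subspace_linear_preimage[OF bilin_hom(1)[OF cons_bilin] subspace_gr_T] .
  fix "is" vs assume "homog V is vs" "sum_list is = p"
  then show "cons v (w vs) \<in> gr T (i + p)"
    using word_gr[of "i # is" "v # vs"] assms(1) by (simp add: cons_word homog_Cons)
qed

text \<open>
  The letters of a word are sums of homogeneous ones.
\<close>

lemma word_spanning:
  assumes S: "module.subspace (smul T) {x. P x}"
    and homogeneous: "\<And>is vs. homog V is vs \<Longrightarrow> P (w vs)"
  shows "P x"
proof -
  interpret S: module "smul T" by (rule module_T)
  let ?D = "S.span {w vs | vs is. homog V is vs}"
  have step: "cons v (w vs) \<in> ?D" if "homog V is vs" for v vs "is"
  proof (induction v rule: graded_induct[OF graded_V])
    case (1 i v)
    then have "homog V (i # is) (v # vs)" using that by (simp add: homog_Cons)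
    then show ?case unfolding cons_word by (blast intro: S.span_base)
  qed (simp add: cons_simps S.span_add)
  have "x \<in> ?D"
  proof (induction x rule: cons_induct)
    case unit
    have "homog V [] []" by (simp add: homog_def)
    then show ?case by (blast intro: S.span_base)
  next
    case (cons v x)
    show ?case
    proof (rule S.span_induct[OF cons])
      show "S.subspace {x. cons v x \<in> ?D}"
        by (rule module_hom.subspace_linear_preimage[OF bilin_hom(1)[OF cons_bilin] S.subspace_span])
      fix x assume "x \<in> {w vs | vs is. homog V is vs}"
      then obtain vs "is" where "x = w vs" "homog V is vs" by blast
      then show "cons v x \<in> ?D" using step by (simp only:)
    qed
  qed (auto intro: S.span_add S.span_scale)
  then show ?thesis by (rule S.span_induct[OF _ S]) (auto intro: homogeneous)
qed

lemma hom_eq_homog: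
  assumes f: "module_hom (smul T) sN f" and g: "module_hom (smul T) sN g"
    and "\<And>is vs. homog V is vs \<Longrightarrow> f (w vs) = g (w vs)"
  shows "f x = g x"
  by (rule word_spanning[OF module_hom.subspace_kernel[OF module_hom_plus(2)[OF f g], simplified]])
     (rule assms(3))

lemma HomI_rec:
  assumes f: "module_hom (smul T) (smul N) f"
    and N: "\<And>i. module.subspace (smul N) (gr N i)"
    and unit: "f (w []) \<in> gr N n"
    and cons: "\<And>i p v x. v \<in> gr V i \<Longrightarrow> x \<in> gr T p \<Longrightarrow> f x \<in> gr N (p + n) \<Longrightarrow>
       f (cons v x) \<in> gr N (i + p + n)"
  shows "f \<in> Hom n T N"
proof (rule HomI[OF f])
  have words: "f (w vs) \<in> gr N (sum_list is + n)" if "homog V is vs" for "is" vs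
    using that
  proof (induction vs arbitrary: "is")
    case Nil then show ?case by (simp add: homog_def unit)
  next
    case (Cons v vs)
    then obtain i js where "is = i # js" "v \<in> gr V i" "homog V js vs" by (auto simp: homog_Cons)
    with Cons cons[of v i "w vs" "sum_list js"] word_gr[of js vs] show ?case
      by (simp add: cons_word algebra_simps)
  qed
  show "f x \<in> gr N (p + n)" if "x \<in> gr T p" for p x
    by (rule gr_word_induct[OF that module_hom.subspace_linear_preimage[OF f N]])
       (use words in blast)
qed

text \<open>
  The homogeneous components of a tensor are computed by recursion on the first letter, as a function of
  the degree: a letter of degree \<open>i\<close> shifts this function by \<open>i\<close>. The step is first defined on
  homogeneous letters and then extended linearly.
\<close>

lemma graded_T: "graded_module T"
proof -
  interpret S: module "smul T" by (rule module_T)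
  define sN where "sN = (\<lambda>c (f :: int \<Rightarrow> 't) p. smul T c (f p))"
  have N: "module sN" unfolding sN_def by (rule module_pointwise[OF module_T])
  have "\<exists>\<phi>. module_hom (smul V) sN \<phi> \<and> (\<forall>i. \<forall>v\<in>gr V i. \<phi> v = (\<lambda>p. cons v (y (p - i))))" for y
    by (rule graded_lift[OF graded_V N]) (simp_all add: fun_eq_iff cons_simps sN_def)
  then obtain K where K: "\<And>y. module_hom (smul V) sN (K y)"
    "\<And>y i v. v \<in> gr V i \<Longrightarrow> K y v = (\<lambda>p. cons v (y (p - i)))" by metis
  have K_add: "K (y + y') v = K y v + K y' v" for y y' v
    by (rule graded_hom_eq[OF graded_V K(1) module_hom_plus(1)[OF K(1) K(1)]])
       (simp add: K(2) fun_eq_iff cons_simps)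
  have K_scale: "K (sN c y) v = sN c (K y v)" for c y v
    by (rule graded_hom_eq[OF graded_V K(1) module_hom_multiple(2)[OF K(1)]])
       (simp add: K(2) fun_eq_iff cons_simps sN_def)
  have step: "rec_step sN (\<lambda>v x y. K y v)"
    by (simp add: rec_step_def N module_hom.add[OF K(1)] module_hom.scale[OF K(1)] K_add K_scale)
  define \<phi> where "\<phi> = tfold sN (\<lambda>p. if p = 0 then w [] else 0) (\<lambda>v x y. K y v)"
  note \<phi> = tfold[OF step, of "\<lambda>p. if p = 0 then w [] else 0", folded \<phi>_def]
  have hom: "module_hom (smul T) (smul T) (\<lambda>x. \<phi> x p)" for p
    using \<phi>(1) by (simp add: module_hom_iff module_T sN_def fun_eq_iff)
  have words: "\<phi> (w vs) = (\<lambda>p. if p = sum_list is then w vs else 0)" if "homog V is vs" for "is" vs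
    using that
  proof (induction vs arbitrary: "is")
    case Nil then show ?case by (auto simp: homog_def \<phi>(2))
  next
    case (Cons v vs)
    then obtain i js where *: "is = i # js" "v \<in> gr V i" "homog V js vs" by (auto simp: homog_Cons)
    with Cons.IH[OF *(3)] show ?case
      by (auto simp: cons_word[symmetric] \<phi>(3) K(2) fun_eq_iff cons_simps)
  qed
  show ?thesis
  proof (rule graded_moduleI[where \<pi> = "\<lambda>p x. \<phi> x p"])
    show "module (smul T)" by (rule module_T)
    show "module.subspace (smul T) (gr T i)" for i by (rule subspace_gr_T)
    show "module_hom (smul T) (smul T) (\<lambda>x. \<phi> x p)" for p by (rule hom)
    show "\<phi> x p = (if p = q then x else 0)" if "x \<in> gr T q" for p q x
    proof (rule gr_word_induct[OF that])
      show "S.subspace {x. \<phi> x p = (if p = q then x else 0)}"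
        unfolding S.subspace_def
        by (auto simp: module_hom.add[OF hom] module_hom.scale[OF hom] module_hom.zero[OF hom])
    qed (simp add: words)
    show "\<phi> x p \<in> gr T p" for p x
    proof (rule word_spanning[where P = "\<lambda>x. \<phi> x p \<in> gr T p"])
      show "S.subspace {x. \<phi> x p \<in> gr T p}"
        by (rule module_hom.subspace_linear_preimage[OF hom subspace_gr_T])
    qed (simp add: words word_gr S.subspace_0[OF subspace_gr_T])
    let ?Q = "\<lambda>x. \<exists>S. finite S \<and> (\<forall>S'. finite S' \<longrightarrow> S \<subseteq> S' \<longrightarrow> (\<Sum>p\<in>S'. \<phi> x p) = x)"
    show "?Q x" for x
    proof (rule word_spanning[where P = ?Q])
      show "?Q (w vs)" if "homog V is vs" for "is" vs
        by (rule exI[of _ "{sum_list is}"]) (simp add: words[OF that])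
      have "?Q 0" by (rule exI[of _ "{}"]) (simp add: module_hom.zero[OF hom])
      moreover have "?Q (x + y)" if Q: "?Q x" "?Q y" for x y
      proof -
        obtain S1 where S1: "finite S1 \<and> (\<forall>S'. finite S' \<longrightarrow> S1 \<subseteq> S' \<longrightarrow> (\<Sum>p\<in>S'. \<phi> x p) = x)"
          using Q(1) ..
        obtain S2 where S2: "finite S2 \<and> (\<forall>S'. finite S' \<longrightarrow> S2 \<subseteq> S' \<longrightarrow> (\<Sum>p\<in>S'. \<phi> y p) = y)"
          using Q(2) ..
        from S1 S2 show ?thesis
          by (intro exI[of _ "S1 \<union> S2"]) (simp add: module_hom.add[OF hom] sum.distrib)
      qed
      moreover have "?Q (smul T c x)" if Q: "?Q x" for c x
      proof -
        obtain S where S: "finite S \<and> (\<forall>S'. finite S' \<longrightarrow> S \<subseteq> S' \<longrightarrow> (\<Sum>p\<in>S'. \<phi> x p) = x)"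
          using Q ..
        then show ?thesis
          by (intro exI[of _ S]) (simp add: module_hom.scale[OF hom] S.scale_sum_right[symmetric])
      qed
      ultimately show "S.subspace {x. ?Q x}" 
        unfolding S.subspace_def mem_Collect_eq by (intro conjI allI ballI) simp_all
    qed
  qed
qed

lemma tw_unit: "tw T n (w []) = w []"
  using tw_gr[OF graded_T unit_gr] by simp

lemma tw_cons: "tw T n (cons v x) = cons (tw V n v) (tw T n x)"
proof (induction v rule: graded_induct[OF graded_V])
  case (1 i v)
  show ?case
  proof (induction x rule: graded_induct[OF graded_T])
    case (1 p x)
    then show ?case using \<open>v \<in> gr V i\<close> cons_gr[of v i x p]
      by (simp add: tw_gr[OF graded_T] tw_gr[OF graded_V] ksign_def cons_simps)
  qed (simp add: cons_simps module_hom.add[OF tw_hom[OF graded_T]])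
qed (simp add: cons_simps module_hom.add[OF tw_hom[OF graded_V]] module_hom.add[OF tw_hom[OF graded_T]])

definition counit :: "'t \<Rightarrow> 'k" where "counit = tfold (*) 1 (\<lambda>v x y. 0)"

lemma counit_hom: "module_hom (smul T) (*) counit" and counit_unit [simp]: "counit (w []) = 1"
  and counit_cons [simp]: "counit (cons v x) = 0"
proof -
  have "rec_step (*) (\<lambda>v x (y :: 'k). 0)" by (simp add: rec_step_def module_self)
  from tfold[OF this] show "module_hom (smul T) (*) counit" "counit (w []) = 1"
    "counit (cons v x) = 0" unfolding counit_def by auto
qed

lemma counit_word: "counit (w vs) = (if vs = [] then 1 else 0)"
  by (cases vs) (simp_all add: cons_word[symmetric])

lemma counit_gr:
  assumes "x \<in> gr T p" "p \<noteq> 0" shows "counit x = 0"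
  by (rule gr_word_induct[OF assms(1) module_hom.subspace_kernel[OF counit_hom]])
     (use assms(2) in \<open>auto simp: counit_word homog_def\<close>)

end


section \<open>Graded commutators and differential graded Lie algebras\<close>

lemma comm_br_Hom:
  assumes M: "graded_module M" and X: "X \<in> Hom m M M" and Y: "Y \<in> Hom n M M"
  shows "comm_br m n X Y \<in> Hom (m + n) M M"
proof (rule HomI)
  show "module_hom (smul M) (smul M) (comm_br m n X Y)" unfolding comm_br_def
    by (intro module_hom_plus(2) module_hom_ksign module_hom_comp[OF HomD(1)[OF X] HomD(1)[OF Y]]
        module_hom_comp[OF HomD(1)[OF Y] HomD(1)[OF X]])
  note M' = graded_module_module[OF M] and sub = graded_module_subspace[OF M]
  fix l x assume x: "x \<in> gr M l"
  show "comm_br m n X Y x \<in> gr M (l + (m + n))"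
    using HomD(2)[OF X HomD(2)[OF Y x]] HomD(2)[OF Y HomD(2)[OF X x]] unfolding comm_br_def
    by (intro module.subspace_diff[OF M' sub] ksign_subspace[OF M' sub]) (simp_all add: algebra_simps)
qed

text \<open>
  The case of odd degree is an identity in \<open>X\<close> that uses no division: \<open>[X, X] = 2 X\<^sup>2\<close> commutes with \<open>X\<close>.
\<close>

lemma
  assumes X: "module_hom s s X" and Y: "module_hom s s Y"
  shows comm_br_antisym: "comm_br m n X Y a = - ksign (m * n) (comm_br n m Y X a)"
    and comm_br_even: "even m \<Longrightarrow> comm_br m m X X a = 0"
    and comm_br_odd: "odd m \<Longrightarrow> comm_br m (m + m) X (comm_br m m X X) a = 0"
  by (auto simp: comm_br_def ksign_def module_hom.diff[OF X] module_hom.add[OF X]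
      module_hom.neg[OF X] algebra_simps)

lemma comm_br_jacobi:
  assumes X: "module_hom s s X" and Y: "module_hom s s Y" and Z: "module_hom s s Z"
  shows "comm_br m (n + p) X (comm_br n p Y Z) a =
     comm_br (m + n) p (comm_br m n X Y) Z a + ksign (m * n) (comm_br n (m + p) Y (comm_br m p X Z) a)"
  by (cases "even m"; cases "even n"; cases "even p")
     (simp_all add: comm_br_def ksign_def module_hom.diff[OF X] module_hom.diff[OF Y]
        module_hom.diff[OF Z] module_hom.add[OF X] module_hom.add[OF Y] module_hom.add[OF Z])

lemma comm_br_square:
  assumes X: "module_hom s s X" and \<delta>: "module_hom s s \<delta>" and \<delta>\<delta>: "\<And>a. \<delta> (\<delta> a) = 0"
  shows "comm_br (- 1) (n - 1) \<delta> (comm_br (- 1) n \<delta> X) a = 0"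
  by (cases "even n")
     (simp_all add: comm_br_def ksign_def module_hom.diff[OF \<delta>] module_hom.add[OF \<delta>] \<delta>\<delta>
        module_hom.zero[OF X])

text \<open>
  All axioms of a differential graded Lie algebra hold for graded commutators, hence for every
  structure that embeds into the graded endomorphisms of a module and is closed under the operations.
\<close>

lemma is_dgl_of_endomorphisms:
  fixes L :: "('k::comm_ring_1, 'l::ab_group_add) dgl"
    and M :: "('k, 'x::ab_group_add, 'm) gmod_scheme" and \<phi> :: "int \<Rightarrow> 'l \<Rightarrow> 'x \<Rightarrow> 'x"
  assumes M: "graded_module M" and \<delta>: "\<delta> \<in> Hom (- 1) M M" and \<delta>\<delta>: "\<And>a. \<delta> (\<delta> a) = 0"
    and L: "module (lscale L)" and sub: "\<And>n. module.subspace (lscale L) (lcar L n)"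
    and \<phi>: "\<And>n x. x \<in> lcar L n \<Longrightarrow> \<phi> n x \<in> Hom n M M"
    and inj: "\<And>n x y. x \<in> lcar L n \<Longrightarrow> y \<in> lcar L n \<Longrightarrow> \<phi> n x = \<phi> n y \<Longrightarrow> x = y"
    and add: "\<And>n x y a. x \<in> lcar L n \<Longrightarrow> y \<in> lcar L n \<Longrightarrow> \<phi> n (x + y) a = \<phi> n x a + \<phi> n y a"
    and scale: "\<And>n c x a. x \<in> lcar L n \<Longrightarrow> \<phi> n (lscale L c x) a = smul M c (\<phi> n x a)"
    and ldiff_in: "\<And>n x. x \<in> lcar L n \<Longrightarrow> ldiff L n x \<in> lcar L (n - 1)"
    and ldiff: "\<And>n x. x \<in> lcar L n \<Longrightarrow> \<phi> (n - 1) (ldiff L n x) = comm_br (- 1) n \<delta> (\<phi> n x)"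
    and lbr_in: "\<And>m n x y. x \<in> lcar L m \<Longrightarrow> y \<in> lcar L n \<Longrightarrow> lbr L m n x y \<in> lcar L (m + n)"
    and lbr: "\<And>m n x y. x \<in> lcar L m \<Longrightarrow> y \<in> lcar L n \<Longrightarrow>
       \<phi> (m + n) (lbr L m n x y) = comm_br m n (\<phi> m x) (\<phi> n y)"
  shows "is_dgl L"
proof -
  interpret L: module "lscale L" by fact
  note in_add = L.subspace_add[OF sub] and in_scale = L.subspace_scale[OF sub]
    and in_neg = L.subspace_neg[OF sub] and in_ksign = ksign_subspace[OF L sub]
  have eqI: "x = y" if "x \<in> lcar L n" "y \<in> lcar L n" "\<And>a. \<phi> n x a = \<phi> n y a" for n x y
    using inj[OF that(1,2)] that(3) by blast
  have zero_in: "0 \<in> lcar L n" for n by (rule L.subspace_0[OF sub])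
  have \<phi>0: "\<phi> n 0 a = 0" for n a using add[OF zero_in zero_in, of n a] by simp
  have neg: "\<phi> n (- x) a = - \<phi> n x a" if "x \<in> lcar L n" for n x a
    using add[OF that in_neg[OF that], of a] \<phi>0 by (simp add: eq_neg_iff_add_eq_0 add.commute)
  have ksign: "\<phi> n (ksign i x) a = ksign i (\<phi> n x a)" if "x \<in> lcar L n" for n i x a
    by (simp add: ksign_def neg[OF that])
  note hom = HomD(1)[OF \<phi>]
  note h\<delta> = HomD(1)[OF \<delta>]
  have cadd: "comm_br m n (\<lambda>a. X a + X' a) Y = (\<lambda>a. comm_br m n X Y a + comm_br m n X' Y a)"
    if "module_hom (smul M) (smul M) Y" for m n X X' Y
    by (simp add: comm_br_def fun_eq_iff module_hom.add[OF that] ksign_add)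
  have cscale: "comm_br m n (\<lambda>a. smul M c (X a)) Y = (\<lambda>a. smul M c (comm_br m n X Y a))"
    if "module_hom (smul M) (smul M) Y" for m n c X Y
    using module.scale_right_diff_distrib[OF graded_module_module[OF M]]
    by (simp add: comm_br_def fun_eq_iff module_hom.scale[OF that]
        ksign_scale[OF graded_module_module[OF M]])
  have 1: "ldiff L n (x + y) = ldiff L n x + ldiff L n y" if xy: "x \<in> lcar L n" "y \<in> lcar L n" for n x y
  proof (rule eqI[of _ "n - 1"])
    fix a show "\<phi> (n - 1) (ldiff L n (x + y)) a = \<phi> (n - 1) (ldiff L n x + ldiff L n y) a"
      by (simp add: add ldiff ldiff_in xy in_add comm_br_def module_hom.add[OF h\<delta>] ksign_add)
  qed (simp_all add: ldiff_in in_add xy)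
  have 2: "ldiff L n (lscale L c x) = lscale L c (ldiff L n x)" if x: "x \<in> lcar L n" for n c x
  proof (rule eqI[of _ "n - 1"])
    fix a show "\<phi> (n - 1) (ldiff L n (lscale L c x)) a = \<phi> (n - 1) (lscale L c (ldiff L n x)) a"
      by (simp add: scale ldiff ldiff_in x in_scale comm_br_def module_hom.scale[OF h\<delta>]
          ksign_scale[OF graded_module_module[OF M], symmetric]
          module.scale_right_diff_distrib[OF graded_module_module[OF M]])
  qed (simp_all add: ldiff_in in_scale x)
  have 3: "ldiff L (n - 1) (ldiff L n x) = 0" if x: "x \<in> lcar L n" for n x
  proof (rule eqI[of _ "n - 1 - 1"])
    fix a show "\<phi> (n - 1 - 1) (ldiff L (n - 1) (ldiff L n x)) a = \<phi> (n - 1 - 1) 0 a"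
      by (simp only: ldiff[OF ldiff_in[OF x]] ldiff[OF x] \<phi>0 comm_br_square[OF hom[OF x] h\<delta> \<delta>\<delta>])
  qed (simp_all only: ldiff_in[OF ldiff_in[OF x]] zero_in)
  have 4: "lbr L m n (x + x') y = lbr L m n x y + lbr L m n x' y"
    if x: "x \<in> lcar L m" "x' \<in> lcar L m" and y: "y \<in> lcar L n" for m n x x' y
  proof (rule eqI[of _ "m + n"])
    have "\<phi> m (x + x') = (\<lambda>a. \<phi> m x a + \<phi> m x' a)" using add x by blast
    then show "\<phi> (m + n) (lbr L m n (x + x') y) a = \<phi> (m + n) (lbr L m n x y + lbr L m n x' y) a" for a
      by (simp add: add lbr lbr_in x y in_add cadd[OF hom[OF y]])
  qed (simp_all add: lbr_in in_add x y)
  have 5: "lbr L m n (lscale L c x) y = lscale L c (lbr L m n x y)"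
    if x: "x \<in> lcar L m" and y: "y \<in> lcar L n" for m n c x y
  proof (rule eqI[of _ "m + n"])
    have "\<phi> m (lscale L c x) = (\<lambda>a. smul M c (\<phi> m x a))" using scale x by blast
    then show "\<phi> (m + n) (lbr L m n (lscale L c x) y) a = \<phi> (m + n) (lscale L c (lbr L m n x y)) a" for a
      by (simp add: scale lbr lbr_in x y in_scale cscale[OF hom[OF y]])
  qed (simp_all add: lbr_in in_scale x y)
  have 6: "lbr L m n x y = - ksign (m * n) (lbr L n m y x)"
    if x: "x \<in> lcar L m" and y: "y \<in> lcar L n" for m n x y
  proof (rule eqI[of _ "m + n"])
    have yx: "lbr L n m y x \<in> lcar L (m + n)" using lbr_in[OF y x] by (simp add: add.commute)
    have "\<phi> (m + n) (lbr L n m y x) = comm_br n m (\<phi> n y) (\<phi> m x)"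
      using lbr[OF y x] by (simp add: add.commute)
    then show "\<phi> (m + n) (lbr L m n x y) a = \<phi> (m + n) (- ksign (m * n) (lbr L n m y x)) a" for a
      by (simp only: neg[OF in_ksign[OF yx]] ksign[OF yx] lbr[OF x y]
          comm_br_antisym[OF hom[OF x] hom[OF y], of m n a])
    show "- ksign (m * n) (lbr L n m y x) \<in> lcar L (m + n)" by (rule in_neg[OF in_ksign[OF yx]])
  qed (rule lbr_in[OF x y])
  have 7: "lbr L m m x x = 0" if x: "x \<in> lcar L m" and "even m" for m x
  proof (rule eqI[of _ "m + m"])
    fix a show "\<phi> (m + m) (lbr L m m x x) a = \<phi> (m + m) 0 a"
      by (simp only: lbr[OF x x] comm_br_even[OF hom[OF x] hom[OF x] that(2)] \<phi>0)
  qed (simp_all only: lbr_in[OF x x] zero_in)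
  have 8: "lbr L m (m + m) x (lbr L m m x x) = 0" if x: "x \<in> lcar L m" and "odd m" for m x
  proof (rule eqI[of _ "m + (m + m)"])
    fix a show "\<phi> (m + (m + m)) (lbr L m (m + m) x (lbr L m m x x)) a = \<phi> (m + (m + m)) 0 a"
      by (simp only: lbr[OF x x] lbr[OF x lbr_in[OF x x]] comm_br_odd[OF hom[OF x] hom[OF x] that(2)] \<phi>0)
  qed (simp_all only: lbr_in[OF x x] lbr_in[OF x lbr_in[OF x x]] zero_in)
  have 9: "lbr L m (n + p) x (lbr L n p y z) = lbr L (m + n) p (lbr L m n x y) z
      + ksign (m * n) (lbr L n (m + p) y (lbr L m p x z))"
    if x: "x \<in> lcar L m" and y: "y \<in> lcar L n" and z: "z \<in> lcar L p" for m n p x y z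
  proof (rule eqI[of _ "m + (n + p)"])
    have e: "m + n + p = m + (n + p)" "n + (m + p) = m + (n + p)" by auto
    note l = lbr[OF x lbr_in[OF y z]] lbr[OF lbr_in[OF x y] z, unfolded e]
      lbr[OF y lbr_in[OF x z], unfolded e] lbr[OF x y] lbr[OF y z] lbr[OF x z]
    note i = lbr_in[OF x lbr_in[OF y z]] lbr_in[OF lbr_in[OF x y] z, unfolded e]
      lbr_in[OF y lbr_in[OF x z], unfolded e]
    show "lbr L m (n + p) x (lbr L n p y z) \<in> lcar L (m + (n + p))" by (rule i)
    show "lbr L (m + n) p (lbr L m n x y) z + ksign (m * n) (lbr L n (m + p) y (lbr L m p x z))
        \<in> lcar L (m + (n + p))" by (rule in_add[OF i(2) in_ksign[OF i(3)]])
    fix a show "\<phi> (m + (n + p)) (lbr L m (n + p) x (lbr L n p y z)) a =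
      \<phi> (m + (n + p)) (lbr L (m + n) p (lbr L m n x y) z + ksign (m * n) (lbr L n (m + p) y (lbr L m p x z))) a"
      by (simp only: add[OF i(2) in_ksign[OF i(3)]] ksign[OF i(3)] l
          comm_br_jacobi[OF hom[OF x] hom[OF y] hom[OF z]])
  qed
  have 10: "ldiff L (m + n) (lbr L m n x y) =
      lbr L (m - 1) n (ldiff L m x) y + ksign m (lbr L m (n - 1) x (ldiff L n y))"
    if x: "x \<in> lcar L m" and y: "y \<in> lcar L n" for m n x y
  proof (rule eqI[of _ "m + n - 1"])
    have e: "m - 1 + n = m + n - 1" "m + (n - 1) = m + n - 1" by auto
    note l = ldiff[OF lbr_in[OF x y]] lbr[OF x y] lbr[OF ldiff_in[OF x] y, unfolded e]
      lbr[OF x ldiff_in[OF y], unfolded e] ldiff[OF x] ldiff[OF y]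
    note i = ldiff_in[OF lbr_in[OF x y]] lbr_in[OF ldiff_in[OF x] y, unfolded e]
      lbr_in[OF x ldiff_in[OF y], unfolded e]
    show "ldiff L (m + n) (lbr L m n x y) \<in> lcar L (m + n - 1)" by (rule i)
    show "lbr L (m - 1) n (ldiff L m x) y + ksign m (lbr L m (n - 1) x (ldiff L n y))
       \<in> lcar L (m + n - 1)" by (rule in_add[OF i(2) in_ksign[OF i(3)]])
    have k: "- 1 + m = m - 1" "- 1 + n = n - 1" by auto
    have "ksign (- 1 * m) b = ksign m b" for b :: 'x by (simp add: ksign_def)
    then show "\<phi> (m + n - 1) (ldiff L (m + n) (lbr L m n x y)) a = \<phi> (m + n - 1)
      (lbr L (m - 1) n (ldiff L m x) y + ksign m (lbr L m (n - 1) x (ldiff L n y))) a" for a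
      by (simp only: add[OF i(2) in_ksign[OF i(3)]] ksign[OF i(3)] l
          comm_br_jacobi[OF h\<delta> hom[OF x] hom[OF y]] k)
  qed
  show ?thesis unfolding is_dgl_def
    by (intro conjI allI ballI impI L sub ldiff_in lbr_in 1 2 3 4 5 6 7 8 9 10)
qed


section \<open>Quasi-isomorphisms with acyclic cokernel\<close>

lemma is_dglD:
  assumes "is_dgl L"
  shows "module (lscale L)" "module.subspace (lscale L) (lcar L n)"
    and "x \<in> lcar L n \<Longrightarrow> ldiff L n x \<in> lcar L (n - 1)"
    and "x \<in> lcar L n \<Longrightarrow> y \<in> lcar L n \<Longrightarrow> ldiff L n (x + y) = ldiff L n x + ldiff L n y"
    and "x \<in> lcar L n \<Longrightarrow> ldiff L (n - 1) (ldiff L n x) = 0"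
  using assms by (simp_all add: is_dgl_def)

lemma ldiff_neg:
  assumes "is_dgl L" "x \<in> lcar L n"
  shows "ldiff L n (- x) = - ldiff L n x"
proof -
  note L = is_dglD[OF assms(1)]
  have 0: "0 \<in> lcar L n" by (rule module.subspace_0[OF L(1,2)])
  have "ldiff L n 0 = 0" using L(4)[OF 0 0] by simp
  then show ?thesis using L(4)[OF assms(2) module.subspace_neg[OF L(1,2) assms(2)]]
    by (simp add: eq_neg_iff_add_eq_0 add.commute)
qed

lemma ldiff_diff:
  assumes L: "is_dgl L" and x: "x \<in> lcar L n" and y: "y \<in> lcar L n"
  shows "ldiff L n (x - y) = ldiff L n x - ldiff L n y"
  using is_dglD(4)[OF L x module.subspace_neg[OF is_dglD(1,2)[OF L] y]] ldiff_neg[OF L y] by simp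

lemma equiv_homologous:
  assumes L: "is_dgl L" shows "equiv (cycles L n) (homologous L n)"
proof (rule equivI)
  note D = is_dglD[OF L]
  note M = D(1) and sub = D(2)
  have 0: "ldiff L i 0 = 0" for i using D(4)[of 0 i 0] module.subspace_0[OF M sub] by simp
  have b0: "0 \<in> boundaries L n"
    unfolding boundaries_def
    by (rule image_eqI[where x = 0]) (simp_all add: 0 module.subspace_0[OF M sub])
  have bneg: "- x \<in> boundaries L n" if x: "x \<in> boundaries L n" for x
  proof -
    from x obtain z where z: "z \<in> lcar L (n + 1)" "x = ldiff L (n + 1) z" by (auto simp: boundaries_def)
    show ?thesis unfolding boundaries_def
      by (rule image_eqI[of _ _ "- z"]) (simp_all add: z ldiff_neg[OF L z(1)] module.subspace_neg[OF M sub])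
  qed
  have badd: "x + y \<in> boundaries L n" if x: "x \<in> boundaries L n" and y: "y \<in> boundaries L n" for x y
  proof -
    from x obtain u where u: "u \<in> lcar L (n + 1)" "x = ldiff L (n + 1) u" by (auto simp: boundaries_def)
    from y obtain v where v: "v \<in> lcar L (n + 1)" "y = ldiff L (n + 1) v" by (auto simp: boundaries_def)
    show ?thesis unfolding boundaries_def
      by (rule image_eqI[of _ _ "u + v"]) (simp_all add: u v D(4)[OF u(1) v(1)] module.subspace_add[OF M sub])
  qed
  show "homologous L n \<subseteq> cycles L n \<times> cycles L n" by (auto simp: homologous_def)
  show "refl_on (cycles L n) (homologous L n)"
    using b0 by (auto simp: refl_on_def homologous_def)
  show "sym (homologous L n)"
  proof (rule symI)
    fix x y assume "(x, y) \<in> homologous L n"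
    then show "(y, x) \<in> homologous L n" using bneg[of "x - y"] by (simp add: homologous_def)
  qed
  show "trans (homologous L n)"
  proof (rule transI)
    fix x y z assume "(x, y) \<in> homologous L n" "(y, z) \<in> homologous L n"
    then show "(x, z) \<in> homologous L n" using badd[of "x - y" "y - z"] by (simp add: homologous_def)
  qed
qed

text \<open>
  The hypothesis \<open>acyclic\<close> says that the cokernel of \<open>\<phi>\<close> is acyclic: whatever is a cycle modulo the
  image of \<open>\<phi>\<close> is a boundary modulo that image. Applied to cycles it gives surjectivity in homology,
  applied to an element bounding the image of a cycle it gives injectivity.
\<close>

lemma injective_quasi_isoI:
  fixes L :: "('k::comm_ring_1, 'a::ab_group_add) dgl" and L' :: "('k, 'b::ab_group_add) dgl"
  assumes L: "is_dgl L" and L': "is_dgl L'" and hom: "is_dgl_hom L L' \<phi>"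
    and inj: "\<And>n. inj_on (\<phi> n) (lcar L n)"
    and acyclic: "\<And>n g. g \<in> lcar L' n \<Longrightarrow> ldiff L' n g \<in> \<phi> (n - 1) ` lcar L (n - 1) \<Longrightarrow>
       \<exists>g' \<in> lcar L' (n + 1). g - ldiff L' (n + 1) g' \<in> \<phi> n ` lcar L n"
  shows "injective_quasi_iso L L' \<phi>"
proof -
  note D = is_dglD[OF L] and D' = is_dglD[OF L']
  have \<phi>_in: "\<phi> n x \<in> lcar L' n" if "x \<in> lcar L n" for n x using hom that by (simp add: is_dgl_hom_def)
  have \<phi>_d: "ldiff L' n (\<phi> n x) = \<phi> (n - 1) (ldiff L n x)" if "x \<in> lcar L n" for n x
    using hom that by (simp add: is_dgl_hom_def)
  have \<phi>_add: "\<phi> n (x + y) = \<phi> n x + \<phi> n y" if "x \<in> lcar L n" "y \<in> lcar L n" for n x y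
    using hom that by (simp add: is_dgl_hom_def)
  have zero_in: "0 \<in> lcar L n" for n by (rule module.subspace_0[OF D(1,2)])
  have \<phi>0: "\<phi> n 0 = 0" for n using \<phi>_add[OF zero_in zero_in, of n] by simp
  have \<phi>_diff: "\<phi> n (x - y) = \<phi> n x - \<phi> n y" if "x \<in> lcar L n" "y \<in> lcar L n" for n x y
    using \<phi>_add[OF module.subspace_diff[OF D(1,2) that] that(2)] by (simp add: eq_diff_eq)
  have \<phi>_cyc: "\<phi> n x \<in> cycles L' n" if "x \<in> cycles L n" for n x
    using that by (simp add: cycles_def \<phi>_in \<phi>_d \<phi>0)
  have \<phi>_hlg: "(\<phi> n x, \<phi> n y) \<in> homologous L' n" if "(x, y) \<in> homologous L n" for n x y
  proof -
    from that obtain z where z: "z \<in> lcar L (n + 1)" "x - y = ldiff L (n + 1) z"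
      and xy: "x \<in> cycles L n" "y \<in> cycles L n"
      by (auto simp: homologous_def boundaries_def)
    then have "\<phi> n x - \<phi> n y = ldiff L' (n + 1) (\<phi> (n + 1) z)"
      using \<phi>_d[OF z(1)] \<phi>_diff[of x n y] by (simp add: cycles_def)
    then show ?thesis using xy \<phi>_cyc \<phi>_in[OF z(1)] by (auto simp: homologous_def boundaries_def)
  qed
  have bij: "bij_betw (homology_map L' \<phi> n) (homology L n) (homology L' n)" for n
  proof -
    note eq = equiv_homologous[OF L, of n] and eq' = equiv_homologous[OF L', of n]
    have map: "homology_map L' \<phi> n (homologous L n `` {x}) = homologous L' n `` {\<phi> n x}"
      if x: "x \<in> cycles L n" for x
    proof -
      have cls: "homologous L' n `` {\<phi> n y} = homologous L' n `` {\<phi> n x}"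
        if "(x, y) \<in> homologous L n" for y
        using equiv_class_eq[OF eq' \<phi>_hlg[OF that]] by simp
      have xx: "x \<in> homologous L n `` {x}" using equiv_class_self[OF eq x] .
      have "(\<Union>y\<in>homologous L n `` {x}. homologous L' n `` {\<phi> n y}) = homologous L' n `` {\<phi> n x}"
      proof (intro equalityI UN_least)
        fix y assume "y \<in> homologous L n `` {x}"
        then show "homologous L' n `` {\<phi> n y} \<subseteq> homologous L' n `` {\<phi> n x}" using cls[of y] by simp
      qed (rule UN_upper[OF xx])
      moreover have "R `` (f ` S) = (\<Union>y\<in>S. R `` {f y})" for R :: "('b \<times> 'b) set" and f :: "'a \<Rightarrow> 'b" and S
        by blast
      ultimately show ?thesis unfolding homology_map_def by (rule trans[rotated])
    qed
    show ?thesis unfolding bij_betw_def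
    proof
      show "inj_on (homology_map L' \<phi> n) (homology L n)"
      proof (rule inj_onI)
        fix X Y assume "X \<in> homology L n" "Y \<in> homology L n"
          and e: "homology_map L' \<phi> n X = homology_map L' \<phi> n Y"
        then obtain x y where x: "x \<in> cycles L n" "X = homologous L n `` {x}"
          and y: "y \<in> cycles L n" "Y = homologous L n `` {y}"
          unfolding homology_def by (elim quotientE)
        have "(\<phi> n x, \<phi> n y) \<in> homologous L' n"
          using e eq_equiv_class[OF _ eq' \<phi>_cyc[OF y(1)]] by (simp add: x y map)
        then obtain g where g: "g \<in> lcar L' (n + 1)" "\<phi> n x - \<phi> n y = ldiff L' (n + 1) g"
          by (auto simp: homologous_def boundaries_def)
        have xy: "x \<in> lcar L n" "y \<in> lcar L n" "x - y \<in> lcar L n"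
          using x y module.subspace_diff[OF D(1,2)] by (auto simp: cycles_def)
        have "ldiff L' (n + 1) g \<in> \<phi> (n + 1 - 1) ` lcar L (n + 1 - 1)"
          by (rule image_eqI[where x = "x - y"]) (simp_all add: xy \<phi>_diff g(2))
        from acyclic[OF g(1) this] obtain g' z where g': "g' \<in> lcar L' (n + 1 + 1)"
          and z: "z \<in> lcar L (n + 1)" "g - ldiff L' (n + 1 + 1) g' = \<phi> (n + 1) z" by blast
        note dg = D'(3)[OF g', unfolded add_diff_cancel_right'] D'(5)[OF g', unfolded add_diff_cancel_right']
        have "\<phi> n (x - y) = ldiff L' (n + 1) (g - ldiff L' (n + 1 + 1) g')"
          by (simp only: \<phi>_diff[OF xy(1,2)] ldiff_diff[OF L' g(1) dg(1)] dg(2) g(2) diff_zero)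
        also have "\<dots> = \<phi> n (ldiff L (n + 1) z)" unfolding z(2) using \<phi>_d[OF z(1)] by (simp only: add_diff_cancel_right')
        finally have "x - y = ldiff L (n + 1) z"
          by (rule inj_onD[OF inj _ xy(3)]) (use D(3)[OF z(1)] in simp)
        then have "(x, y) \<in> homologous L n" using x y z(1) by (auto simp: homologous_def boundaries_def)
        then show "X = Y" using equiv_class_eq[OF eq] x y by simp
      qed
      show "homology_map L' \<phi> n ` homology L n = homology L' n"
      proof
        show "homology_map L' \<phi> n ` homology L n \<subseteq> homology L' n"
        proof (rule image_subsetI)
          fix X assume "X \<in> homology L n"
          then obtain x where x: "x \<in> cycles L n" "X = homologous L n `` {x}"
            unfolding homology_def by (rule quotientE)
          show "homology_map L' \<phi> n X \<in> homology L' n"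
            unfolding x(2) map[OF x(1)] homology_def by (rule quotientI[OF \<phi>_cyc[OF x(1)]])
        qed
        show "homology L' n \<subseteq> homology_map L' \<phi> n ` homology L n"
        proof
          fix Y assume "Y \<in> homology L' n"
          then obtain g where g: "g \<in> cycles L' n" "Y = homologous L' n `` {g}"
            unfolding homology_def by (rule quotientE)
          have gl: "g \<in> lcar L' n" "ldiff L' n g = 0" using g(1) by (auto simp: cycles_def)
          have "ldiff L' n g \<in> \<phi> (n - 1) ` lcar L (n - 1)"
            by (rule image_eqI[of _ _ 0]) (simp_all add: gl(2) \<phi>0 zero_in)
          from acyclic[OF gl(1) this] obtain g' x where g': "g' \<in> lcar L' (n + 1)"
            and x: "x \<in> lcar L n" "g - ldiff L' (n + 1) g' = \<phi> n x" by blast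
          have dg: "ldiff L' (n + 1) g' \<in> lcar L' n" "ldiff L' n (ldiff L' (n + 1) g') = 0"
            using D'(3)[OF g'] D'(5)[OF g'] by simp_all
          have "\<phi> (n - 1) (ldiff L n x) = \<phi> (n - 1) 0"
            by (simp only: \<phi>_d[OF x(1), symmetric] x(2)[symmetric] ldiff_diff[OF L' gl(1) dg(1)] dg gl \<phi>0) simp
          then have "ldiff L n x = 0" using inj_onD[OF inj] D(3)[OF x(1)] zero_in by blast
          then have xc: "x \<in> cycles L n" using x by (simp add: cycles_def)
          have "g - \<phi> n x \<in> boundaries L' n"
            unfolding x(2)[symmetric] boundaries_def using g' by simp
          then have "(g, \<phi> n x) \<in> homologous L' n" using g(1) \<phi>_cyc[OF xc] by (simp add: homologous_def)
          then have "Y = homology_map L' \<phi> n (homologous L n `` {x})"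
            unfolding map[OF xc] g(2) by (rule equiv_class_eq[OF eq'])
          then show "Y \<in> homology_map L' \<phi> n ` homology L n"
            unfolding homology_def by (rule image_eqI[OF _ quotientI[OF xc]])
        qed
      qed
    qed
  qed
  show ?thesis unfolding injective_quasi_iso_def using L L' hom inj bij by blast
qed


section \<open>Graded algebras and derivations\<close>

locale galgebra =
  fixes A :: "('k::comm_ring_1, 'a::ring_1, 'm) gmod_scheme"
  assumes graded: "graded_module A" and scale: "algebra_scale (smul A)"
    and one_gr: "1 \<in> gr A 0"
    and mult_gr: "x \<in> gr A i \<Longrightarrow> y \<in> gr A j \<Longrightarrow> x * y \<in> gr A (i + j)"
begin

lemmas module = graded_module_module[OF graded]
lemmas subspace_gr = graded_module_subspace[OF graded]
lemmas gr_add = module.subspace_add[OF module subspace_gr]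
  and gr_diff = module.subspace_diff[OF module subspace_gr]
  and gr_neg = module.subspace_neg[OF module subspace_gr]
  and gr_scale = module.subspace_scale[OF module subspace_gr]
  and gr_zero = module.subspace_0[OF module subspace_gr]
  and gr_ksign = ksign_subspace[OF module subspace_gr]

lemma smul_mult: "smul A c x * y = smul A c (x * y)" "x * smul A c y = smul A c (x * y)"
  using scale unfolding algebra_scale_def by metis+

lemma mult_bilin: "bilin (smul A) (smul A) (smul A) (*)"
  by (rule bilinI[OF module module module]) (simp_all add: smul_mult distrib_left distrib_right)

lemma mult_hom:
  "module_hom (smul A) (smul A) ((*) x)" "module_hom (smul A) (smul A) (\<lambda>x. x * y)"
  using bilin_hom[OF mult_bilin] .

lemma tw_linear:
  "tw A n (x + y) = tw A n x + tw A n y" "tw A n (x - y) = tw A n x - tw A n y"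
  "tw A n (- x) = - tw A n x" "tw A n 0 = 0" "tw A n (smul A c x) = smul A c (tw A n x)"
  "tw A n (ksign i x) = ksign i (tw A n x)"
  using module_hom.add[OF tw_hom[OF graded]] module_hom.diff[OF tw_hom[OF graded]]
    module_hom.neg[OF tw_hom[OF graded]] module_hom.zero[OF tw_hom[OF graded]]
    module_hom.scale[OF tw_hom[OF graded]] ksign_hom[OF tw_hom[OF graded]] by auto

lemma tw_one [simp]: "tw A n 1 = 1"
  using tw_gr[OF graded one_gr] by simp

lemma tw_mult: "tw A n (x * y) = tw A n x * tw A n y"
proof (induction x rule: graded_induct[OF graded])
  case (1 i x)
  show ?case
  proof (induction y rule: graded_induct[OF graded])
    case (1 p y)
    show ?case using tw_gr[OF graded mult_gr[OF \<open>x \<in> gr A i\<close> \<open>y \<in> gr A p\<close>], of n]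
        tw_gr[OF graded \<open>x \<in> gr A i\<close>, of n] tw_gr[OF graded \<open>y \<in> gr A p\<close>, of n]
      by (simp add: ksign_def)
  qed (simp add: tw_linear distrib_left)
qed (simp add: tw_linear distrib_right)

text \<open>
  Both sides are linear in \<open>x\<close> once the sign is written as \<open>tw\<close>, so homogeneous \<open>x\<close> suffice.
\<close>

lemma Der_iff:
  "\<theta> \<in> Der n A \<longleftrightarrow> \<theta> \<in> Hom n A A \<and> (\<forall>x y. \<theta> (x * y) = \<theta> x * y + tw A n x * \<theta> y)"
proof
  assume \<theta>: "\<theta> \<in> Der n A"
  then have H: "\<theta> \<in> Hom n A A" by (simp add: Der_def)
  note h = HomD(1)[OF H]
  have "\<theta> (x * y) = \<theta> x * y + tw A n x * \<theta> y" for x y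
  proof (induction x rule: graded_induct[OF graded])
    case (1 i x)
    then show ?case using \<theta> by (simp add: Der_def tw_gr[OF graded] ksign_mult)
  qed (simp add: distrib_right module_hom.add[OF h] tw_linear)
  with H show "\<theta> \<in> Hom n A A \<and> (\<forall>x y. \<theta> (x * y) = \<theta> x * y + tw A n x * \<theta> y)" by simp
next
  assume "\<theta> \<in> Hom n A A \<and> (\<forall>x y. \<theta> (x * y) = \<theta> x * y + tw A n x * \<theta> y)"
  then show "\<theta> \<in> Der n A" by (simp add: Der_def tw_gr[OF graded] ksign_mult)
qed

lemma DerI:
  assumes "\<theta> \<in> Hom n A A" "\<And>x y. \<theta> (x * y) = \<theta> x * y + tw A n x * \<theta> y"
  shows "\<theta> \<in> Der n A"
  using assms by (simp add: Der_iff)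

lemma DerD:
  assumes "\<theta> \<in> Der n A"
  shows "\<theta> \<in> Hom n A A" "module_hom (smul A) (smul A) \<theta>" "x \<in> gr A i \<Longrightarrow> \<theta> x \<in> gr A (i + n)"
    and "\<theta> (x * y) = \<theta> x * y + tw A n x * \<theta> y"
    and "\<theta> (x + y) = \<theta> x + \<theta> y" "\<theta> (x - y) = \<theta> x - \<theta> y" "\<theta> (- x) = - \<theta> x"
    "\<theta> 0 = 0" "\<theta> (smul A c x) = smul A c (\<theta> x)" "\<theta> (ksign i x) = ksign i (\<theta> x)"
    and "\<theta> 1 = 0" and "\<theta> (tw A m x) = ksign (m * n) (tw A m (\<theta> x))"
proof -
  show H: "\<theta> \<in> Hom n A A" and L: "\<theta> (x * y) = \<theta> x * y + tw A n x * \<theta> y" for x y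
    using assms by (auto simp: Der_iff)
  show h: "module_hom (smul A) (smul A) \<theta>" by (rule HomD(1)[OF H])
  show "x \<in> gr A i \<Longrightarrow> \<theta> x \<in> gr A (i + n)" by (rule HomD(2)[OF H])
  show "\<theta> (x + y) = \<theta> x + \<theta> y" "\<theta> (x - y) = \<theta> x - \<theta> y" "\<theta> (- x) = - \<theta> x"
    "\<theta> 0 = 0" "\<theta> (smul A c x) = smul A c (\<theta> x)" "\<theta> (ksign i x) = ksign i (\<theta> x)"
    using module_hom.add[OF h] module_hom.diff[OF h] module_hom.neg[OF h] module_hom.zero[OF h]
      module_hom.scale[OF h] ksign_hom[OF h] by auto
  show "\<theta> 1 = 0" using L[of 1 1] by simp
  show "\<theta> (tw A m x) = ksign (m * n) (tw A m (\<theta> x))" by (rule Hom_tw[OF graded graded H])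
qed

lemma Der_subspace: "module.subspace (\<lambda>c \<theta> x. smul A c (\<theta> x)) (Der n A)"
proof -
  interpret F: module "\<lambda>c (\<theta> :: 'a \<Rightarrow> 'a) x. smul A c (\<theta> x)" by (rule module_pointwise[OF module])
  interpret S: module "smul A" by (rule module)
  show ?thesis
  proof (rule F.subspaceI)
    show "0 \<in> Der n A"
      by (rule DerI) (auto intro!: HomI module_homI module simp: gr_zero)
    show "\<theta> + \<theta>' \<in> Der n A" if "\<theta> \<in> Der n A" "\<theta>' \<in> Der n A" for \<theta> \<theta>'
    proof (rule DerI[OF HomI])
      show "module_hom (smul A) (smul A) (\<theta> + \<theta>')"
        using module_hom_plus(1)[OF DerD(2)[OF that(1)] DerD(2)[OF that(2)]] by (simp add: plus_fun_def)
    qed (use that in \<open>simp_all add: gr_add DerD(3,4) algebra_simps\<close>)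
    show "(\<lambda>x. smul A c (\<theta> x)) \<in> Der n A" if "\<theta> \<in> Der n A" for \<theta> c
    proof (rule DerI[OF HomI])
      show "module_hom (smul A) (smul A) (\<lambda>x. smul A c (\<theta> x))"
        by (rule module_hom_multiple(2)[OF DerD(2)[OF that]])
    qed (use that in \<open>simp_all add: gr_scale DerD(3,4) smul_mult S.scale_right_distrib\<close>)
  qed
qed

lemma comm_br_Der:
  assumes X: "\<theta> \<in> Der m A" and Y: "\<theta>' \<in> Der n A"
  shows "comm_br m n \<theta> \<theta>' \<in> Der (m + n) A"
proof (rule DerI[OF comm_br_Hom[OF graded DerD(1)[OF X] DerD(1)[OF Y]]])
  fix x y
  show "comm_br m n \<theta> \<theta>' (x * y) = comm_br m n \<theta> \<theta>' x * y + tw A (m + n) x * comm_br m n \<theta> \<theta>' y"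
    by (cases "even m"; cases "even n")
       (simp_all add: comm_br_def ksign_def DerD(4-8,12)[OF X] DerD(4-8,12)[OF Y] tw_tw[OF graded]
          add.commute[of n m] algebra_simps)
qed

text \<open>
  The commutator \<open>[X, X]\<close> of an odd derivation only gives twice its square, which does not determine the
  square in characteristic 2.
\<close>

lemma Der_square:
  assumes X: "X \<in> Der n A" and n: "odd n" shows "(\<lambda>x. X (X x)) \<in> Der (n + n) A"
proof (rule DerI[OF HomI])
  show "module_hom (smul A) (smul A) (\<lambda>x. X (X x))" by (rule module_hom_comp[OF DerD(2)[OF X] DerD(2)[OF X]])
  show "X (X x) \<in> gr A (i + (n + n))" if "x \<in> gr A i" for i x
    using DerD(3)[OF X DerD(3)[OF X that]] by (simp add: add.assoc)
  show "X (X (x * y)) = X (X x) * y + tw A (n + n) x * X (X y)" for x y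
    using n by (simp add: DerD(4,5)[OF X] DerD(12)[OF X] tw_tw[OF graded] ksign_def)
qed

lemma inner_derivation:
  assumes x: "x \<in> gr A n"
  shows "(\<lambda>y. x * y - tw A n y * x) \<in> Der n A"
proof (rule DerI[OF HomI])
  show "module_hom (smul A) (smul A) (\<lambda>y. x * y - tw A n y * x)"
    by (rule module_hom_plus(2)[OF mult_hom(1) module_hom_comp[OF mult_hom(2) tw_hom[OF graded]]])
  show "x * y - tw A n y * x \<in> gr A (i + n)" if "y \<in> gr A i" for i y
    using mult_gr[OF x that] mult_gr[OF tw_in_gr[OF graded that] x] by (simp add: gr_diff add.commute)
  show "x * (y * z) - tw A n (y * z) * x = (x * y - tw A n y * x) * z + tw A n y * (x * z - tw A n z * x)"
    for y z by (simp add: tw_mult algebra_simps)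
qed

end

lemma is_dga_galgebra: "is_dga A \<Longrightarrow> galgebra A"
  by (simp add: is_dga_def galgebra_def)

text \<open>
  Multiplication by the sign is linear as a function of \<open>y\<close>, so \<open>ad\<^sub>x\<close> is given by a single formula.
\<close>

lemma ad_eq:
  assumes A: "is_dga A" and x: "x \<in> gr A n"
  shows "ad A n x = (\<lambda>y. x * y - tw A n y * x)"
proof -
  interpret galgebra A by (rule is_dga_galgebra[OF A])
  have "is_ad A n x (\<lambda>y. x * y - tw A n y * x)"
    using DerD(1)[OF inner_derivation[OF x]] by (simp add: is_ad_def tw_gr[OF graded] ksign_mult)
  moreover have "h = h'" if "is_ad A n x h" "is_ad A n x h'" for h h'
  proof
    show "h y = h' y" for y
      by (rule graded_hom_eq[OF graded, where sN = "smul A"])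
         (use that in \<open>auto simp: is_ad_def Hom_def\<close>)
  qed
  ultimately show ?thesis unfolding ad_def by (blast intro: the_equality)
qed

lemma is_dgaD:
  assumes "is_dga A" shows "diff A \<in> Der (- 1) A" "diff A (diff A x) = 0"
  using assms by (simp_all add: is_dga_def)

lemma is_dgl_Der:
  fixes A :: "('k::comm_ring_1, 'a::ring_1) dga"
  assumes A: "is_dga A" shows "is_dgl (Der_dgl A)"
proof -
  interpret galgebra A by (rule is_dga_galgebra[OF A])
  note d = is_dgaD[OF A]
  show ?thesis
  proof (rule is_dgl_of_endomorphisms[OF graded DerD(1)[OF d(1)] d(2), where \<phi> = "\<lambda>n \<theta>. \<theta>"],
      unfold Der_dgl_def dgl.select_convs)
    show "module (\<lambda>c (\<theta> :: 'a \<Rightarrow> 'a) x. smul A c (\<theta> x))" by (rule module_pointwise[OF module])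
    show "comm_br (- 1) n (diff A) \<theta> \<in> Der (n - 1) A" if "\<theta> \<in> Der n A" for n \<theta>
      using comm_br_Der[OF d(1) that] by simp
  qed (auto simp: Der_subspace DerD(1) comm_br_Der)
qed

text \<open>
  The closure properties of the semidirect product of \<open>Der A\<close> and \<open>sA\<close>. Its Lie axioms are
  inherited below from the Hochschild complex, into which it embeds.
\<close>

lemma tDer_closed:
  fixes A :: "('k::comm_ring_1, 'a::ring_1) dga"
  assumes A: "is_dga A"
  shows "module (lscale (tDer_dgl A))"
    and "module.subspace (lscale (tDer_dgl A)) (lcar (tDer_dgl A) n)"
    and "z \<in> lcar (tDer_dgl A) n \<Longrightarrow> ldiff (tDer_dgl A) n z \<in> lcar (tDer_dgl A) (n - 1)"
    and "z \<in> lcar (tDer_dgl A) m \<Longrightarrow> z' \<in> lcar (tDer_dgl A) n \<Longrightarrow>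
       lbr (tDer_dgl A) m n z z' \<in> lcar (tDer_dgl A) (m + n)"
proof -
  interpret galgebra A by (rule is_dga_galgebra[OF A])
  note d = is_dgaD[OF A]
  have F: "module (\<lambda>c (\<theta> :: 'a \<Rightarrow> 'a) x. smul A c (\<theta> x))" by (rule module_pointwise[OF module])
  note sF = module.subspace_diff[OF F Der_subspace]
  show L: "module (lscale (tDer_dgl A))"
    unfolding tDer_dgl_def dgl.select_convs by (rule module_times[OF F module])
  show "module.subspace (lscale (tDer_dgl A)) (lcar (tDer_dgl A) n)"
  proof (rule module.subspaceI[OF L])
  qed (use module.subspace_0[OF F Der_subspace] module.subspace_add[OF F Der_subspace]
        module.subspace_scale[OF F Der_subspace]
      in \<open>auto simp: tDer_dgl_def zero_prod_def gr_zero gr_add gr_scale\<close>)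
  show "ldiff (tDer_dgl A) n z \<in> lcar (tDer_dgl A) (n - 1)" if z: "z \<in> lcar (tDer_dgl A) n"
  proof -
    obtain \<theta> x where z': "z = (\<theta>, x)" "\<theta> \<in> Der n A" "x \<in> gr A (n - 1)"
      using z by (cases z) (auto simp: tDer_dgl_def)
    have "comm_br (- 1) n (diff A) \<theta> \<in> Der (n - 1) A" using comm_br_Der[OF d(1) z'(2)] by simp
    moreover have "ad A (n - 1) x \<in> Der (n - 1) A"
      unfolding ad_eq[OF A z'(3)] by (rule inner_derivation[OF z'(3)])
    ultimately have "(\<lambda>y. comm_br (- 1) n (diff A) \<theta> y - ad A (n - 1) x y) \<in> Der (n - 1) A"
      using sF[of "comm_br (- 1) n (diff A) \<theta>" "n - 1" "ad A (n - 1) x"] by (simp add: fun_diff_def)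
    moreover have "- diff A x \<in> gr A (n - 1 - 1)" using DerD(3)[OF d(1) z'(3)] by (simp add: gr_neg)
    ultimately show ?thesis by (simp add: tDer_dgl_def z'(1))
  qed
  show "lbr (tDer_dgl A) m n z z' \<in> lcar (tDer_dgl A) (m + n)"
    if z: "z \<in> lcar (tDer_dgl A) m" and z': "z' \<in> lcar (tDer_dgl A) n"
  proof -
    obtain \<theta> x where *: "z = (\<theta>, x)" "\<theta> \<in> Der m A" "x \<in> gr A (m - 1)"
      using z by (cases z) (auto simp: tDer_dgl_def)
    obtain \<theta>' x' where **: "z' = (\<theta>', x')" "\<theta>' \<in> Der n A" "x' \<in> gr A (n - 1)"
      using z' by (cases z') (auto simp: tDer_dgl_def)
    have "\<theta> x' \<in> gr A (m + n - 1)" using DerD(3)[OF *(2) **(3)] by (simp add: algebra_simps)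
    moreover have "\<theta>' x \<in> gr A (m + n - 1)" using DerD(3)[OF **(2) *(3)] by (simp add: algebra_simps)
    ultimately show ?thesis using comm_br_Der[OF *(2) **(2)]
      by (simp add: tDer_dgl_def *(1) **(1) gr_diff gr_ksign del: ksign_simps)
  qed
qed


section \<open>Tensor algebras and their derivations\<close>

locale tensor_alg =
  fixes V :: "('k::comm_ring_1, 'v::ab_group_add, 'm) gmod_scheme"
    and T :: "('k, 't::ring_1, 'n) gmod_scheme" and \<iota> :: "'v \<Rightarrow> 't"
  assumes graded_V: "graded_module V" and tensor_algebra: "tensor_algebra V T \<iota>"
begin

abbreviation "word vs \<equiv> prod_list (map \<iota> vs)"

lemma tensor_powers: "tensor_powers V T word"
  using tensor_algebra by (simp add: tensor_algebra_def)

lemma algebra_scale: "algebra_scale (smul T)"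
  using tensor_algebra by (simp add: tensor_algebra_def)

lemma gen_hom: "module_hom (smul V) (smul T) \<iota>"
  using word_multilinear[OF tensor_powers, of "[]" _ _ "[]"] algebra_scale
  by (intro module_homI[OF graded_module_module[OF graded_V]]) (simp_all add: algebra_scale_def)

sublocale tpow V T word "\<lambda>v x. \<iota> v * x"
proof
  have T: "module (smul T)" using algebra_scale by (simp add: algebra_scale_def)
  have s: "smul T c x * y = smul T c (x * y)" "x * smul T c y = smul T c (x * y)" for c x y
    using algebra_scale unfolding algebra_scale_def by metis+
  show "bilin (smul V) (smul T) (smul T) (\<lambda>v x. \<iota> v * x)"
    by (rule bilinI[OF graded_module_module[OF graded_V] T T])
       (simp_all add: module_hom.add[OF gen_hom] module_hom.scale[OF gen_hom] distrib_left distrib_right s)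
qed (simp_all add: graded_V tensor_powers)

sublocale galgebra T
proof
  show "1 \<in> gr T 0" using unit_gr by simp
  fix x y i j assume x: "x \<in> gr T i" and y: "y \<in> gr T j"
  note M = algebra_scale[unfolded algebra_scale_def]
  show "x * y \<in> gr T (i + j)"
  proof (rule gr_word_induct[OF x])
    have h: "module_hom (smul T) (smul T) (\<lambda>x. x * y)"
      using M by (intro module_homI) (auto simp: distrib_right)
    show "module.subspace (smul T) {x. x * y \<in> gr T (i + j)}"
      by (rule module_hom.subspace_linear_preimage[OF h subspace_gr_T])
    fix "is" vs assume "homog V is vs" "sum_list is = i"
    then show "word vs * y \<in> gr T (i + j)"
    proof (induction vs arbitrary: "is" i)
      case Nil
      then show ?case using y by (simp add: homog_def)
    next
      case (Cons v vs)
      then obtain k js where *: "is = k # js" "v \<in> gr V k" "homog V js vs" by (auto simp: homog_Cons)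
      have "word vs * y \<in> gr T (sum_list js + j)" using Cons.IH[OF *(3) refl] .
      from cons_gr[OF *(2) this] show ?case
        using Cons.prems(2) by (simp add: *(1) mult.assoc add.assoc[symmetric])
    qed
  qed
qed (simp_all add: graded_T algebra_scale)

lemma gen_gr: "v \<in> gr V i \<Longrightarrow> \<iota> v \<in> gr T i"
  using word_gr[of "[i]" "[v]"] by (simp add: homog_def)

lemma tw_gen: "tw T n (\<iota> v) = \<iota> (tw V n v)"
  using tw_cons[of n v 1] by simp

lemma counit_one [simp]: "counit 1 = 1"
  using counit_unit by simp

lemma counit_gen [simp]: "counit (\<iota> v * x) = 0"
  by (rule counit_cons)

lemma counit_mult: "counit (x * y) = counit x * counit y"
proof (induction x rule: cons_induct)
  case (add x x')
  then show ?case by (simp add: distrib_right module_hom.add[OF counit_hom])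
next
  case (scale c x)
  then show ?case by (simp add: smul_mult module_hom.scale[OF counit_hom])
qed (simp_all add: mult.assoc)

lemma counit_tw: "counit (tw T n x) = counit x"
proof (induction x rule: cons_induct)
  case (add x x')
  then show ?case by (simp add: tw_linear module_hom.add[OF counit_hom])
next
  case (scale c x)
  then show ?case by (simp add: tw_linear module_hom.scale[OF counit_hom])
qed (simp_all add: tw_mult tw_gen)

text \<open>
  The recursion is the Leibniz rule for a product of a generator and the remaining word.
\<close>

definition der :: "int \<Rightarrow> ('v \<Rightarrow> 't) \<Rightarrow> 't \<Rightarrow> 't" where
  "der n \<phi> = tfold (smul T) 0 (\<lambda>v x y. \<phi> v * x + tw T n (\<iota> v) * y)"

lemma
  assumes \<phi>: "module_hom (smul V) (smul T) \<phi>" "\<And>i v. v \<in> gr V i \<Longrightarrow> \<phi> v \<in> gr T (i + n)"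
  shows der_Der: "der n \<phi> \<in> Der n T" and der_gen: "der n \<phi> (\<iota> v) = \<phi> v"
proof -
  have "rec_step (smul T) (\<lambda>v x y. \<phi> v * x + tw T n (\<iota> v) * y)"
    by (simp add: rec_step_def module module_hom.add[OF \<phi>(1)] module_hom.scale[OF \<phi>(1)]
        module_hom.add[OF gen_hom] module_hom.scale[OF gen_hom] tw_linear smul_mult
        module.scale_right_distrib[OF module] algebra_simps)
  note f = tfold[OF this, of 0, folded der_def]
  have c: "der n \<phi> (\<iota> v * x) = \<phi> v * x + tw T n (\<iota> v) * der n \<phi> x" for v x by (rule f(3))
  have 1: "der n \<phi> 1 = 0" using f(2) by simp
  show "der n \<phi> (\<iota> v) = \<phi> v" using c[of v 1] by (simp add: 1)
  have "der n \<phi> \<in> Hom n T T"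
  proof (rule HomI_rec[OF f(1) subspace_gr])
    show "der n \<phi> (word []) \<in> gr T n" by (simp add: 1 gr_zero)
    fix i p v x assume *: "v \<in> gr V i" "x \<in> gr T p" "der n \<phi> x \<in> gr T (p + n)"
    have "\<phi> v * x \<in> gr T (i + p + n)" using mult_gr[OF \<phi>(2)[OF *(1)] *(2)] by (simp add: algebra_simps)
    moreover have "tw T n (\<iota> v) * der n \<phi> x \<in> gr T (i + p + n)"
      using mult_gr[OF tw_in_gr[OF graded gen_gr[OF *(1)]] *(3)] by (simp add: algebra_simps)
    ultimately show "der n \<phi> (\<iota> v * x) \<in> gr T (i + p + n)" unfolding c by (rule gr_add)
  qed
  then show "der n \<phi> \<in> Der n T"
  proof (rule DerI)
    fix x y show "der n \<phi> (x * y) = der n \<phi> x * y + tw T n x * der n \<phi> y"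
    proof (induction x rule: cons_induct)
      case (cons v x)
      then show ?case by (simp add: mult.assoc c tw_mult algebra_simps)
    qed (simp_all add: 1 distrib_right module_hom.add[OF f(1)] module_hom.scale[OF f(1)]
          tw_linear smul_mult module.scale_right_distrib[OF module])
  qed
qed

text \<open>
  This covers derivations of \<open>T\<close> (with \<open>j\<close> the identity) and also derivations along an algebra map \<open>j\<close>
  into another algebra, such as composites of \<open>j\<close> with a derivation of the target.
\<close>

lemma Leibniz_unique:
  assumes X: "module_hom (smul T) sN X" and Y: "module_hom (smul T) sN Y"
    and X1: "X 1 = Y 1" and gen: "\<And>v i. v \<in> gr V i \<Longrightarrow> X (\<iota> v) = Y (\<iota> v)"
    and LX: "\<And>v x. X (\<iota> v * x) = X (\<iota> v) * j x + s (\<iota> v) * X x"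
    and LY: "\<And>v x. Y (\<iota> v * x) = Y (\<iota> v) * j x + s (\<iota> v) * (Y x :: 'r::ring_1)"
  shows "X x = Y x"
proof -
  have g: "X (\<iota> v) = Y (\<iota> v)" for v
    by (rule graded_hom_eq[OF graded_V module_hom_comp[OF X gen_hom] module_hom_comp[OF Y gen_hom]])
       (rule gen)
  show ?thesis
    by (rule hom_eq[OF X Y]) (simp_all add: X1, simp only: LX LY g)
qed

lemma Der_unique:
  assumes X: "X \<in> Der n T" and Y: "Y \<in> Der n T" and gen: "\<And>v i. v \<in> gr V i \<Longrightarrow> X (\<iota> v) = Y (\<iota> v)"
  shows "X = Y"
proof
  show "X x = Y x" for x
    by (rule Leibniz_unique[OF DerD(2)[OF X] DerD(2)[OF Y] _ gen, where j = "\<lambda>x. x" and s = "tw T n"])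
       (simp_all add: DerD(4,11)[OF X] DerD(4,11)[OF Y])
qed

end


section \<open>The tensor coalgebra and its coderivations\<close>

lemma smul_susp [simp]: "smul (susp M) = smul M"
  and gr_susp [simp]: "gr (susp M) i = gr M (i - 1)"
  by (simp_all add: susp_def)

lemma graded_module_susp:
  assumes "graded_module M" shows "graded_module (susp M)"
proof -
  have "\<exists>!c. (\<forall>i. Poly_Mapping.lookup c i \<in> gr M (i - 1)) \<and>
      x = (\<Sum>i\<in>Poly_Mapping.keys c. Poly_Mapping.lookup c i)" for x
  proof (rule ex1I)
    have inj: "inj (\<lambda>i :: int. i - 1)" "inj (\<lambda>i :: int. i + 1)" by (auto simp: inj_def)
    let ?c = "Poly_Mapping.map_key (\<lambda>i. i - 1) (dec M x)"
    have l: "Poly_Mapping.lookup ?c i = Poly_Mapping.lookup (dec M x) (i - 1)" for i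
      by (simp add: Poly_Mapping.map_key.rep_eq inj)
    have "(\<Sum>i\<in>Poly_Mapping.keys ?c. Poly_Mapping.lookup ?c i) =
        (\<Sum>i\<in>Poly_Mapping.keys (dec M x). Poly_Mapping.lookup (dec M x) i)"
      by (rule sum.reindex_bij_witness[of _ "\<lambda>i. i + 1" "\<lambda>i. i - 1"]) (auto simp: in_keys_iff l)
    then show "(\<forall>i. Poly_Mapping.lookup ?c i \<in> gr M (i - 1)) \<and>
        x = (\<Sum>i\<in>Poly_Mapping.keys ?c. Poly_Mapping.lookup ?c i)"
      using dec[OF assms] by (simp add: l)
    fix c assume c: "(\<forall>i. Poly_Mapping.lookup c i \<in> gr M (i - 1)) \<and>
        x = (\<Sum>i\<in>Poly_Mapping.keys c. Poly_Mapping.lookup c i)"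
    let ?e = "Poly_Mapping.map_key (\<lambda>i. i + 1) c"
    have le: "Poly_Mapping.lookup ?e i = Poly_Mapping.lookup c (i + 1)" for i
      by (simp add: Poly_Mapping.map_key.rep_eq inj)
    have "dec M x = ?e"
    proof (rule dec_unique[OF assms _ finite_keys subset_refl])
      show "Poly_Mapping.lookup ?e i \<in> gr M i" for i
        using conjunct1[OF c, rule_format, of "i + 1"] by (simp add: le)
      have "(\<Sum>i\<in>Poly_Mapping.keys ?e. Poly_Mapping.lookup ?e i) =
          (\<Sum>i\<in>Poly_Mapping.keys c. Poly_Mapping.lookup c i)"
        by (rule sum.reindex_bij_witness[of _ "\<lambda>i. i - 1" "\<lambda>i. i + 1"]) (auto simp: in_keys_iff le)
      then show "(\<Sum>i\<in>Poly_Mapping.keys ?e. Poly_Mapping.lookup ?e i) = x"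
        using conjunct2[OF c] by (rule trans[OF _ sym])
    qed
    then have "Poly_Mapping.lookup (dec M x) i = Poly_Mapping.lookup c (i + 1)" for i
      by (simp only: le)
    then show "c = ?c" by (intro poly_mapping_eqI) (simp add: l)
  qed
  then show ?thesis using assms unfolding graded_module_def smul_susp gr_susp by blast
qed

lemma tw_susp:
  assumes M: "graded_module M" shows "tw (susp M) n x = ksign n (tw M n x)"
proof (rule graded_hom_eq[OF graded_module_susp[OF M] tw_hom[OF graded_module_susp[OF M]]])
  show "module_hom (smul (susp M)) (smul (susp M)) (\<lambda>x. ksign n (tw M n x))"
    unfolding smul_susp by (rule module_hom_ksign[OF tw_hom[OF M]])
  fix i x assume x: "x \<in> gr (susp M) i"
  then show "tw (susp M) n x = ksign n (tw M n x)"
    using tw_gr[OF graded_module_susp[OF M] x] tw_gr[OF M, of x "i - 1"] by (simp add: ksign_def)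
qed

text \<open>
  The sum over all ways to cut a word in two. For \<open>F x y = [x] \<otimes> [y]\<close> it is the deconcatenation
  coproduct, and \<open>splitsum_assoc\<close> is its coassociativity.
\<close>

definition splitsum :: "('a list \<Rightarrow> 'a list \<Rightarrow> 'b::comm_monoid_add) \<Rightarrow> 'a list \<Rightarrow> 'b" where
  "splitsum F as = (\<Sum>i\<le>length as. F (take i as) (drop i as))"

lemma splitsum_simps [simp]:
  "splitsum F [] = F [] []"
  "splitsum F (a # as) = F [] (a # as) + splitsum (\<lambda>x y. F (a # x) y) as"
  by (simp_all add: splitsum_def sum.atMost_Suc_shift del: sum.atMost_Suc)

lemma splitsum_add: "splitsum (\<lambda>x y. F x y + G x y) as = splitsum F as + splitsum G as"
  by (simp add: splitsum_def sum.distrib)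

lemma splitsum_zero [simp]: "splitsum (\<lambda>x y. 0) as = 0"
  by (simp add: splitsum_def)

lemma splitsum_cong: "(\<And>x y. x @ y = as \<Longrightarrow> F x y = G x y) \<Longrightarrow> splitsum F as = splitsum G as"
  unfolding splitsum_def by (rule sum.cong) auto

lemma splitsum_hom: "module_hom s1 s2 f \<Longrightarrow> f (splitsum F as) = splitsum (\<lambda>x y. f (F x y)) as"
  by (simp add: splitsum_def module_hom.sum)

lemma splitsum_select:
  "splitsum (\<lambda>x y. if y = [] then F x else 0) as = F as"
  "splitsum (\<lambda>x y. if x = [] then F y else 0) as = F as"
  by (induction as arbitrary: F) simp_all

lemma splitsum_assoc:
  "splitsum (\<lambda>x y. splitsum (\<lambda>u v. F x u v) y) as = splitsum (\<lambda>x y. splitsum (\<lambda>u v. F u v y) x) as"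
  by (induction as arbitrary: F) (simp_all add: splitsum_add add.assoc)

text \<open>
  The coalgebra \<open>TC(sA)\<close> with \<open>cons a\<close> the map \<open>[a\<^sub>1|\<dots>|a\<^sub>k] \<mapsto> [a|a\<^sub>1|\<dots>|a\<^sub>k]\<close>.
\<close>

locale hochschild = galgebra A
  for A :: "('k::comm_ring_1, 'a::ring_1) dga" +
  fixes C :: "('k, 'c::ab_group_add) gmod" and bar :: "'a list \<Rightarrow> 'c"
    and sc2 :: "'k \<Rightarrow> 'e::ab_group_add \<Rightarrow> 'e" and t :: "'c \<Rightarrow> 'c \<Rightarrow> 'e"
    and cons :: "'a \<Rightarrow> 'c \<Rightarrow> 'c"
  assumes dga: "is_dga A"
    and tensor_powers: "tensor_powers (susp A) C bar"
    and tensor_product: "tensor_product (smul C) (smul C) sc2 t"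
    and cons_bilin: "bilin (smul A) (smul C) (smul C) cons"
    and cons_word: "cons a (bar as) = bar (a # as)"
begin

sublocale C: tpow "susp A" C bar cons
  by unfold_locales
    (simp_all add: graded_module_susp[OF graded] tensor_powers cons_bilin cons_word)

lemmas C_graded = C.graded_T
lemmas C_module = C.module_T
lemmas cons_linear = bilin_simps[OF cons_bilin]
lemmas t_bilin = tensor_product_bilin[OF C_module C_module tensor_product]
lemmas t_simps = bilin_simps[OF t_bilin]
lemmas E_module = bilin_modules(3)[OF t_bilin]
lemmas E_eq = tensor_product_hom_eq[OF tensor_product]

abbreviation "u \<equiv> bar []"

abbreviation "lin \<equiv> module_hom (smul C) (smul A)"

lemma rec_stepI:
  assumes "module sN"
    and "\<And>a b x y. K (a + b) x y = K a x y + K b x y" "\<And>c a x y. K (smul A c a) x y = sN c (K a x y)"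
    and "\<And>a x x' y y'. K a (x + x') (y + y') = K a x y + K a x' y'"
    and "\<And>c a x y. K a (smul C c x) (sN c y) = sN c (K a x y)"
  shows "C.rec_step sN K"
  using assms by (simp add: C.rec_step_def)

definition tlift :: "('k \<Rightarrow> 'x::ab_group_add \<Rightarrow> 'x) \<Rightarrow> ('c \<Rightarrow> 'c \<Rightarrow> 'x) \<Rightarrow> 'e \<Rightarrow> 'x" where
  "tlift sQ f = (SOME \<phi>. module_hom sc2 sQ \<phi> \<and> (\<forall>x y. \<phi> (t x y) = f x y))"

lemma tlift:
  assumes "bilin (smul C) (smul C) sQ f"
  shows "module_hom sc2 sQ (tlift sQ f)" "tlift sQ f (t x y) = f x y"
  using someI_ex[OF tensor_product_lift[OF tensor_product assms], folded tlift_def] by auto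

definition cons_tensor :: "'a \<Rightarrow> 'e \<Rightarrow> 'e" where
  "cons_tensor a = tlift sc2 (\<lambda>x y. t (cons a x) y)"

lemma cons_tensor:
  "module_hom sc2 sc2 (cons_tensor a)" "cons_tensor a (t x y) = t (cons a x) y"
proof -
  have "bilin (smul C) (smul C) sc2 (\<lambda>x y. t (cons a x) y)"
    by (rule bilinI[OF C_module C_module E_module]) (simp_all add: t_simps cons_linear)
  from tlift[OF this] show "module_hom sc2 sc2 (cons_tensor a)"
    "cons_tensor a (t x y) = t (cons a x) y" unfolding cons_tensor_def .
qed

lemma cons_tensor_bilin: "bilin (smul A) sc2 sc2 cons_tensor"
proof (rule bilinI[OF module E_module E_module])
  fix a b y c
  show "cons_tensor (a + b) y = cons_tensor a y + cons_tensor b y"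
    by (rule E_eq[OF cons_tensor(1) module_hom_plus(1)[OF cons_tensor(1) cons_tensor(1)]])
       (simp add: cons_tensor(2) cons_linear t_simps)
  show "cons_tensor (smul A c a) y = sc2 c (cons_tensor a y)"
    by (rule E_eq[OF cons_tensor(1) module_hom_multiple(2)[OF cons_tensor(1)]])
       (simp add: cons_tensor(2) cons_linear t_simps)
qed (simp_all add: module_hom.add[OF cons_tensor(1)] module_hom.scale[OF cons_tensor(1)])

text \<open>
  A word \<open>a # as\<close> is cut either in front of \<open>a\<close> or inside \<open>as\<close>.
\<close>

definition \<Delta> :: "'c \<Rightarrow> 'e" where
  "\<Delta> = C.tfold sc2 (t u u) (\<lambda>a x e. t u (cons a x) + cons_tensor a e)"

lemma \<Delta>_step: "C.rec_step sc2 (\<lambda>a x e. t u (cons a x) + cons_tensor a e)"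
  by (rule rec_stepI[OF E_module])
     (simp_all add: bilin_simps[OF cons_tensor_bilin] t_simps cons_linear
        module.scale_right_distrib[OF E_module])

lemma \<Delta>_hom: "module_hom (smul C) sc2 \<Delta>" and \<Delta>_u: "\<Delta> u = t u u"
  and \<Delta>_cons: "\<Delta> (cons a x) = t u (cons a x) + cons_tensor a (\<Delta> x)"
  unfolding \<Delta>_def by (rule C.tfold[OF \<Delta>_step])+

lemma \<Delta>_bar: "\<Delta> (bar as) = splitsum (\<lambda>x y. t (bar x) (bar y)) as"
  by (induction as)
     (simp_all add: \<Delta>_u cons_word[symmetric] \<Delta>_cons splitsum_hom[OF cons_tensor(1)] cons_tensor(2))

lemma deconcat_eq: "deconcat C bar sc2 t = \<Delta>"
  unfolding deconcat_def
proof (rule the_equality)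
  show "module_hom (smul C) sc2 \<Delta> \<and>
      (\<forall>as. \<Delta> (bar as) = (\<Sum>i\<le>length as. t (bar (take i as)) (bar (drop i as))))"
    using \<Delta>_hom \<Delta>_bar by (simp add: splitsum_def)
  fix D assume D: "module_hom (smul C) sc2 D \<and>
      (\<forall>as. D (bar as) = (\<Sum>i\<le>length as. t (bar (take i as)) (bar (drop i as))))"
  show "D = \<Delta>"
  proof
    show "D x = \<Delta> x" for x
      by (rule presented_hom_eq[OF C.presented conjunct1[OF D] \<Delta>_hom])
         (simp add: D \<Delta>_bar splitsum_def)
  qed
qed

abbreviation "counit \<equiv> C.counit"

definition p :: "'c \<Rightarrow> 'a" where "p = C.tfold (smul A) 0 (\<lambda>a x y. smul A (counit x) a)"

lemma p_step: "C.rec_step (smul A) (\<lambda>a x y. smul A (counit x) a)"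
proof -
  interpret M: module "smul A" by (rule module)
  show ?thesis
    by (rule rec_stepI[OF module])
       (simp_all add: M.scale_right_distrib M.scale_left_distrib mult.commute
          module_hom.add[OF C.counit_hom] module_hom.scale[OF C.counit_hom])
qed

lemma p_hom: "lin p" and p_u [simp]: "p u = 0"
  and p_cons [simp]: "p (cons a x) = smul A (counit x) a"
  unfolding p_def by (rule C.tfold[OF p_step])+

lemma smul_simps [simp]: "smul A 1 x = x" "smul A 0 x = 0" "smul C 1 z = z" "smul C 0 z = 0"
  using module C_module by (simp_all add: module.scale_one module.scale_zero_left)

lemma p_bar: "p (bar as) = (if length as = 1 then hd as else 0)"
  by (cases as) (simp_all add: cons_word[symmetric] C.counit_word)

lemma bar_proj_eq: "bar_proj A C bar = p"
  unfolding bar_proj_def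
proof (rule the_equality)
  show "module_hom (smul C) (smul (susp A)) p \<and> (\<forall>a. p (bar [a]) = a) \<and>
      (\<forall>as. length as \<noteq> 1 \<longrightarrow> p (bar as) = 0)"
    using p_hom by (simp add: p_bar)
  fix q assume q: "module_hom (smul C) (smul (susp A)) q \<and> (\<forall>a. q (bar [a]) = a) \<and>
      (\<forall>as. length as \<noteq> 1 \<longrightarrow> q (bar as) = 0)"
  then have h: "lin q" by simp
  show "q = p"
  proof
    show "q x = p x" for x
      by (rule presented_hom_eq[OF C.presented h p_hom])
         (use q in \<open>auto simp: p_bar length_Suc_conv\<close>)
  qed
qed

lemma p_Hom: "p \<in> Hom (- 1) C A"
proof (rule C.HomI_rec[OF p_hom subspace_gr])
  fix i q a x assume *: "a \<in> gr (susp A) i" "x \<in> gr C q"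
  show "p (cons a x) \<in> gr A (i + q + - 1)"
    using * C.counit_gr[OF *(2)] by (cases "q = 0") (simp_all add: gr_scale gr_zero)
qed (simp add: gr_zero)

abbreviation "tws \<equiv> tw (susp A)"

lemma tws_linear:
  "tws n (x + y) = tws n x + tws n y" "tws n (smul A c x) = smul A c (tws n x)"
  using module_hom.add[OF tw_hom[OF C.graded_V]] module_hom.scale[OF tw_hom[OF C.graded_V]] by auto

lemma bar_eq:
  assumes "module_hom (smul C) sN f" "module_hom (smul C) sN g" "\<And>as. f (bar as) = g (bar as)"
  shows "f x = g x"
  by (rule presented_hom_eq[OF C.presented assms])

text \<open>
  \<open>ins g\<close> applies \<open>g\<close> to all prefixes of a word and keeps the suffix. The coderivation with
  corestriction \<open>g\<close> applies \<open>g\<close> to all subwords; on a word \<open>a # as\<close> it either moves past \<open>a\<close> or acts on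
  a prefix, which gives a recursion.
\<close>

definition ins :: "('c \<Rightarrow> 'a) \<Rightarrow> 'c \<Rightarrow> 'c" where
  "ins g x = tlift (smul C) (\<lambda>x y. cons (g x) y) (\<Delta> x)"

definition coder :: "int \<Rightarrow> ('c \<Rightarrow> 'a) \<Rightarrow> 'c \<Rightarrow> 'c" where
  "coder n g = C.tfold (smul C) (cons (g u) u) (\<lambda>a x y. cons (tws (n + 1) a) y + ins g (cons a x))"

lemma ins:
  assumes g: "lin g"
  shows ins_hom: "module_hom (smul C) (smul C) (ins g)"
    and ins_bar: "ins g (bar as) = splitsum (\<lambda>x y. cons (g (bar x)) (bar y)) as"
proof -
  have "bilin (smul C) (smul C) (smul C) (\<lambda>x y. cons (g x) y)"
    by (rule bilinI[OF C_module C_module C_module])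
       (simp_all add: cons_linear module_hom.add[OF g] module_hom.scale[OF g])
  note l = tlift[OF this]
  show "module_hom (smul C) (smul C) (ins g)"
    unfolding ins_def by (rule module_hom_comp[OF l(1) \<Delta>_hom])
  show "ins g (bar as) = splitsum (\<lambda>x y. cons (g (bar x)) (bar y)) as"
    by (simp add: ins_def \<Delta>_bar splitsum_hom[OF l(1)] l(2))
qed

lemma coder:
  assumes g: "lin g"
  shows coder_hom: "module_hom (smul C) (smul C) (coder n g)"
    and coder_u: "coder n g u = cons (g u) u"
    and coder_cons: "coder n g (cons a x) = cons (tws (n + 1) a) (coder n g x) + ins g (cons a x)"
proof -
  have "C.rec_step (smul C) (\<lambda>a x y. cons (tws (n + 1) a) y + ins g (cons a x))"
    by (rule rec_stepI[OF C_module])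
       (simp_all add: cons_linear tws_linear module_hom.add[OF ins_hom[OF g]]
          module_hom.scale[OF ins_hom[OF g]] module.scale_right_distrib[OF C_module])
  from C.tfold[OF this] show "module_hom (smul C) (smul C) (coder n g)" "coder n g u = cons (g u) u"
    "coder n g (cons a x) = cons (tws (n + 1) a) (coder n g x) + ins g (cons a x)"
    unfolding coder_def by auto
qed

lemma counit_ins: "lin g \<Longrightarrow> counit (ins g x) = 0"
  by (rule bar_eq[OF module_hom_comp[OF C.counit_hom ins_hom]])
     (auto simp: ins_bar splitsum_hom[OF C.counit_hom] module_hom_iff C_module module_self)

lemma counit_coder: "lin g \<Longrightarrow> counit (coder n g x) = 0"
proof (induction x rule: C.cons_induct)
  case (cons v x)
  then show ?case by (simp add: coder_cons module_hom.add[OF C.counit_hom] counit_ins)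
qed (simp_all add: coder_u module_hom.add[OF coder_hom] module_hom.scale[OF coder_hom]
      module_hom.add[OF C.counit_hom] module_hom.scale[OF C.counit_hom])

lemma p_ins:
  assumes g: "lin g" shows "p (ins g x) = g x"
proof (rule bar_eq[OF module_hom_comp[OF p_hom ins_hom[OF g]] g])
  fix as
  have "p (ins g (bar as)) = splitsum (\<lambda>x y. if y = [] then g (bar x) else 0) as"
    unfolding ins_bar[OF g] splitsum_hom[OF p_hom] by (rule splitsum_cong) (simp add: C.counit_word)
  then show "p (ins g (bar as)) = g (bar as)" by (simp add: splitsum_select)
qed

lemma p_coder:
  assumes g: "lin g" shows "p (coder n g x) = g x"
proof (induction x rule: C.cons_induct)
  case (cons v x)
  then show ?case by (simp add: coder_cons[OF g] module_hom.add[OF p_hom] counit_coder[OF g] p_ins[OF g])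
qed (simp_all add: coder_u[OF g] module_hom.add[OF coder_hom[OF g]] module_hom.scale[OF coder_hom[OF g]]
      module_hom.add[OF p_hom] module_hom.scale[OF p_hom] module_hom.add[OF g] module_hom.scale[OF g])

lemma homog_take_drop:
  assumes "homog (susp A) is as"
  shows "bar (take i as) \<in> gr C (sum_list (take i is))" "bar (drop i as) \<in> gr C (sum_list (drop i is))"
  using assms by (auto intro!: C.word_gr simp: homog_def list_all2_takeI list_all2_dropI)

lemma ins_Hom:
  assumes g: "g \<in> Hom n C A" shows "ins g \<in> Hom (n + 1) C C"
proof (rule HomI[OF ins_hom[OF HomD(1)[OF g]]])
  note h = HomD(1)[OF g]
  fix q x assume "x \<in> gr C q"
  then show "ins g x \<in> gr C (q + (n + 1))"
  proof (rule C.gr_word_induct)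
    show "module.subspace (smul C) {x. ins g x \<in> gr C (q + (n + 1))}"
      by (rule module_hom.subspace_linear_preimage[OF ins_hom[OF h] C.subspace_gr_T])
    fix "is" as assume *: "homog (susp A) is as" "sum_list is = q"
    have "cons (g (bar (take i as))) (bar (drop i as)) \<in> gr C (q + (n + 1))" for i
    proof -
      have 1: "g (bar (take i as)) \<in> gr (susp A) (sum_list (take i is) + (n + 1))"
        using HomD(2)[OF g homog_take_drop(1)[OF *(1)], of i] by simp
      have "sum_list (take i is) + sum_list (drop i is) = q"
        unfolding *(2)[symmetric] sum_list_append[symmetric] append_take_drop_id ..
      then have e: "sum_list (take i is) + (n + 1) + sum_list (drop i is) = q + (n + 1)" by simp
      show ?thesis using C.cons_gr[OF 1 homog_take_drop(2)[OF *(1), of i]] unfolding e .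
    qed
    then show "ins g (bar as) \<in> gr C (q + (n + 1))"
      unfolding ins_bar[OF h] splitsum_def
      by (intro module.subspace_sum[OF C_module C.subspace_gr_T]) blast
  qed
qed

lemma coder_Hom:
  assumes g: "g \<in> Hom n C A" shows "coder n g \<in> Hom (n + 1) C C"
proof (rule C.HomI_rec[OF coder_hom[OF HomD(1)[OF g]] C.subspace_gr_T])
  note h = HomD(1)[OF g]
  have gu: "g u \<in> gr A n" using HomD(2)[OF g C.unit_gr] by simp
  show "coder n g u \<in> gr C (n + 1)"
    using C.cons_gr[OF _ C.unit_gr, of "g u" "n + 1"] gu by (simp add: coder_u[OF h])
  fix i q a x assume *: "a \<in> gr (susp A) i" "x \<in> gr C q" "coder n g x \<in> gr C (q + (n + 1))"
  have "cons (tws (n + 1) a) (coder n g x) \<in> gr C (i + q + (n + 1))"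
    using C.cons_gr[OF tw_in_gr[OF C.graded_V *(1)] *(3)] by (simp add: add.assoc)
  moreover have "ins g (cons a x) \<in> gr C (i + q + (n + 1))"
    by (rule HomD(2)[OF ins_Hom[OF g] C.cons_gr[OF *(1,2)]])
  ultimately show "coder n g (cons a x) \<in> gr C (i + q + (n + 1))"
    unfolding coder_cons[OF h] by (rule module.subspace_add[OF C_module C.subspace_gr_T])
qed

text \<open>The operator \<open>\<beta> \<otimes> 1 + 1 \<otimes> \<beta>\<close> on \<open>TC(sA) \<otimes> TC(sA)\<close>.\<close>

definition tens :: "int \<Rightarrow> ('c \<Rightarrow> 'c) \<Rightarrow> 'e \<Rightarrow> 'e" where
  "tens m \<beta> = tlift sc2 (\<lambda>x y. t (\<beta> x) y + t (tw C m x) (\<beta> y))"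

lemma twC_linear:
  "tw C n (x + y) = tw C n x + tw C n y" "tw C n (smul C c x) = smul C c (tw C n x)"
  "tw C n (- x) = - tw C n x" "tw C n (x - y) = tw C n x - tw C n y"
  using module_hom.add[OF tw_hom[OF C_graded]] module_hom.scale[OF tw_hom[OF C_graded]]
    module_hom.neg[OF tw_hom[OF C_graded]] module_hom.diff[OF tw_hom[OF C_graded]] by auto

lemma tens:
  assumes \<beta>: "module_hom (smul C) (smul C) \<beta>"
  shows tens_hom: "module_hom sc2 sc2 (tens m \<beta>)"
    and tens_t: "tens m \<beta> (t x y) = t (\<beta> x) y + t (tw C m x) (\<beta> y)"
proof -
  have "bilin (smul C) (smul C) sc2 (\<lambda>x y. t (\<beta> x) y + t (tw C m x) (\<beta> y))"
    by (rule bilinI[OF C_module C_module E_module])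
       (simp_all add: t_simps module_hom.add[OF \<beta>] module_hom.scale[OF \<beta>] twC_linear
          module.scale_right_distrib[OF E_module])
  from tlift[OF this] show "module_hom sc2 sc2 (tens m \<beta>)"
    "tens m \<beta> (t x y) = t (\<beta> x) y + t (tw C m x) (\<beta> y)" unfolding tens_def by auto
qed

lemma tens_bar:
  assumes \<beta>: "module_hom (smul C) (smul C) \<beta>"
  shows "tens m \<beta> (\<Delta> (bar as)) =
     splitsum (\<lambda>x y. t (\<beta> (bar x)) (bar y) + t (tw C m (bar x)) (\<beta> (bar y))) as"
  by (simp add: \<Delta>_bar splitsum_hom[OF tens_hom[OF \<beta>]] tens_t[OF \<beta>])

text \<open>
  Cutting \<open>[g x|y]\<close> behind its first letter means to cut \<open>y\<close>. By coassociativity this is the same as cutting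
  the whole word first and then applying \<open>ins g\<close> to the first part.
\<close>

lemma \<Delta>_ins:
  assumes g: "lin g"
  shows "\<Delta> (ins g (bar as)) = t u (ins g (bar as)) + splitsum (\<lambda>x y. t (ins g (bar x)) (bar y)) as"
proof -
  have "\<Delta> (ins g (bar as)) = splitsum (\<lambda>x y. t u (cons (g (bar x)) (bar y))) as +
      splitsum (\<lambda>x y. splitsum (\<lambda>v z. t (cons (g (bar x)) (bar v)) (bar z)) y) as"
    by (simp add: ins_bar[OF g] splitsum_hom[OF \<Delta>_hom] \<Delta>_cons splitsum_add \<Delta>_bar
        splitsum_hom[OF cons_tensor(1)] cons_tensor(2))
  also have "splitsum (\<lambda>x y. splitsum (\<lambda>v z. t (cons (g (bar x)) (bar v)) (bar z)) y) as =
      splitsum (\<lambda>x y. t (ins g (bar x)) (bar y)) as"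
    by (subst splitsum_assoc) (simp add: ins_bar[OF g] splitsum_hom[OF bilin_hom(2)[OF t_bilin]])
  also have "splitsum (\<lambda>x y. t u (cons (g (bar x)) (bar y))) as = t u (ins g (bar as))"
    by (simp add: ins_bar[OF g] splitsum_hom[OF bilin_hom(1)[OF t_bilin]])
  finally show ?thesis .
qed

text \<open>
  Induction on the word. The recursive summand of \<open>coder\<close> is covered by the induction hypothesis, and
  \<open>ins g\<close> contributes exactly the terms in which \<open>coder\<close> acts on a prefix of the first factor.
\<close>

lemma coder_coderivation:
  assumes g: "lin g" shows "\<Delta> (coder n g x) = tens (n + 1) (coder n g) (\<Delta> x)"
proof (rule bar_eq[OF module_hom_comp[OF \<Delta>_hom coder_hom[OF g]]
      module_hom_comp[OF tens_hom[OF coder_hom[OF g]] \<Delta>_hom]])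
  fix as
  show "\<Delta> (coder n g (bar as)) = tens (n + 1) (coder n g) (\<Delta> (bar as))"
    unfolding tens_bar[OF coder_hom[OF g]]
  proof (induction as)
    case Nil
    show ?case using \<Delta>_ins[OF g, of "[]"]
      by (simp add: coder_u[OF g] ins_bar[OF g] C.tw_unit add.commute)
  next
    case (Cons a as)
    have word: "coder n g (bar (a # x)) = cons (tws (n + 1) a) (coder n g (bar x)) + ins g (bar (a # x))" for x
      by (simp add: cons_word[symmetric] coder_cons[OF g])
    have unit: "coder n g u = ins g u" by (simp add: coder_u[OF g] ins_bar[OF g])
    have twc: "tw C (n + 1) (bar (a # x)) = cons (tws (n + 1) a) (tw C (n + 1) (bar x))" for x
      by (simp only: cons_word[symmetric] C.tw_cons)
    have "\<Delta> (coder n g (bar (a # as))) = t u (cons (tws (n + 1) a) (coder n g (bar as))) +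
        cons_tensor (tws (n + 1) a) (\<Delta> (coder n g (bar as))) + (t u (ins g (bar (a # as))) +
        splitsum (\<lambda>x y. t (ins g (bar x)) (bar y)) (a # as))"
      by (simp only: word module_hom.add[OF \<Delta>_hom] \<Delta>_cons \<Delta>_ins[OF g])
    also have "cons_tensor (tws (n + 1) a) (\<Delta> (coder n g (bar as))) =
        splitsum (\<lambda>x y. t (cons (tws (n + 1) a) (coder n g (bar x))) (bar y) +
          t (cons (tws (n + 1) a) (tw C (n + 1) (bar x))) (coder n g (bar y))) as"
      by (simp only: Cons.IH splitsum_hom[OF cons_tensor(1)] module_hom.add[OF cons_tensor(1)] cons_tensor(2))
    finally show ?case
      unfolding splitsum_simps splitsum_add word unit twc t_simps C.tw_unit by (simp only: ac_simps)
  qed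
qed

text \<open>
  Projecting the first factor of \<open>\<Delta> y\<close> to length 1 and putting the two factors together again recovers \<open>y\<close>
  up to its component of length 0. For a primitive element this yields \<open>p y\<close>, and a primitive element of
  length 0 satisfies \<open>z = 2 z\<close>.
\<close>

lemma primitive_eq_0:
  assumes prim: "\<Delta> y = t y u + t u y" and py: "p y = 0"
  shows "y = 0"
proof -
  have pb: "bilin (smul C) (smul C) (smul C) (\<lambda>x y. cons (p x) y)"
    by (rule bilinI[OF C_module C_module C_module])
       (simp_all add: cons_linear module_hom.add[OF p_hom] module_hom.scale[OF p_hom])
  note l = tlift[OF pb]
  have "tlift (smul C) (\<lambda>x y. cons (p x) y) (\<Delta> x) = x - smul C (counit x) u" for x
  proof (rule bar_eq[OF module_hom_comp[OF l(1) \<Delta>_hom]])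
    show "module_hom (smul C) (smul C) (\<lambda>x. x - smul C (counit x) u)"
      by (rule module_hom_plus(2)[OF module.module_hom_ident[OF C_module]])
         (auto intro!: module_homI simp: C_module module.scale_left_distrib[OF C_module]
            module_hom.add[OF C.counit_hom] module_hom.scale[OF C.counit_hom] module.scale_scale[OF C_module])
    show "tlift (smul C) (\<lambda>x y. cons (p x) y) (\<Delta> (bar as)) = bar as - smul C (counit (bar as)) u" for as
    proof (cases as)
      case Nil
      then show ?thesis by (simp add: \<Delta>_u l(2) cons_linear)
    next
      case (Cons a as')
      have "splitsum (\<lambda>x y. cons (p (bar (a # x))) (bar y)) as' =
          splitsum (\<lambda>x y. if x = [] then cons a (bar y) else 0) as'"
        by (rule splitsum_cong) (simp add: p_bar cons_linear)
      then show ?thesis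
        by (simp add: Cons \<Delta>_bar module_hom.add[OF l(1)] splitsum_hom[OF l(1)] l(2)
            splitsum_select cons_linear C.counit_word cons_word cons_linear(5)[of "bar xs" for xs, unfolded cons_word])
    qed
  qed
  from this[of y] have "y - smul C (counit y) u = 0"
    by (simp add: prim module_hom.add[OF l(1)] l(2) py cons_linear)
  then have y: "y = smul C (counit y) u" by simp
  have "sc2 (counit y) (t u u) = sc2 (counit y) (t u u) + sc2 (counit y) (t u u)"
  proof -
    have "\<Delta> y = sc2 (counit y) (t u u)"
      by (subst y) (simp add: module_hom.scale[OF \<Delta>_hom] \<Delta>_u)
    moreover have "t y u = sc2 (counit y) (t u u)" "t u y = sc2 (counit y) (t u u)"
      by (subst y, simp add: t_simps)+
    ultimately show ?thesis using prim by simp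
  qed
  then have z: "sc2 (counit y) (t u u) = 0" by simp
  have cc: "bilin (smul C) (smul C) (*) (\<lambda>x y. counit x * counit y)"
    by (rule bilinI[OF C_module C_module module_self])
       (simp_all add: module_hom.add[OF C.counit_hom] module_hom.scale[OF C.counit_hom] algebra_simps)
  from module_hom.scale[OF tlift(1)[OF cc], of "counit y" "t u u"] have "counit y = 0"
    unfolding z by (simp add: tlift(2)[OF cc] module_hom.zero[OF tlift(1)[OF cc]])
  then show ?thesis using y by simp
qed

text \<open>
  By induction on length, the difference vanishes on all proper prefixes and suffixes of a word, so that
  its value on the word is primitive.
\<close>

lemma coderivation_unique:
  assumes X: "module_hom (smul C) (smul C) X" "\<And>x. \<Delta> (X x) = tens m X (\<Delta> x)"
    and Y: "module_hom (smul C) (smul C) Y" "\<And>x. \<Delta> (Y x) = tens m Y (\<Delta> x)"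
    and p: "\<And>x. p (X x) = p (Y x)"
  shows "X = Y"
proof
  define \<gamma> where "\<gamma> x = X x - Y x" for x
  have z: "\<gamma> (bar as) = 0" for as
  proof (induction as rule: measure_induct_rule[of length])
    case (less as)
    have "\<Delta> (\<gamma> (bar as)) =
        splitsum (\<lambda>x y. t (\<gamma> (bar x)) (bar y) + t (tw C m (bar x)) (\<gamma> (bar y))) as"
      unfolding \<gamma>_def module_hom.diff[OF \<Delta>_hom] X(2) Y(2) tens_bar[OF X(1)] tens_bar[OF Y(1)]
      by (simp add: splitsum_def sum_subtractf[symmetric] t_simps algebra_simps)
    also have "\<dots> = splitsum (\<lambda>x y. (if y = [] then t (\<gamma> (bar x)) u else 0) +
        (if x = [] then t u (\<gamma> (bar y)) else 0)) as"
    proof (rule splitsum_cong)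
      fix x y assume xy: "x @ y = as"
      have "y \<noteq> [] \<Longrightarrow> \<gamma> (bar x) = 0" using xy less[of x] by auto
      moreover have "x \<noteq> [] \<Longrightarrow> \<gamma> (bar y) = 0" using xy less[of y] by auto
      ultimately show "t (\<gamma> (bar x)) (bar y) + t (tw C m (bar x)) (\<gamma> (bar y)) =
        (if y = [] then t (\<gamma> (bar x)) u else 0) + (if x = [] then t u (\<gamma> (bar y)) else 0)"
        by (cases "x = []"; cases "y = []") (simp_all add: t_simps C.tw_unit)
    qed
    finally have "\<Delta> (\<gamma> (bar as)) = t (\<gamma> (bar as)) u + t u (\<gamma> (bar as))"
      by (simp add: splitsum_add splitsum_select)
    then show ?case by (rule primitive_eq_0) (simp add: \<gamma>_def module_hom.diff[OF p_hom] p)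
  qed
  show "X x = Y x" for x
    by (rule bar_eq[OF X(1) Y(1)]) (use z in \<open>simp add: \<gamma>_def\<close>)
qed

lemma coder_unique:
  assumes X: "module_hom (smul C) (smul C) X" "\<And>x. \<Delta> (X x) = tens (n + 1) X (\<Delta> x)"
    and g: "lin g" and p: "\<And>x. p (X x) = g x"
  shows "coder n g = X"
  by (rule coderivation_unique[OF coder_hom[OF g] coder_coderivation[OF g] X])
     (simp add: p_coder[OF g] p)

text \<open>
  On homogeneous words the sign in the definition of a coderivation is the one produced by \<open>tw C m\<close>.
\<close>

lemma coderivation_iff:
  assumes \<beta>: "\<beta> \<in> Hom m C C"
  shows "coderivation A C bar sc2 t m \<beta> \<longleftrightarrow> (\<forall>x. \<Delta> (\<beta> x) = tens m \<beta> (\<Delta> x))"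
proof -
  note h = HomD(1)[OF \<beta>]
  have eq: "tens m \<beta> (\<Delta> (bar as)) = (\<Sum>i\<le>length as.
      t (\<beta> (bar (take i as))) (bar (drop i as))
      + ksign (m * sum_list (take i is)) (t (bar (take i as)) (\<beta> (bar (drop i as)))))"
    if "homog (susp A) is as" for "is" as
    unfolding tens_bar[OF h] splitsum_def
    by (rule sum.cong[OF refl])
       (simp add: tw_gr[OF C_graded homog_take_drop(1)[OF that]] ksign_def t_simps)
  show ?thesis
  proof
    assume c: "coderivation A C bar sc2 t m \<beta>"
    show "\<forall>x. \<Delta> (\<beta> x) = tens m \<beta> (\<Delta> x)"
    proof
      show "\<Delta> (\<beta> x) = tens m \<beta> (\<Delta> x)" for x
        by (rule C.hom_eq_homog[OF module_hom_comp[OF \<Delta>_hom h] module_hom_comp[OF tens_hom[OF h] \<Delta>_hom]])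
           (use c in \<open>simp add: coderivation_def deconcat_eq eq\<close>)
    qed
  next
    assume "\<forall>x. \<Delta> (\<beta> x) = tens m \<beta> (\<Delta> x)"
    then show "coderivation A C bar sc2 t m \<beta>"
      using \<beta> by (simp add: coderivation_def deconcat_eq eq)
  qed
qed

lemma hoch_beta_eq:
  assumes g: "g \<in> Hom n C A" shows "hoch_beta A C bar sc2 t n g = coder n g"
  unfolding hoch_beta_def bar_proj_eq
proof (rule the_equality)
  note h = HomD(1)[OF g]
  show "coderivation A C bar sc2 t (n + 1) (coder n g) \<and> (\<forall>x. p (coder n g x) = g x)"
    by (simp add: coderivation_iff[OF coder_Hom[OF g]] coder_coderivation[OF h] p_coder[OF h])
  fix \<beta> assume b: "coderivation A C bar sc2 t (n + 1) \<beta> \<and> (\<forall>x. p (\<beta> x) = g x)"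
  then have H: "\<beta> \<in> Hom (n + 1) C C" by (simp add: coderivation_def)
  show "\<beta> = coder n g"
    by (rule coder_unique[OF HomD(1)[OF H] _ h, symmetric]) (use b coderivation_iff[OF H] in auto)
qed

text \<open>
  The mixed terms \<open>X \<otimes> Y\<close> cancel because \<open>Y\<close> commutes with \<open>tw C m\<close> up to the sign of the commutator.
\<close>

lemma comm_coderivation:
  assumes X: "X \<in> Hom m C C" "\<And>x. \<Delta> (X x) = tens m X (\<Delta> x)"
    and Y: "Y \<in> Hom n C C" "\<And>x. \<Delta> (Y x) = tens n Y (\<Delta> x)"
  shows "\<Delta> (comm_br m n X Y x) = tens (m + n) (comm_br m n X Y) (\<Delta> x)"
proof -
  note hX = HomD(1)[OF X(1)] and hY = HomD(1)[OF Y(1)]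
    and XY = comm_br_Hom[OF C_graded X(1) Y(1)]
  have "comm_br m n (tens m X) (tens n Y) e = tens (m + n) (comm_br m n X Y) e" for e
  proof (rule E_eq[where f = "comm_br m n (tens m X) (tens n Y)"
        and g = "tens (m + n) (comm_br m n X Y)"])
    show "module_hom sc2 sc2 (comm_br m n (tens m X) (tens n Y))" unfolding comm_br_def
      by (intro module_hom_plus(2) module_hom_ksign module_hom_comp[OF tens_hom[OF hX] tens_hom[OF hY]]
          module_hom_comp[OF tens_hom[OF hY] tens_hom[OF hX]])
    show "module_hom sc2 sc2 (tens (m + n) (comm_br m n X Y))" by (rule tens_hom[OF HomD(1)[OF XY]])
    show "comm_br m n (tens m X) (tens n Y) (t x y) = tens (m + n) (comm_br m n X Y) (t x y)" for x y
      unfolding tens_t[OF HomD(1)[OF XY]]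
      by (cases "even m"; cases "even n")
         (simp_all add: comm_br_def ksign_def tens_t[OF hX] tens_t[OF hY] module_hom.add[OF tens_hom[OF hX]]
            module_hom.add[OF tens_hom[OF hY]] Hom_tw[OF C_graded C_graded X(1)]
            Hom_tw[OF C_graded C_graded Y(1)] tw_tw[OF C_graded] add.commute[of n m] t_simps)
  qed
  then show ?thesis
    by (simp add: comm_br_def module_hom.diff[OF \<Delta>_hom] ksign_hom[OF \<Delta>_hom] X(2) Y(2))
qed

lemma square_coderivation:
  assumes X: "X \<in> Hom m C C" "\<And>x. \<Delta> (X x) = tens m X (\<Delta> x)" and m: "odd m"
  shows "\<Delta> (X (X x)) = tens (m + m) (\<lambda>x. X (X x)) (\<Delta> x)"
proof -
  note h = HomD(1)[OF X(1)] and hh = module_hom_comp[OF HomD(1)[OF X(1)] HomD(1)[OF X(1)]]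
  have "tens m X (tens m X e) = tens (m + m) (\<lambda>x. X (X x)) e" for e
    by (rule E_eq[OF module_hom_comp[OF tens_hom[OF h] tens_hom[OF h]] tens_hom[OF hh]])
       (simp add: tens_t[OF h] tens_t[OF hh] module_hom.add[OF tens_hom[OF h]] m ksign_def
          Hom_tw[OF C_graded C_graded X(1)] tw_tw[OF C_graded] t_simps)
  then show ?thesis by (simp add: X(2))
qed


section \<open>The Hochschild complex as a Lie algebra of coderivations\<close>

abbreviation "d \<equiv> diff A"

lemmas dD = DerD[OF is_dgaD(1)[OF dga]]
lemmas dd [simp] = is_dgaD(2)[OF dga]

lemma linD:
  assumes f: "lin f"
  shows "f (x + y) = f x + f y" "f (x - y) = f x - f y" "f (- x) = - f x" "f 0 = 0"
    "f (smul C c x) = smul A c (f x)" "f (ksign n x) = ksign n (f x)"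
    "f (sum g S) = (\<Sum>i\<in>S. f (g i))"
  using module_hom.add[OF f] module_hom.diff[OF f] module_hom.neg[OF f] module_hom.zero[OF f]
    module_hom.scale[OF f] ksign_hom[OF f] module_hom.sum[OF f] by auto

lemma tw_1: "tw A (- 1) a = tw A 1 a" "tw A 1 (tw A 1 a) = a"
  "tws (- 1) a = - tw A 1 a" "tws (- 2) a = a"
  by (simp_all add: tw_parity[OF graded, of "- 1" 1] tw_tw[OF graded] tw_even[OF graded]
      tw_susp[OF graded] ksign_def)

lemma hom_eq_words:
  assumes "lin f" "lin g" and "\<And>is as. homog A is as \<Longrightarrow> f (bar as) = g (bar as)"
  shows "f = g"
proof
  show "f x = g x" for x
  proof (rule C.hom_eq_homog[OF assms(1,2)])
    fix "is" as assume "homog (susp A) is as"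
    then have "homog A (map (\<lambda>i. i - 1) is) as" by (simp add: homog_def list_all2_map1)
    then show "f (bar as) = g (bar as)" by (rule assms(3))
  qed
qed

lemma take_gr:
  assumes "homog A is as" "k \<le> length as"
  shows "bar (take k as) \<in> gr C (\<Sum>j<k. is ! j + 1)"
proof -
  have len: "length is = length as" using assms(1) by (simp add: homog_def list_all2_lengthD)
  have "homog (susp A) (map (\<lambda>i. i + 1) is) as"
    using assms(1) by (simp add: homog_def list_all2_map1)
  from homog_take_drop(1)[OF this, of k]
  have "bar (take k as) \<in> gr C (sum_list (take k (map (\<lambda>i. i + 1) is)))" .
  moreover have "sum_list (take k (map (\<lambda>i. i + 1) is)) = (\<Sum>j<k. is ! j + 1)"
    unfolding sum_list_sum_nth using assms(2) len
    by (intro sum.cong) (auto simp: min_def)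
  ultimately show ?thesis by simp
qed

lemma Hom_subspace: "module.subspace (\<lambda>c f x. smul A c (f x)) (Hom n C A)"
proof -
  interpret F: module "\<lambda>c (f :: 'c \<Rightarrow> 'a) x. smul A c (f x)" by (rule module_pointwise[OF module])
  show ?thesis
  proof (rule F.subspaceI)
    show "0 \<in> Hom n C A" by (rule HomI) (auto intro!: module_homI simp: module C_module gr_zero
          module.scale_zero_right[OF module])
    show "f + g \<in> Hom n C A" if "f \<in> Hom n C A" "g \<in> Hom n C A" for f g
      using module_hom_plus(1)[OF HomD(1)[OF that(1)] HomD(1)[OF that(2)]] HomD(2)[OF that(1)] HomD(2)[OF that(2)]
      by (intro HomI) (simp_all add: plus_fun_def gr_add)
    show "(\<lambda>x. smul A c (f x)) \<in> Hom n C A" if "f \<in> Hom n C A" for f c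
      using module_hom_multiple(2)[OF HomD(1)[OF that]] HomD(2)[OF that]
      by (intro HomI) (simp_all add: gr_scale)
  qed
qed

lemma ins_linear:
  assumes f: "lin f" and g: "lin g"
  shows "ins (\<lambda>x. f x + g x) x = ins f x + ins g x"
    and "ins (\<lambda>x. smul A c (f x)) x = smul C c (ins f x)"
proof -
  note fg = module_hom_plus(1)[OF f g] and cf = module_hom_multiple(2)[OF f]
  show "ins (\<lambda>x. f x + g x) x = ins f x + ins g x"
    by (rule bar_eq[OF ins_hom[OF fg] module_hom_plus(1)[OF ins_hom[OF f] ins_hom[OF g]]])
       (simp add: ins_bar[OF fg] ins_bar[OF f] ins_bar[OF g] splitsum_add[symmetric] cons_linear)
  show "ins (\<lambda>x. smul A c (f x)) x = smul C c (ins f x)"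
    by (rule bar_eq[OF ins_hom[OF cf] module_hom_multiple(2)[OF ins_hom[OF f]]])
       (simp add: ins_bar[OF cf] ins_bar[OF f] cons_linear
          splitsum_hom[OF module_hom_multiple(2)[OF module.module_hom_ident[OF C_module]]])
qed

lemma coder_linear:
  assumes f: "lin f" and g: "lin g"
  shows "coder n (\<lambda>x. f x + g x) x = coder n f x + coder n g x"
    and "coder n (\<lambda>x. smul A c (f x)) x = smul C c (coder n f x)"
proof -
  note fg = module_hom_plus(1)[OF f g] and cf = module_hom_multiple(2)[OF f]
  show "coder n (\<lambda>x. f x + g x) x = coder n f x + coder n g x"
    by (rule C.hom_eq[OF coder_hom[OF fg] module_hom_plus(1)[OF coder_hom[OF f] coder_hom[OF g]]])
       (simp_all add: coder_u[OF fg] coder_u[OF f] coder_u[OF g] coder_cons[OF fg] coder_cons[OF f]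
          coder_cons[OF g] cons_linear ins_linear[OF f g])
  show "coder n (\<lambda>x. smul A c (f x)) x = smul C c (coder n f x)"
    by (rule C.hom_eq[OF coder_hom[OF cf] module_hom_multiple(2)[OF coder_hom[OF f]]])
       (simp_all add: coder_u[OF cf] coder_u[OF f] coder_cons[OF cf] coder_cons[OF f]
          cons_linear ins_linear(2)[OF f f] module.scale_right_distrib[OF C_module])
qed

text \<open>
  The bar differential is the coderivation \<open>\<delta>\<close> with corestriction \<open>m\<close>, where \<open>m\<close> is given by the
  differential of \<open>sA\<close> on words of length 1 and, up to sign, by the product on words of length 2. The
  Hochschild differential is the bracket with \<open>m\<close>.
\<close>

definition m1 :: "'c \<Rightarrow> 'a" where "m1 x = - d (p x)"

definition m2 :: "'c \<Rightarrow> 'a" where "m2 = C.tfold (smul A) 0 (\<lambda>a x y. - (tw A 1 a * p x))"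

definition m :: "'c \<Rightarrow> 'a" where "m x = m1 x + m2 x"

definition \<delta> :: "'c \<Rightarrow> 'c" where "\<delta> = coder (- 2) m"

text \<open>
  \<open>lmul a\<close> multiplies the first letter by \<open>a\<close> on the left and is zero on the empty word; \<open>rmul f\<close> applies \<open>f\<close> to all
  letters but the last one and multiplies by the last letter, up to sign. They occur in the product terms of the bar
  differential and of the Hochschild differential, respectively.
\<close>

definition lmul :: "'a \<Rightarrow> 'c \<Rightarrow> 'c" where
  "lmul a = C.tfold (smul C) 0 (\<lambda>b x y. cons (a * b) x)"

definition rmul :: "('c \<Rightarrow> 'a) \<Rightarrow> 'c \<Rightarrow> 'a" where "rmul f x = - m2 (ins f x)"

lemma m1_hom: "lin m1"
  unfolding m1_def by (rule module_hom_multiple(1)[OF module_hom_comp[OF dD(2) p_hom]])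

lemma m2_hom: "lin m2" and m2_u [simp]: "m2 u = 0" and m2_cons: "m2 (cons a x) = - (tw A 1 a * p x)"
proof -
  have "C.rec_step (smul A) (\<lambda>a x y. - (tw A 1 a * p x))"
    by (rule rec_stepI[OF module])
       (simp_all add: tw_linear distrib_right distrib_left linD[OF p_hom] smul_mult
          module.scale_minus_right[OF module])
  from C.tfold[OF this] show "lin m2" "m2 u = 0" "m2 (cons a x) = - (tw A 1 a * p x)"
    unfolding m2_def by auto
qed

lemma m_hom: "lin m"
  unfolding m_def by (rule module_hom_plus(1)[OF m1_hom m2_hom])

lemma m_u [simp]: "m u = 0"
  by (simp add: m_def m1_def dD)

lemma m_cons: "m (cons a x) = - smul A (counit x) (d a) - tw A 1 a * p x"
  by (simp add: m_def m1_def m2_cons dD)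

lemma m1_Hom: "m1 \<in> Hom (- 2) C A"
proof (rule HomI[OF m1_hom])
  fix l x assume "x \<in> gr C l"
  from dD(3)[OF HomD(2)[OF p_Hom this]] show "m1 x \<in> gr A (l + - 2)" by (simp add: m1_def gr_neg)
qed

lemma m2_Hom: "m2 \<in> Hom (- 2) C A"
proof (rule C.HomI_rec[OF m2_hom subspace_gr])
  fix i q a x assume *: "a \<in> gr (susp A) i" "x \<in> gr C q"
  have "tw A 1 a \<in> gr A (i - 1)" using * by (simp add: tw_in_gr[OF graded])
  from mult_gr[OF this HomD(2)[OF p_Hom *(2)]] show "m2 (cons a x) \<in> gr A (i + q + - 2)"
    by (simp add: m2_cons gr_neg algebra_simps)
qed (simp add: gr_zero)

lemma m_Hom: "m \<in> Hom (- 2) C A"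
  unfolding m_def using HomD[OF m1_Hom] HomD[OF m2_Hom]
  by (intro HomI module_hom_plus(1)) (simp_all add: gr_add)

lemma \<delta>_Hom: "\<delta> \<in> Hom (- 1) C C"
  using coder_Hom[OF m_Hom] by (simp add: \<delta>_def)

lemma \<delta>_coderivation: "\<Delta> (\<delta> x) = tens (- 1) \<delta> (\<Delta> x)"
  using coder_coderivation[OF m_hom, of "- 2"] by (simp add: \<delta>_def)

lemma lmul_hom: "module_hom (smul C) (smul C) (lmul a)" and lmul_u [simp]: "lmul a u = 0"
  and lmul_cons [simp]: "lmul a (cons b x) = cons (a * b) x"
proof -
  have "C.rec_step (smul C) (\<lambda>b x y. cons (a * b) x)"
    by (rule rec_stepI[OF C_module]) (simp_all add: distrib_left cons_linear smul_mult)
  from C.tfold[OF this] show "module_hom (smul C) (smul C) (lmul a)" "lmul a u = 0"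
    "lmul a (cons b x) = cons (a * b) x" unfolding lmul_def by auto
qed

lemma rmul_hom: "lin f \<Longrightarrow> lin (rmul f)"
  unfolding rmul_def by (rule module_hom_multiple(1)[OF module_hom_comp[OF m2_hom ins_hom]])

lemma rmul_bar:
  assumes f: "lin f"
  shows "rmul f (bar as) = splitsum (\<lambda>x y. tw A 1 (f (bar x)) * p (bar y)) as"
  unfolding rmul_def ins_bar[OF f] splitsum_hom[OF module_hom_multiple(1)[OF m2_hom]]
  by (simp add: m2_cons)

lemma lin_cons: "lin f \<Longrightarrow> lin (\<lambda>x. f (cons a x))"
  by (rule module_hom_comp[OF _ bilin_hom(1)[OF cons_bilin]])

lemma rmul_u [simp]: "lin f \<Longrightarrow> rmul f u = 0"
  by (simp add: rmul_bar)

lemma rmul_cons: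
  assumes f: "lin f"
  shows "rmul f (cons a x) = smul A (counit x) (tw A 1 (f u) * a) + rmul (\<lambda>y. f (cons a y)) x"
proof (rule bar_eq[OF lin_cons[OF rmul_hom[OF f]]])
  show "lin (\<lambda>x. smul A (counit x) (tw A 1 (f u) * a) + rmul (\<lambda>y. f (cons a y)) x)"
    by (rule module_hom_plus(1)[OF _ rmul_hom[OF lin_cons[OF f]]])
       (auto intro!: module_homI simp: C_module module module.scale_left_distrib[OF module]
          module_hom.add[OF C.counit_hom] module_hom.scale[OF C.counit_hom] module.scale_scale[OF module])
  show "rmul f (cons a (bar as)) =
      smul A (counit (bar as)) (tw A 1 (f u) * a) + rmul (\<lambda>y. f (cons a y)) (bar as)" for as
    by (simp add: cons_word rmul_bar[OF f] rmul_bar[OF lin_cons[OF f]] C.counit_word p_bar)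
qed

lemma rmul_butlast:
  assumes "lin f" "as \<noteq> []"
  shows "rmul f (bar as) = tw A 1 (f (bar (butlast as))) * last as"
  using assms
proof (induction as arbitrary: f)
  case (Cons a as)
  then show ?case
    using Cons.IH[OF lin_cons[OF Cons.prems(1), of a]]
    by (cases "as = []") (simp_all add: cons_word[symmetric] rmul_cons rmul_u[OF lin_cons] C.counit_word)
qed simp

lemma lin_zero: "lin (\<lambda>x. 0)"
  by (rule module_homI) (simp_all add: C_module module module.scale_zero_right[OF module])

lemma rmul_zero [simp]: "rmul (\<lambda>x. 0) x = 0"
  by (rule bar_eq[OF rmul_hom[OF lin_zero] lin_zero]) (simp add: rmul_bar[OF lin_zero] tw_linear)

lemma rmul_linear:
  assumes f: "lin f" and g: "lin g"
  shows "rmul (\<lambda>x. f x + g x) x = rmul f x + rmul g x"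
    and "rmul (\<lambda>x. f x - g x) x = rmul f x - rmul g x"
    and "rmul (\<lambda>x. ksign n (f x)) x = ksign n (rmul f x)"
    and "rmul (\<lambda>x. a * f x) x = tw A 1 a * rmul f x"
proof -
  have 1: "rmul (\<lambda>x. f x + g x) x = rmul f x + rmul g x" if "lin f" "lin g" for f g
    by (simp add: rmul_def ins_linear(1)[OF that] linD[OF m2_hom])
  then show "rmul (\<lambda>x. f x + g x) x = rmul f x + rmul g x" using f g .
  have 2: "rmul (\<lambda>x. - g x) x = - rmul g x" if "lin g" for g
    using 1[OF that module_hom_multiple(1)[OF that]] by (simp add: eq_neg_iff_add_eq_0 add.commute)
  show "rmul (\<lambda>x. f x - g x) x = rmul f x - rmul g x"
    using 1[OF f module_hom_multiple(1)[OF g]] 2[OF g] by simp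
  show "rmul (\<lambda>x. ksign n (f x)) x = ksign n (rmul f x)"
    using 2[OF f] by (cases "even n") (simp_all add: ksign_def)
  have af: "lin (\<lambda>x. a * f x)" by (rule module_hom_comp[OF mult_hom(1) f])
  show "rmul (\<lambda>x. a * f x) x = tw A 1 a * rmul f x"
    by (rule bar_eq[OF rmul_hom[OF af] module_hom_comp[OF mult_hom(1) rmul_hom[OF f]]])
       (simp add: rmul_bar[OF af] rmul_bar[OF f] tw_mult mult.assoc splitsum_hom[OF mult_hom(1)])
qed

lemma ins_m1: "ins m1 (cons a x) = - cons (d a) x"
proof (rule bar_eq[OF module_hom_comp[OF ins_hom[OF m1_hom] bilin_hom(1)[OF cons_bilin]]
      module_hom_multiple(1)[OF bilin_hom(1)[OF cons_bilin]]])
  fix as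
  have "ins m1 (cons a (bar as)) = splitsum (\<lambda>x y. cons (m1 (bar (a # x))) (bar y)) as"
    by (simp add: cons_word[of a] ins_bar[OF m1_hom] m1_def dD cons_linear)
  also have "\<dots> = splitsum (\<lambda>x y. if x = [] then - cons (d a) (bar y) else 0) as"
    by (rule splitsum_cong) (simp add: m1_def p_bar dD cons_linear)
  finally show "ins m1 (cons a (bar as)) = - cons (d a) (bar as)" by (simp only: splitsum_select)
qed

lemma ins_m2: "ins m2 (cons a x) = - lmul (tw A 1 a) x"
proof (rule bar_eq[OF module_hom_comp[OF ins_hom[OF m2_hom] bilin_hom(1)[OF cons_bilin]]
      module_hom_multiple(1)[OF lmul_hom]])
  fix as
  have 1: "ins m2 (cons a (bar as)) = splitsum (\<lambda>x y. cons (m2 (cons a (bar x))) (bar y)) as"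
    by (simp add: cons_word[of a] ins_bar[OF m2_hom] cons_linear)
  show "ins m2 (cons a (bar as)) = - lmul (tw A 1 a) (bar as)"
  proof (cases as)
    case Nil
    show ?thesis using 1 unfolding Nil by (simp add: m2_cons cons_linear)
  next
    case (Cons b bs)
    have e: "splitsum (\<lambda>x y. cons (m2 (cons a (bar (b # x)))) (bar y)) bs =
        splitsum (\<lambda>x y. if x = [] then - cons (tw A 1 a * b) (bar y) else 0) bs"
      by (rule splitsum_cong) (simp add: m2_cons p_bar cons_linear)
    show ?thesis
      unfolding Cons 1[unfolded Cons] splitsum_simps e splitsum_select
      by (simp add: m2_cons cons_linear cons_word[symmetric])
  qed
qed

lemma \<delta>_u [simp]: "\<delta> u = 0"
  by (simp add: \<delta>_def coder_u[OF m_hom] cons_linear)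

lemma \<delta>_cons: "\<delta> (cons a x) = - cons (tw A 1 a) (\<delta> x) - cons (d a) x - lmul (tw A 1 a) x"
proof -
  have "ins m (cons a x) = ins m1 (cons a x) + ins m2 (cons a x)"
    using ins_linear(1)[OF m1_hom m2_hom] by (simp add: m_def[abs_def])
  then show ?thesis
    by (simp add: \<delta>_def coder_cons[OF m_hom] ins_m1 ins_m2 tw_1 cons_linear)
qed

text \<open>
  In \<open>m (coder q f w)\<close> only the summands of \<open>coder q f w\<close> of length 1 and 2 survive: \<open>f\<close> is applied to
  the whole word, to all letters but the first, or to all letters but the last.
\<close>

lemma m_coder:
  assumes f: "lin f"
  shows "m (coder q f u) = - d (f u)"
    and "m (coder q f (cons a x)) = - d (f (cons a x)) + tws q a * f x - rmul f (cons a x)"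
    and "m2 (coder q f (cons a x)) = tws q a * f x - rmul f (cons a x)"
proof -
  have e: "- (tw A 1 (tws (q + 1) a) * b) = tws q a * b" for a b
    using tw_parity[OF graded, of "1 + (q + 1)" q a]
    by (simp add: tw_susp[OF graded] tw_linear tw_tw[OF graded] ksign_def add.commute)
  show 2: "m2 (coder q f (cons a x)) = tws q a * f x - rmul f (cons a x)"
    by (simp add: coder_cons[OF f] linD[OF m2_hom] m2_cons rmul_def p_coder[OF f] e)
  show "m (coder q f u) = - d (f u)"
    by (simp add: m_def m1_def p_coder[OF f]) (simp add: coder_u[OF f] m2_cons)
  show "m (coder q f (cons a x)) = - d (f (cons a x)) + tws q a * f x - rmul f (cons a x)"
    by (simp add: m_def m1_def p_coder[OF f] 2)
qed

text \<open>
  Words of length 1, 2 and 3 give \<open>d\<^sup>2 = 0\<close>, the Leibniz rule and associativity.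
\<close>

lemma m_\<delta> [simp]: "m (\<delta> x) = 0"
proof (rule bar_eq[OF module_hom_comp[OF m_hom HomD(1)[OF \<delta>_Hom]]])
  show "lin (\<lambda>x. 0)" by (rule lin_zero)
  fix as
  have m_bar: "m (bar (a # as)) =
      - (if as = [] then d a else 0) - tw A 1 a * (if length as = 1 then hd as else 0)" for a as
    by (simp add: cons_word[symmetric] m_cons C.counit_word p_bar)
  have step: "m (\<delta> (bar (a # as))) =
      - d (m (bar (a # as))) + a * m (bar as) - tw A 1 (m (bar (butlast (a # as)))) * last (a # as)" for a as
    using m_coder(2)[OF m_hom, of "- 2" a "bar as"] rmul_butlast[OF m_hom, of "a # as"]
    by (simp add: \<delta>_def tw_1 cons_word)
  have dtw: "d (tw A 1 a) = - tw A 1 (d a)" for a by (simp add: dD(12) ksign_def)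
  show "m (\<delta> (bar as)) = 0"
  proof (cases as)
    case Nil
    then show ?thesis using m_coder(1)[OF m_hom, of "- 2"] by (simp add: \<delta>_def dD)
  next
    case (Cons a bs)
    note as = this
    show ?thesis
    proof (cases bs)
      case Nil
      then show ?thesis unfolding as step by (simp add: m_bar dD tw_linear)
    next
      case (Cons b cs)
      note bs = this
      show ?thesis
      proof (cases cs)
        case Nil
        then show ?thesis unfolding as bs step
          by (simp add: m_bar dD(4,5,7) dtw tw_linear tw_1 algebra_simps)
      next
        case (Cons c es)
        then show ?thesis unfolding as bs step
          by (simp add: m_bar dD(8) tw_linear tw_1 tw_mult mult.assoc)
      qed
    qed
  qed
qed

text \<open>
  The square of an odd coderivation is a coderivation, and its corestriction is \<open>m \<circ> \<delta>\<close>.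
\<close>

lemma \<delta>\<delta>: "\<delta> (\<delta> x) = 0"
proof -
  have z: "module_hom (smul C) (smul C) (\<lambda>x. 0)"
    by (rule module_homI) (simp_all add: C_module module.scale_zero_right[OF C_module])
  note h = HomD(1)[OF \<delta>_Hom]
  have "(\<lambda>x. \<delta> (\<delta> x)) = (\<lambda>x. 0)"
  proof (rule coderivation_unique[OF module_hom_comp[OF h h] _ z])
    show "\<Delta> (\<delta> (\<delta> x)) = tens (- 1 + - 1) (\<lambda>x. \<delta> (\<delta> x)) (\<Delta> x)" for x
      by (rule square_coderivation[OF \<delta>_Hom \<delta>_coderivation]) simp
    show "\<Delta> 0 = tens (- 1 + - 1) (\<lambda>x. 0) (\<Delta> x)" for x
    proof -
      have "tens (- 1 + - 1) (\<lambda>x. 0) e = 0" for e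
        by (rule E_eq[OF tens_hom[OF z]])
           (auto intro!: module_homI simp: E_module module.scale_zero_right[OF E_module] tens_t[OF z] t_simps)
      then show ?thesis by (simp add: module_hom.zero[OF \<Delta>_hom])
    qed
    show "p (\<delta> (\<delta> x)) = p 0" for x
      using p_coder[OF m_hom, of "- 2" "\<delta> x"] by (simp add: \<delta>_def[symmetric] linD[OF p_hom])
  qed
  then show ?thesis by (rule fun_cong)
qed

text \<open>
  The bracket \<open>[m, f] = m \<circ> coder f - (-1)\<^bsup>|m||f|\<^esup> f \<circ> \<delta>\<close> in suspended degrees, where \<open>m\<close> has degree \<open>-1\<close> and
  \<open>f\<close> has degree \<open>q + 1\<close>.
\<close>

definition hdiff :: "int \<Rightarrow> ('c \<Rightarrow> 'a) \<Rightarrow> 'c \<Rightarrow> 'a" where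
  "hdiff q f x = m (coder q f x) + ksign q (f (\<delta> x))"


lemma hdiff_Hom:
  assumes f: "f \<in> Hom q C A" shows "hdiff q f \<in> Hom (q - 1) C A"
  unfolding hdiff_def
proof (intro HomI module_hom_plus(1) module_hom_ksign)
  note h = HomD(1)[OF f]
  show "lin (\<lambda>x. m (coder q f x))" by (rule module_hom_comp[OF m_hom coder_hom[OF h]])
  show "lin (\<lambda>x. f (\<delta> x))" by (rule module_hom_comp[OF h HomD(1)[OF \<delta>_Hom]])
  fix l x assume x: "x \<in> gr C l"
  show "m (coder q f x) + ksign q (f (\<delta> x)) \<in> gr A (l + (q - 1))"
    using HomD(2)[OF m_Hom HomD(2)[OF coder_Hom[OF f] x]] HomD(2)[OF f HomD(2)[OF \<delta>_Hom x]]
    by (intro gr_add gr_ksign) (simp_all add: algebra_simps)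
qed

lemma hdiff_u:
  assumes f: "lin f" shows "hdiff q f u = - d (f u)"
  by (simp add: hdiff_def m_coder(1)[OF f] linD[OF f])

lemma hdiff_cons:
  assumes f: "lin f"
  shows "hdiff q f (cons a x) = - d (f (cons a x)) + tws q a * f x - rmul f (cons a x)
     - ksign q (f (cons (tw A 1 a) (\<delta> x)) + f (cons (d a) x) + f (lmul (tw A 1 a) x))"
  by (simp add: hdiff_def m_coder(2)[OF f] \<delta>_cons linD[OF f] ksign_diff ksign_add)

lemma m1_u [simp]: "m1 u = 0"
  by (simp add: m1_def dD)

lemma ksign_sum: "ksign n (sum g S) = (\<Sum>i\<in>S. ksign n (g i :: 'x::ab_group_add))"
  by (simp add: ksign_def sum_negf)

lemma cons_ksign: "cons (ksign k a) x = ksign k (cons a x)" "cons a (ksign k x) = ksign k (cons a x)"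
  by (simp_all add: ksign_def cons_linear)

lemma epsbar_Cons: "(\<Sum>l<Suc n. (i # js) ! l + 1) = (i + 1) + (\<Sum>l<n. js ! l + (1 :: int))"
  unfolding sum.lessThan_Suc_shift by simp

lemma tws_homog:
  assumes "a \<in> gr A i" shows "tws (- 1) a = ksign (i + 1) a"
  using tw_gr[OF C.graded_V, of a "i + 1" "- 1"] assms by (simp add: ksign_def)

text \<open>
  The two summands of the bar differential, written as the sums over positions that occur in the
  Hochschild differentials \<open>D\<^sub>0\<close> and \<open>D\<^sub>1\<close>.
\<close>

lemma coder_m1_bar:
  assumes "homog A is as"
  shows "coder (- 2) m1 (bar as) =
     (\<Sum>i<length as. ksign (\<Sum>j<i. is ! j + 1) (bar (as[i := susp_diff A (as ! i)])))"
  using assms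
proof (induction as arbitrary: "is")
  case Nil
  show ?case by (simp add: coder_u[OF m1_hom] cons_linear)
next
  case (Cons a as)
  then obtain i js where *: "is = i # js" "a \<in> gr A i" "homog A js as"
    by (auto simp: homog_def list_all2_Cons2)
  define T where "T j = ksign (\<Sum>l<j. is ! l + 1) (bar ((a # as)[j := susp_diff A ((a # as) ! j)]))" for j
  define U where "U j = ksign (\<Sum>l<j. js ! l + 1) (bar (as[j := susp_diff A (as ! j)]))" for j
  have T0: "T 0 = - cons (d a) (bar as)"
    by (simp add: T_def susp_diff_def cons_word[symmetric] cons_linear)
  have TS: "T (Suc j) = ksign (i + 1) (cons a (U j))" for j
    unfolding T_def U_def *(1) epsbar_Cons cons_ksign ksign_simps(4) by (simp add: cons_word)
  have "coder (- 2) m1 (bar (a # as)) = ksign (i + 1) (cons a (\<Sum>j<length as. U j)) - cons (d a) (bar as)"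
    using Cons.IH[OF *(3)] tws_homog[OF *(2)]
    by (simp add: cons_word[symmetric, of a as] coder_cons[OF m1_hom] ins_m1 U_def cons_ksign)
  also have "\<dots> = T 0 + (\<Sum>j<length as. T (Suc j))"
    unfolding T0 TS bilin_sum_right[OF cons_bilin] ksign_sum by simp
  also have "\<dots> = (\<Sum>j<length (a # as). T j)"
    unfolding list.size(4) add_0_right add_Suc_right by (rule sum.lessThan_Suc_shift[symmetric])
  finally show ?case unfolding T_def .
qed

lemma coder_m2_bar:
  assumes "homog A is as"
  shows "coder (- 2) m2 (bar as) = (\<Sum>j<length as - 1. ksign (\<Sum>l<Suc j. is ! l + 1)
     (bar (take j as @ [as ! j * as ! Suc j] @ drop (j + 2) as)))"
  using assms
proof (induction as arbitrary: "is")
  case Nil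
  show ?case by (simp add: coder_u[OF m2_hom] cons_linear)
next
  case (Cons a as)
  then obtain i js where *: "is = i # js" "a \<in> gr A i" "homog A js as"
    by (auto simp: homog_def list_all2_Cons2)
  show ?case
  proof (cases as)
    case Nil
    show ?thesis unfolding Nil
      by (simp add: cons_word[symmetric] coder_cons[OF m2_hom] ins_m2 coder_u[OF m2_hom] cons_linear)
  next
    case (Cons b bs)
    define T where "T j = ksign (\<Sum>l<Suc j. is ! l + 1)
      (bar (take j (a # as) @ [(a # as) ! j * (a # as) ! Suc j] @ drop (j + 2) (a # as)))" for j
    define U where "U j = ksign (\<Sum>l<Suc j. js ! l + 1)
      (bar (take j as @ [as ! j * as ! Suc j] @ drop (j + 2) as))" for j
    have T0: "T 0 = ksign (i + 1) (cons (a * b) (bar bs))"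
      by (simp add: T_def *(1) Cons cons_word)
    have TS: "T (Suc j) = ksign (i + 1) (cons a (U j))" for j
      unfolding T_def U_def *(1) epsbar_Cons cons_ksign ksign_simps(4) by (simp add: cons_word)
    have "- lmul (tw A 1 a) (bar as) = ksign (i + 1) (cons (a * b) (bar bs))"
    proof -
      have "- lmul (tw A 1 a) (bar as) = cons (tws (- 1) a * b) (bar bs)"
        by (simp add: Cons cons_word[symmetric] cons_linear tw_1)
      then show ?thesis by (simp add: tws_homog[OF *(2)] ksign_mult cons_ksign)
    qed
    moreover have "coder (- 2) m2 (bar as) = (\<Sum>j<length bs. U j)"
      using Cons.IH[OF *(3)] by (simp add: Cons U_def)
    ultimately have "coder (- 2) m2 (bar (a # as)) =
        ksign (i + 1) (cons a (\<Sum>j<length bs. U j)) + ksign (i + 1) (cons (a * b) (bar bs))"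
      using tws_homog[OF *(2)]
      by (simp add: cons_word[symmetric, of a as] coder_cons[OF m2_hom] ins_m2 cons_ksign)
    also have "\<dots> = T 0 + (\<Sum>j<length bs. T (Suc j))"
      unfolding T0 TS bilin_sum_right[OF cons_bilin] ksign_sum by simp
    also have "\<dots> = (\<Sum>j<length (a # as) - 1. T j)"
      unfolding Cons list.size(4) add_0_right add_Suc_right diff_Suc_1
      by (rule sum.lessThan_Suc_shift[symmetric])
    finally show ?thesis unfolding T_def .
  qed
qed

lemma \<delta>_sum: "\<delta> x = coder (- 2) m1 x + coder (- 2) m2 x"
  using coder_linear(1)[OF m1_hom m2_hom] by (simp add: \<delta>_def m_def[abs_def])

text \<open>
  \<open>D\<^sub>0\<close> and \<open>D\<^sub>1\<close> are, up to sign, the brackets with \<open>m1\<close> and \<open>m2\<close>. A linear map is determined by its values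
  on homogeneous words, where the formulas are compared.
\<close>

lemma hoch_D0_eq:
  assumes f: "f \<in> Hom q C A"
  shows "hoch_D0 A C bar q f = (\<lambda>x. d (f x) - ksign q (f (coder (- 2) m1 x)))"
  unfolding hoch_D0_def
proof (rule the_equality, intro conjI allI impI)
  note h = HomD(1)[OF f]
  have c: "coder (- 2) m1 \<in> Hom (- 1) C C" using coder_Hom[OF m1_Hom] by simp
  show H: "(\<lambda>x. d (f x) - ksign q (f (coder (- 2) m1 x))) \<in> Hom (q - 1) C A"
  proof (intro HomI module_hom_plus(2) module_hom_ksign)
    show "lin (\<lambda>x. d (f x))" by (rule module_hom_comp[OF dD(2) h])
    show "lin (\<lambda>x. f (coder (- 2) m1 x))" by (rule module_hom_comp[OF h HomD(1)[OF c]])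
    show "d (f x) - ksign q (f (coder (- 2) m1 x)) \<in> gr A (l + (q - 1))" if "x \<in> gr C l" for l x
      using dD(3)[OF HomD(2)[OF f that]] HomD(2)[OF f HomD(2)[OF c that]]
      by (intro gr_diff gr_ksign) (simp_all add: algebra_simps)
  qed
  show W: "d (f (bar as)) - ksign q (f (coder (- 2) m1 (bar as))) = d (f (bar as))
      - (\<Sum>i<length as. ksign (epsbar q is i) (f (bar (as[i := susp_diff A (as ! i)]))))"
    if "homog A is as" for "is" as
    by (simp add: coder_m1_bar[OF that] linD[OF h] ksign_sum epsbar_def)
  fix g assume g: "g \<in> Hom (q - 1) C A \<and> (\<forall>is as. homog A is as \<longrightarrow> g (bar as) = d (f (bar as))
      - (\<Sum>i<length as. ksign (epsbar q is i) (f (bar (as[i := susp_diff A (as ! i)])))))"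
  show "g = (\<lambda>x. d (f x) - ksign q (f (coder (- 2) m1 x)))"
    by (rule hom_eq_words[OF HomD(1)[OF conjunct1[OF g]] HomD(1)[OF H]]) (use g W in simp)
qed

lemma hoch_D1_eq:
  assumes f: "f \<in> Hom q C A"
  shows "hoch_D1 A C bar q f = (\<lambda>x. - m2 (coder q f x) - ksign q (f (coder (- 2) m2 x)))"
    (is "_ = ?D")
  unfolding hoch_D1_def
proof (rule the_equality, intro conjI allI impI)
  note h = HomD(1)[OF f]
  have c: "coder (- 2) m2 \<in> Hom (- 1) C C" using coder_Hom[OF m2_Hom] by simp
  show H: "?D \<in> Hom (q - 1) C A"
  proof (intro HomI module_hom_plus(2) module_hom_ksign module_hom_multiple(1))
    show "lin (\<lambda>x. m2 (coder q f x))" by (rule module_hom_comp[OF m2_hom coder_hom[OF h]])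
    show "lin (\<lambda>x. f (coder (- 2) m2 x))" by (rule module_hom_comp[OF h HomD(1)[OF c]])
    show "- m2 (coder q f x) - ksign q (f (coder (- 2) m2 x)) \<in> gr A (l + (q - 1))"
      if "x \<in> gr C l" for l x
      using HomD(2)[OF m2_Hom HomD(2)[OF coder_Hom[OF f] that]] HomD(2)[OF f HomD(2)[OF c that]]
      by (intro gr_diff gr_ksign gr_neg) (simp_all add: algebra_simps)
  qed
  show U: "- m2 (coder q f u) - ksign q (f (coder (- 2) m2 u)) = 0"
    by (simp add: coder_u[OF h] coder_u[OF m2_hom] m2_cons cons_linear linD[OF h])
  let ?R = "\<lambda>is as. - ksign ((hd is + 1) * q) (hd as * f (bar (tl as)))
      - (\<Sum>i\<in>{1..<length as}. ksign (epsbar q is i)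
           (f (bar (take (i - 1) as @ [as ! (i - 1) * as ! i] @ drop (i + 1) as))))
      + ksign (epsbar q is (length as - 1)) (f (bar (butlast as)) * last as)"
  have W: "- m2 (coder q f (bar as)) - ksign q (f (coder (- 2) m2 (bar as))) = ?R is as"
    if *: "homog A is as" and ne: "as \<noteq> []" for "is" as
  proof -
    obtain a bs where as: "as = a # bs" using ne by (cases as) auto
    then obtain i js where "is": "is = i # js" "a \<in> gr A i" using * by (auto simp: homog_def list_all2_Cons2)
    have "(\<Sum>i\<in>{1..<length as}. ksign (epsbar q is i)
           (f (bar (take (i - 1) as @ [as ! (i - 1) * as ! i] @ drop (i + 1) as)))) =
        (\<Sum>j<length as - 1. ksign (epsbar q is (Suc j))
           (f (bar (take j as @ [as ! j * as ! Suc j] @ drop (j + 2) as))))"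
      by (rule sum.reindex_bij_witness[of _ Suc "\<lambda>i. i - 1"]) auto
    then have 1: "ksign q (f (coder (- 2) m2 (bar as))) = (\<Sum>i\<in>{1..<length as}. ksign (epsbar q is i)
           (f (bar (take (i - 1) as @ [as ! (i - 1) * as ! i] @ drop (i + 1) as))))"
      by (simp only: coder_m2_bar[OF *] linD[OF h] ksign_sum epsbar_def ksign_simps)
    have "f (bar (butlast as)) \<in> gr A (epsbar q is (length as - 1))"
      using HomD(2)[OF f take_gr[OF *, of "length as - 1"]]
      by (simp add: butlast_conv_take epsbar_def add.commute)
    then have 2: "rmul f (bar as) = ksign (epsbar q is (length as - 1)) (f (bar (butlast as)) * last as)"
      unfolding rmul_butlast[OF h ne] by (simp add: tw_gr[OF graded] ksign_mult)
    have 3: "tws q a = ksign ((i + 1) * q) a"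
      using tw_gr[OF C.graded_V, of a "i + 1" q] "is"(2) by (simp add: mult.commute)
    have "m2 (coder q f (bar as)) = ksign ((i + 1) * q) (a * f (bar bs)) - rmul f (bar as)"
      using m_coder(3)[OF h, of q a "bar bs"] by (simp add: as cons_word 3 ksign_mult)
    then show ?thesis unfolding 1 2 by (simp add: as "is")
  qed
  then show "?D (bar as) = ?R is as" if "homog A is as \<and> as \<noteq> []" for "is" as using that by blast
  fix g assume g: "g \<in> Hom (q - 1) C A \<and> g u = 0 \<and>
      (\<forall>is as. homog A is as \<and> as \<noteq> [] \<longrightarrow> g (bar as) = ?R is as)"
  show "g = ?D"
  proof (rule hom_eq_words[OF HomD(1)[OF conjunct1[OF g]] HomD(1)[OF H]])
    fix "is" as assume *: "homog A is as"
    show "g (bar as) = ?D (bar as)"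
    proof (cases "as = []")
      case True
      then show ?thesis using g U by simp
    next
      case False
      have "g (bar as) = ?R is as" using g * False by blast
      then show ?thesis unfolding W[OF * False] .
    qed
  qed
qed

abbreviation "H \<equiv> hoch_dgl A C bar sc2 t"

lemma lcar_H: "lcar H n = Hom (n - 1) C A"
  by (simp add: hoch_dgl_def)

lemma ldiff_H:
  assumes "f \<in> Hom (n - 1) C A" shows "ldiff H n f = hdiff (n - 1) f"
  by (simp add: hoch_dgl_def hoch_D0_eq[OF assms] hoch_D1_eq[OF assms] fun_eq_iff hdiff_def m_def
      m1_def p_coder[OF HomD(1)[OF assms]] \<delta>_sum linD[OF HomD(1)[OF assms]] ksign_add)

lemma lbr_H:
  assumes "f \<in> Hom (k - 1) C A" "g \<in> Hom (n - 1) C A"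
  shows "lbr H k n f g = (\<lambda>x. f (coder (n - 1) g x) - ksign (k * n) (g (coder (k - 1) f x)))"
  by (simp add: hoch_dgl_def hoch_beta_eq[OF assms(1)] hoch_beta_eq[OF assms(2)])

lemma lbr_H_Hom:
  assumes f: "f \<in> Hom (k - 1) C A" and g: "g \<in> Hom (n - 1) C A"
  shows "lbr H k n f g \<in> Hom (k + n - 1) C A"
  unfolding lbr_H[OF f g]
proof (intro HomI module_hom_plus(2) module_hom_ksign)
  note hf = HomD(1)[OF f] and hg = HomD(1)[OF g]
  show "lin (\<lambda>x. f (coder (n - 1) g x))" by (rule module_hom_comp[OF hf coder_hom[OF hg]])
  show "lin (\<lambda>x. g (coder (k - 1) f x))" by (rule module_hom_comp[OF hg coder_hom[OF hf]])
  show "f (coder (n - 1) g x) - ksign (k * n) (g (coder (k - 1) f x)) \<in> gr A (l + (k + n - 1))"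
    if "x \<in> gr C l" for l x
    using HomD(2)[OF f HomD(2)[OF coder_Hom[OF g] that]] HomD(2)[OF g HomD(2)[OF coder_Hom[OF f] that]]
    by (intro gr_diff gr_ksign) (simp_all add: algebra_simps)
qed

lemma coder_Hom': "f \<in> Hom (n - 1) C A \<Longrightarrow> coder (n - 1) f \<in> Hom n C C"
  using coder_Hom[of f "n - 1"] by simp

lemma coder_coderivation': "lin f \<Longrightarrow> \<Delta> (coder (n - 1) f x) = tens n (coder (n - 1) f) (\<Delta> x)"
  using coder_coderivation[of f "n - 1"] by simp

lemma coder_lbr:
  assumes f: "f \<in> Hom (k - 1) C A" and g: "g \<in> Hom (n - 1) C A"
  shows "coder (k + n - 1) (lbr H k n f g) = comm_br k n (coder (k - 1) f) (coder (n - 1) g)"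
proof (rule coder_unique[OF _ _ HomD(1)[OF lbr_H_Hom[OF f g]]])
  note hf = HomD(1)[OF f] and hg = HomD(1)[OF g]
  show "module_hom (smul C) (smul C) (comm_br k n (coder (k - 1) f) (coder (n - 1) g))"
    by (rule HomD(1)[OF comm_br_Hom[OF C_graded coder_Hom'[OF f] coder_Hom'[OF g]]])
  show "\<Delta> (comm_br k n (coder (k - 1) f) (coder (n - 1) g) x) =
      tens (k + n - 1 + 1) (comm_br k n (coder (k - 1) f) (coder (n - 1) g)) (\<Delta> x)" for x
    using comm_coderivation[OF coder_Hom'[OF f] coder_coderivation'[OF hf]
        coder_Hom'[OF g] coder_coderivation'[OF hg]] by simp
  show "p (comm_br k n (coder (k - 1) f) (coder (n - 1) g) x) = lbr H k n f g x" for x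
    by (simp add: lbr_H[OF f g] comm_br_def linD[OF p_hom] p_coder[OF hf] p_coder[OF hg])
qed

lemma coder_ldiff:
  assumes f: "f \<in> Hom (n - 1) C A"
  shows "coder (n - 1 - 1) (hdiff (n - 1) f) = comm_br (- 1) n \<delta> (coder (n - 1) f)"
proof (rule coder_unique[OF _ _ HomD(1)[OF hdiff_Hom[OF f]]])
  note hf = HomD(1)[OF f]
  show "module_hom (smul C) (smul C) (comm_br (- 1) n \<delta> (coder (n - 1) f))"
    by (rule HomD(1)[OF comm_br_Hom[OF C_graded \<delta>_Hom coder_Hom'[OF f]]])
  show "\<Delta> (comm_br (- 1) n \<delta> (coder (n - 1) f) x) =
      tens (n - 1 - 1 + 1) (comm_br (- 1) n \<delta> (coder (n - 1) f)) (\<Delta> x)" for x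
    using comm_coderivation[OF \<delta>_Hom \<delta>_coderivation coder_Hom'[OF f] coder_coderivation'[OF hf]] by simp
  have "p (\<delta> x) = m x" for x using p_coder[OF m_hom] by (simp add: \<delta>_def)
  then show "p (comm_br (- 1) n \<delta> (coder (n - 1) f) x) = hdiff (n - 1) f x" for x
    by (simp add: comm_br_def linD[OF p_hom] p_coder[OF hf] hdiff_def ksign_def)
qed

theorem is_dgl_H: "is_dgl H"
proof (rule is_dgl_of_endomorphisms[OF C_graded \<delta>_Hom \<delta>\<delta>, where \<phi> = "\<lambda>n. coder (n - 1)"],
    unfold lcar_H)
  have sc: "lscale H = (\<lambda>c f x. smul A c (f x))" by (simp add: hoch_dgl_def)
  show "module (lscale H)" unfolding sc by (rule module_pointwise[OF module])
  show "module.subspace (lscale H) (Hom (n - 1) C A)" for n unfolding sc by (rule Hom_subspace)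
  show "f = g" if "f \<in> Hom (n - 1) C A" "g \<in> Hom (n - 1) C A" "coder (n - 1) f = coder (n - 1) g" for n f g
    using p_coder[OF HomD(1)[OF that(1)]] p_coder[OF HomD(1)[OF that(2)]] that(3) by (metis ext)
  show "coder (n - 1) (f + g) a = coder (n - 1) f a + coder (n - 1) g a"
    if "f \<in> Hom (n - 1) C A" "g \<in> Hom (n - 1) C A" for n f g a
    using coder_linear(1)[OF HomD(1)[OF that(1)] HomD(1)[OF that(2)]] by (simp add: plus_fun_def)
  show "coder (n - 1) (lscale H c f) a = smul C c (coder (n - 1) f a)" if "f \<in> Hom (n - 1) C A" for n c f a
    using coder_linear(2)[OF HomD(1)[OF that] HomD(1)[OF that]] by (simp add: sc)
  show "ldiff H n f \<in> Hom (n - 1 - 1) C A" if "f \<in> Hom (n - 1) C A" for n f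
    using hdiff_Hom[OF that] by (simp only: ldiff_H[OF that])
  show "coder (n - 1 - 1) (ldiff H n f) = comm_br (- 1) n \<delta> (coder (n - 1) f)"
    if "f \<in> Hom (n - 1) C A" for n f
    by (simp only: ldiff_H[OF that] coder_ldiff[OF that])
qed (simp_all only: coder_Hom' lbr_H_Hom coder_lbr)


section \<open>Embedding the derivations into the Hochschild complex\<close>

abbreviation "TD \<equiv> tDer_dgl A"

text \<open>
  The sign in length 1 is forced by compatibility with the differentials: \<open>sf\<close> has differential \<open>-s D\<^sub>0 f\<close>,
  whereas \<open>\<theta>\<close> has differential \<open>+[d, \<theta>]\<close>. In length 0 the same sign change is built into the
  differential of \<open>sx\<close>.
\<close>

definition \<Phi> :: "int \<Rightarrow> ('a \<Rightarrow> 'a) \<times> 'a \<Rightarrow> 'c \<Rightarrow> 'a" where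
  "\<Phi> n z c = smul A (counit c) (snd z) + ksign n (fst z (p c))"

lemma lcar_TD: "z \<in> lcar TD n \<longleftrightarrow> fst z \<in> Der n A \<and> snd z \<in> gr A (n - 1)"
  by (cases z) (simp add: tDer_dgl_def)

lemma counit_smul_hom: "lin (\<lambda>c. smul A (counit c) x)"
  by (rule module_homI)
     (simp_all add: C_module module module.scale_left_distrib[OF module] module.scale_scale[OF module]
        module_hom.add[OF C.counit_hom] module_hom.scale[OF C.counit_hom])

lemma \<Phi>_Hom:
  assumes "z \<in> lcar TD n" shows "\<Phi> n z \<in> Hom (n - 1) C A"
proof -
  have z: "fst z \<in> Der n A" "snd z \<in> gr A (n - 1)" using assms by (auto simp: lcar_TD)
  show ?thesis unfolding \<Phi>_def
  proof (intro HomI module_hom_plus(1) counit_smul_hom module_hom_ksign)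
    show "lin (\<lambda>c. fst z (p c))" by (rule module_hom_comp[OF DerD(2)[OF z(1)] p_hom])
    fix l c assume c: "c \<in> gr C l"
    have "smul A (counit c) (snd z) \<in> gr A (l + (n - 1))"
      using C.counit_gr[OF c] z(2) by (cases "l = 0") (simp_all add: gr_scale gr_zero)
    moreover have "fst z (p c) \<in> gr A (l + (n - 1))"
      using DerD(3)[OF z(1) HomD(2)[OF p_Hom c]] by (simp add: algebra_simps)
    ultimately show "smul A (counit c) (snd z) + ksign n (fst z (p c)) \<in> gr A (l + (n - 1))"
      by (intro gr_add gr_ksign)
  qed
qed

lemma \<Phi>_lin: "z \<in> lcar TD n \<Longrightarrow> lin (\<Phi> n z)"
  by (rule HomD(1)[OF \<Phi>_Hom])

lemma smul_rules: "smul A c 0 = 0" "smul A c (- x) = - smul A c x"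
  "smul A c (x + y) = smul A c x + smul A c y" "smul A c (x - y) = smul A c x - smul A c y"
  "smul A c (ksign n x) = ksign n (smul A c x)"
  using module.scale_zero_right[OF module] module.scale_minus_right[OF module]
    module.scale_right_distrib[OF module] module.scale_right_diff_distrib[OF module] ksign_scale[OF module]
  by auto

lemma \<Phi>_u: "z \<in> lcar TD n \<Longrightarrow> \<Phi> n z u = snd z"
  using DerD(8)[of "fst z" n] by (simp add: \<Phi>_def lcar_TD)

lemma \<Phi>_cons: "z \<in> lcar TD n \<Longrightarrow> \<Phi> n z (cons a c) = ksign n (smul A (counit c) (fst z a))"
  using DerD(9)[of "fst z" n] by (simp add: \<Phi>_def lcar_TD)

lemma \<Phi>_coder:
  assumes "z \<in> lcar TD n" "lin g" shows "\<Phi> n z (coder k g c) = ksign n (fst z (g c))"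
  using assms by (simp add: \<Phi>_def counit_coder p_coder)

lemma \<Phi>_lbr:
  assumes z: "z \<in> lcar TD k" and z': "z' \<in> lcar TD n"
  shows "\<Phi> (k + n) (lbr TD k n z z') = lbr H k n (\<Phi> k z) (\<Phi> n z')"
proof
  fix c
  have \<theta>: "fst z \<in> Der k A" "fst z' \<in> Der n A" using z z' by (auto simp: lcar_TD)
  note D = DerD(5-9)[OF \<theta>(1)] DerD(5-9)[OF \<theta>(2)]
  show "\<Phi> (k + n) (lbr TD k n z z') c = lbr H k n (\<Phi> k z) (\<Phi> n z') c"
    unfolding lbr_H[OF \<Phi>_Hom[OF z] \<Phi>_Hom[OF z']] \<Phi>_coder[OF z \<Phi>_lin[OF z']] \<Phi>_coder[OF z' \<Phi>_lin[OF z]]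
    by (cases "even k"; cases "even n"; cases z; cases z')
       (use D in \<open>simp_all add: \<Phi>_def tDer_dgl_def comm_br_def ksign_def smul_rules\<close>)
qed

text \<open>
  In length 0 this is \<open>-dx\<close>, in length 1 the product terms of the Hochschild differential add the inner
  derivation by \<open>x\<close>, and in length 2 they cancel by the Leibniz rule for \<open>\<theta>\<close>.
\<close>

lemma \<Phi>_ldiff:
  assumes z: "z \<in> lcar TD n"
  shows "\<Phi> (n - 1) (ldiff TD n z) = ldiff H n (\<Phi> n z)"
  unfolding ldiff_H[OF \<Phi>_Hom[OF z]]
proof
  fix c
  note f = \<Phi>_lin[OF z] and dz = tDer_closed(3)[OF dga z]
  obtain \<theta> x where zx: "z = (\<theta>, x)" by (cases z)
  have \<theta>: "\<theta> \<in> Der n A" and x: "x \<in> gr A (n - 1)" using z by (auto simp: lcar_TD zx)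
  note D = DerD(5-9)[OF \<theta>]
  have dzx: "snd (ldiff TD n z) = - d x"
    "fst (ldiff TD n z) a = comm_br (- 1) n d \<theta> a - (x * a - tw A (n - 1) a * x)" for a
    by (simp_all add: tDer_dgl_def zx ad_eq[OF dga x])
  have fz: "fst z = \<theta>" "snd z = x" by (simp_all add: zx)
  have cd: "counit (\<delta> e) = 0" for e unfolding \<delta>_def by (rule counit_coder[OF m_hom])
  have twx: "tw A 1 x = ksign (n - 1) x" using tw_gr[OF graded x, of 1] by simp
  show "\<Phi> (n - 1) (ldiff TD n z) c = hdiff (n - 1) (\<Phi> n z) c"
  proof (rule bar_eq[OF \<Phi>_lin[OF dz] HomD(1)[OF hdiff_Hom[OF \<Phi>_Hom[OF z]]]])
    fix as
    show "\<Phi> (n - 1) (ldiff TD n z) (bar as) = hdiff (n - 1) (\<Phi> n z) (bar as)"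
    proof (cases as)
      case Nil
      then show ?thesis by (simp add: \<Phi>_u[OF dz] hdiff_u[OF f] \<Phi>_u[OF z] dzx(1) fz)
    next
      case (Cons a bs)
      note as = this
      show ?thesis
      proof (cases bs)
        case Nil
        show ?thesis unfolding as Nil cons_word[symmetric]
          by (cases "even n")
             (simp_all add: \<Phi>_cons[OF dz] hdiff_cons[OF f] \<Phi>_cons[OF z] \<Phi>_u[OF z] rmul_cons[OF f]
                rmul_u[OF counit_smul_hom]
                rmul_u[OF module_hom_multiple(1)[OF counit_smul_hom]] dzx fz cd linD[OF f] cons_linear twx tw_susp[OF graded] ksign_def
                comm_br_def dD(7) algebra_simps)
      next
        case (Cons b es)
        have r: "rmul (\<lambda>y. \<Phi> n z (cons a (cons b y))) (bar es) = 0" by (simp add: \<Phi>_cons[OF z])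
        have rc: "rmul (\<lambda>y. smul A (counit y) x) (cons b c) = smul A (counit c) (tw A 1 x * b)"
          "rmul (\<lambda>y. - smul A (counit y) x) (cons b c) = - smul A (counit c) (tw A 1 x * b)" for x c
          by (simp_all add: rmul_cons[OF counit_smul_hom]
              rmul_cons[OF module_hom_multiple(1)[OF counit_smul_hom]] tw_linear smul_rules)
        have L: "\<theta> (tw A 1 a * b) = ksign n (tw A 1 (\<theta> a) * b) + tw A (n + 1) a * \<theta> b"
          by (simp add: DerD(4)[OF \<theta>] DerD(12)[OF \<theta>] tw_tw[OF graded] ksign_mult)
        have t: "tw A (n - 1) a = tw A (n + 1) a" by (rule tw_parity[OF graded]) simp
        show ?thesis unfolding as Cons cons_word[symmetric]
          by (cases "even n"; cases "es = []")
             (simp_all add: \<Phi>_cons[OF dz] hdiff_cons[OF f] \<Phi>_cons[OF z] rmul_cons[OF f]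
                rmul_cons[OF lin_cons[OF f]] r rc dzx fz cd C.counit_word tw_susp[OF graded] ksign_def
                L t dD(8) tw_linear)
      qed
    qed
  qed
qed

lemma \<Phi>_inj: "inj_on (\<Phi> n) (lcar TD n)"
proof (rule inj_onI)
  fix z z' assume z: "z \<in> lcar TD n" and z': "z' \<in> lcar TD n" and e: "\<Phi> n z = \<Phi> n z'"
  have "fst z a = fst z' a" for a
  proof -
    have "ksign n (fst z a) = ksign n (fst z' a)"
      using fun_cong[OF e, of "cons a u"] by (simp add: \<Phi>_cons[OF z] \<Phi>_cons[OF z'])
    then show ?thesis by (auto simp: ksign_def split: if_splits)
  qed
  moreover have "snd z = snd z'" using fun_cong[OF e, of u] by (simp add: \<Phi>_u[OF z] \<Phi>_u[OF z'])
  ultimately show "z = z'" by (simp add: prod_eq_iff fun_eq_iff)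
qed

lemma \<Phi>_linear:
  "\<Phi> n (z + z') c = \<Phi> n z c + \<Phi> n z' c" "\<Phi> n (lscale TD k z) c = smul A k (\<Phi> n z c)"
  by (cases z; cases z'; simp add: \<Phi>_def tDer_dgl_def smul_rules ksign_add module.scale_scale[OF module]
      mult.commute)+

text \<open>
  \<open>\<theta> + sx\<close> is identified with a coderivation of \<open>TC(sA)\<close>.
\<close>

lemma is_dgl_TD: "is_dgl TD"
proof (rule is_dgl_of_endomorphisms[OF C_graded \<delta>_Hom \<delta>\<delta>, where \<phi> = "\<lambda>n z. coder (n - 1) (\<Phi> n z)"])
  note t = tDer_closed[OF dga]
  show "module (lscale TD)" "\<And>n. module.subspace (lscale TD) (lcar TD n)" by (rule t)+
  show "coder (n - 1) (\<Phi> n z) \<in> Hom n C C" if "z \<in> lcar TD n" for n z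
    by (rule coder_Hom'[OF \<Phi>_Hom[OF that]])
  show "z = z'" if "z \<in> lcar TD n" "z' \<in> lcar TD n" "coder (n - 1) (\<Phi> n z) = coder (n - 1) (\<Phi> n z')" for n z z'
  proof -
    have "\<Phi> n z c = \<Phi> n z' c" for c
      using p_coder[OF \<Phi>_lin[OF that(1)], of "n - 1" c] p_coder[OF \<Phi>_lin[OF that(2)], of "n - 1" c] that(3)
      by simp
    then show ?thesis by (intro inj_onD[OF \<Phi>_inj _ that(1,2)] ext)
  qed
  show "coder (n - 1) (\<Phi> n (z + z')) a = coder (n - 1) (\<Phi> n z) a + coder (n - 1) (\<Phi> n z') a"
    if "z \<in> lcar TD n" "z' \<in> lcar TD n" for n z z' a
    using coder_linear(1)[OF \<Phi>_lin[OF that(1)] \<Phi>_lin[OF that(2)]] by (simp add: \<Phi>_linear[abs_def])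
  show "coder (n - 1) (\<Phi> n (lscale TD k z)) a = smul C k (coder (n - 1) (\<Phi> n z) a)"
    if "z \<in> lcar TD n" for n k z a
    using coder_linear(2)[OF \<Phi>_lin[OF that] \<Phi>_lin[OF that]] by (simp add: \<Phi>_linear[abs_def])
  show "ldiff TD n z \<in> lcar TD (n - 1)" if "z \<in> lcar TD n" for n z by (rule t(3)[OF that])
  show "coder (n - 1 - 1) (\<Phi> (n - 1) (ldiff TD n z)) = comm_br (- 1) n \<delta> (coder (n - 1) (\<Phi> n z))"
    if "z \<in> lcar TD n" for n z
    by (simp only: \<Phi>_ldiff[OF that] ldiff_H[OF \<Phi>_Hom[OF that]] coder_ldiff[OF \<Phi>_Hom[OF that]])
  show "lbr TD k n z z' \<in> lcar TD (k + n)" if "z \<in> lcar TD k" "z' \<in> lcar TD n" for k n z z'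
    by (rule t(4)[OF that])
  show "coder (k + n - 1) (\<Phi> (k + n) (lbr TD k n z z')) =
      comm_br k n (coder (k - 1) (\<Phi> k z)) (coder (n - 1) (\<Phi> n z'))"
    if "z \<in> lcar TD k" "z' \<in> lcar TD n" for k n z z'
    by (simp only: \<Phi>_lbr[OF that] coder_lbr[OF \<Phi>_Hom[OF that(1)] \<Phi>_Hom[OF that(2)]])
qed

lemma is_dgl_hom_\<Phi>: "is_dgl_hom TD H \<Phi>"
  unfolding is_dgl_hom_def
  by (intro conjI allI ballI ext)
     (simp_all add: lcar_H \<Phi>_Hom \<Phi>_ldiff \<Phi>_lbr \<Phi>_linear, simp_all add: hoch_dgl_def)

text \<open>The image of \<open>\<Phi>\<close> consists of the cochains concentrated in lengths 0 and 1 that satisfy the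
  Leibniz rule in length 1, which is a part of the cocycle condition.\<close>

lemma \<Phi>_image:
  assumes f: "f \<in> Hom (n - 1) C A" and long: "\<And>a b c. f (cons a (cons b c)) = 0"
    and cyc: "\<And>a b. hdiff (n - 1) f (cons a (cons b u)) = 0"
  shows "f \<in> \<Phi> n ` lcar TD n"
proof -
  note h = HomD(1)[OF f]
  define \<theta> where "\<theta> a = ksign n (f (cons a u))" for a
  have hom: "module_hom (smul A) (smul A) \<theta>" unfolding \<theta>_def
    by (rule module_hom_ksign[OF module_hom_comp[OF h bilin_hom(2)[OF cons_bilin]]])
  have \<theta>_Hom: "\<theta> \<in> Hom n A A"
  proof (rule HomI[OF hom])
    fix i a assume "a \<in> gr A i"
    then have "cons a u \<in> gr C (i + 1)" using C.cons_gr[OF _ C.unit_gr, of a "i + 1"] by simp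
    from HomD(2)[OF f this] show "\<theta> a \<in> gr A (i + n)" by (simp add: \<theta>_def gr_ksign)
  qed
  have \<theta>tw: "\<theta> (tw A 1 a) = ksign n (tw A 1 (\<theta> a))" for a
    using Hom_tw[OF graded graded \<theta>_Hom, of 1] by simp
  have "\<theta> \<in> Der n A"
  proof (rule DerI[OF \<theta>_Hom])
    fix a b
    have \<theta>f: "f (cons a u) = ksign n (\<theta> a)" for a by (simp add: \<theta>_def ksign_def)
    have "tws (n - 1) (tw A 1 a) * ksign n (\<theta> b) - tw A 1 (ksign n (\<theta> (tw A 1 a))) * b
        - ksign (n - 1) (ksign n (\<theta> (a * b))) = 0"
      using cyc[of "tw A 1 a" b]
      by (simp add: hdiff_cons[OF h] long rmul_cons[OF h] rmul_cons[OF lin_cons[OF h]]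
          rmul_u[OF lin_cons[OF lin_cons[OF h]]] \<delta>_cons cons_linear linD[OF h] \<theta>f tw_1 dD(8))
    moreover have "tws (n - 1) (tw A 1 a) = ksign (n - 1) (tw A n a)"
      by (simp add: tw_susp[OF graded] tw_tw[OF graded])
    ultimately show "\<theta> (a * b) = \<theta> a * b + tw A n a * \<theta> b"
      unfolding \<theta>tw by (cases "even n") (simp_all add: ksign_def tw_linear tw_1 algebra_simps)
  qed
  moreover have "f u \<in> gr A (n - 1)" using HomD(2)[OF f C.unit_gr] by simp
  ultimately have z: "(\<theta>, f u) \<in> lcar TD n" by (simp add: lcar_TD)
  have "f c = \<Phi> n (\<theta>, f u) c" for c
  proof (rule bar_eq[OF h \<Phi>_lin[OF z]])
    fix as show "f (bar as) = \<Phi> n (\<theta>, f u) (bar as)"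
    proof (cases as)
      case Nil then show ?thesis by (simp add: \<Phi>_u[OF z])
    next
      case (Cons a bs)
      note as = this
      show ?thesis
      proof (cases bs)
        case Nil
        show ?thesis unfolding as Nil cons_word[symmetric]
          by (simp add: \<Phi>_cons[OF z] \<theta>_def) (simp add: ksign_def)
      next
        case (Cons b es)
        show ?thesis unfolding as Cons cons_word[symmetric]
          by (simp add: \<Phi>_cons[OF z] long)
      qed
    qed
  qed
  then have "f = \<Phi> n (\<theta>, f u)" by (intro ext)
  then show ?thesis using z by (rule image_eqI)
qed

end


section \<open>Acyclicity of the Hochschild complex modulo derivations\<close>

locale free_hochschild = hochschild A C bar sc2 t cons
  for A :: "('k::comm_ring_1, 'a::ring_1) dga" and C :: "('k, 'c::ab_group_add) gmod"
    and bar :: "'a list \<Rightarrow> 'c" and sc2 :: "'k \<Rightarrow> 'e::ab_group_add \<Rightarrow> 'e" and t cons +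
  fixes V :: "('k, 'v::ab_group_add) gmod" and \<iota> :: "'v \<Rightarrow> 'a" and F :: "nat \<Rightarrow> int \<Rightarrow> 'v set"
  assumes V_graded: "graded_module V" and A_tensor: "tensor_algebra V A \<iota>"
    and F_gr: "gr V i = (\<Union>k. F k i)"
    and F0: "v \<in> F 0 i \<Longrightarrow> diff A (\<iota> v) = 0"
    and F_Suc: "v \<in> F (Suc k) i \<Longrightarrow> diff A (\<iota> v) \<in> module.span (smul A)
           {prod_list (map \<iota> vs) | vs. set vs \<subseteq> (\<Union>j. F k j)}"
begin

sublocale TA: tensor_alg V A \<iota>
  by unfold_locales (rule V_graded, rule A_tensor)

end

text \<open>
  Fix a cochain \<open>f\<close> whose differential vanishes on words of length at least 3. A cochain \<open>g\<close> is built
  whose differential agrees with \<open>f\<close> on words of length at least 2. Writing \<open>g\<close> on a word with first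
  letter \<open>a\<close> as a linear map \<open>ghat a\<close> of the rest, the equation for \<open>a = v b\<close> with \<open>v\<close> a generator suggests
  the recursion \<open>ghat (v b) = \<plusminus> f[v|b|\<dots>] \<plusminus> v (ghat b) \<plusminus> ghat (d v) [b|\<dots>]\<close>. Its last term is not covered by
  recursion on the word, as \<open>d v\<close> may be long. So it is first replaced by an arbitrary \<open>\<gamma> v\<close>, and a
  fixed point \<open>\<gamma> v = ghat (d v)\<close> is found by iteration: on generators of level \<open>k\<close> of the free
  model the iterates are constant from the \<open>k\<close>-th on.
\<close>

locale hochschild_cochain = free_hochschild A C bar sc2 t cons V \<iota> F
  for A :: "('k::comm_ring_1, 'a::ring_1) dga" and C :: "('k, 'c::ab_group_add) gmod"
    and bar :: "'a list \<Rightarrow> 'c" and sc2 :: "'k \<Rightarrow> 'e::ab_group_add \<Rightarrow> 'e" and t cons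
    and V :: "('k, 'v::ab_group_add) gmod" and \<iota> F +
  fixes q :: int and f :: "'c \<Rightarrow> 'a"
  assumes f: "f \<in> Hom q C A"
    and cocycle: "hdiff q f (cons a (cons b (cons c x))) = 0"
begin

lemmas f_lin = HomD(1)[OF f]
lemmas f_simps = linD[OF f_lin]

definition CA :: "('k, 'c \<Rightarrow> 'a) gmod" where
  "CA = \<lparr>smul = (\<lambda>c \<phi> x. smul A c (\<phi> x)), gr = (\<lambda>n. Hom n C A)\<rparr>"

lemma smul_CA: "smul CA c \<phi> = (\<lambda>x. smul A c (\<phi> x))" and gr_CA: "gr CA n = Hom n C A"
  by (simp_all add: CA_def)

lemma module_CA: "module (smul CA)"
  unfolding CA_def gmod.select_convs by (rule module_pointwise[OF module])

lemma subspace_CA: "module.subspace (smul CA) (gr CA n)"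
  using Hom_subspace by (simp add: CA_def)

definition step :: "('v \<Rightarrow> 'c \<Rightarrow> 'a) \<Rightarrow> 'v \<Rightarrow> 'a \<Rightarrow> ('c \<Rightarrow> 'a) \<Rightarrow> 'c \<Rightarrow> 'a" where
  "step \<gamma> v b y x = ksign q (f (cons (tw A 1 (\<iota> v)) (cons b x))) + tw A q (\<iota> v) * y x - \<gamma> v (cons b x)"

definition ghat :: "('v \<Rightarrow> 'c \<Rightarrow> 'a) \<Rightarrow> 'a \<Rightarrow> 'c \<Rightarrow> 'a" where
  "ghat \<gamma> = TA.tfold (smul CA) (\<lambda>x. - ksign q (f (cons 1 (cons 1 x)))) (step \<gamma>)"

text \<open>The conditions on \<open>\<gamma>\<close> under which the recursion makes sense and yields homogeneous maps.\<close>

definition admissible :: "('v \<Rightarrow> 'c \<Rightarrow> 'a) \<Rightarrow> bool" where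
  "admissible \<gamma> \<longleftrightarrow> module_hom (smul V) (smul CA) \<gamma> \<and> (\<forall>i. \<forall>v\<in>gr V i. \<gamma> v \<in> Hom (q + 1 + i) C A)"

lemma admissible_lin:
  assumes "admissible \<gamma>" shows "lin (\<gamma> v)"
proof (induction v rule: graded_induct[OF V_graded])
  case (1 i v)
  then show ?case using assms by (auto simp: admissible_def dest: HomD(1))
next
  case (2 v v')
  have "\<gamma> (v + v') = (\<lambda>x. \<gamma> v x + \<gamma> v' x)"
    using module_hom.add[of "smul V" "smul CA" \<gamma>] assms by (simp add: admissible_def plus_fun_def)
  then show ?case using module_hom_plus(1)[OF 2] by simp
qed

lemma step_rec:
  assumes \<gamma>: "admissible \<gamma>" shows "TA.rec_step (smul CA) (step \<gamma>)"
proof -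
  have h: "module_hom (smul V) (smul CA) \<gamma>" using \<gamma> by (simp add: admissible_def)
  note l = linD[OF admissible_lin[OF \<gamma>]]
  show ?thesis unfolding TA.rec_step_def
    by (simp add: module_CA step_def fun_eq_iff module_hom.add[OF h] module_hom.scale[OF h]
        module_hom.add[OF TA.gen_hom] module_hom.scale[OF TA.gen_hom] tw_linear smul_CA cons_linear f_simps l ksign_add
        smul_mult smul_rules distrib_left distrib_right algebra_simps)
qed

lemma ghat:
  assumes \<gamma>: "admissible \<gamma>"
  shows ghat_hom: "module_hom (smul A) (smul CA) (ghat \<gamma>)"
    and ghat_1: "ghat \<gamma> 1 x = - ksign q (f (cons 1 (cons 1 x)))"
    and ghat_mult: "ghat \<gamma> (\<iota> v * b) x =
      ksign q (f (cons (tw A 1 (\<iota> v)) (cons b x))) + tw A q (\<iota> v) * ghat \<gamma> b x - \<gamma> v (cons b x)"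
  unfolding ghat_def using TA.tfold[OF step_rec[OF \<gamma>]] by (simp_all add: step_def)

lemma ghat_Hom:
  assumes \<gamma>: "admissible \<gamma>" shows "ghat \<gamma> \<in> Hom (q + 2) A CA"
proof (rule TA.HomI_rec[OF ghat_hom[OF \<gamma>] subspace_CA])
  have e: "cons a x \<in> gr C (i + 1 + l)" if "a \<in> gr A i" "x \<in> gr C l" for a x i l
    using C.cons_gr[of a "i + 1" x l] that by simp
  have "ghat \<gamma> 1 \<in> Hom (q + 2) C A"
  proof (rule HomI)
    show "lin (ghat \<gamma> 1)" unfolding ghat_1[OF \<gamma>, abs_def]
      by (intro module_hom_multiple(1) module_hom_ksign lin_cons f_lin)
    show "ghat \<gamma> 1 x \<in> gr A (l + (q + 2))" if "x \<in> gr C l" for l x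
      using HomD(2)[OF f e[OF one_gr e[OF one_gr that]]] unfolding ghat_1[OF \<gamma>]
      by (intro gr_neg gr_ksign) (simp add: algebra_simps)
  qed
  then show "ghat \<gamma> (prod_list (map \<iota> [])) \<in> gr CA (q + 2)" by (simp add: gr_CA)
  fix i p v b assume v: "v \<in> gr V i" and b: "b \<in> gr A p" and y: "ghat \<gamma> b \<in> gr CA (p + (q + 2))"
  have y': "ghat \<gamma> b \<in> Hom (p + (q + 2)) C A" using y by (simp add: gr_CA)
  have \<gamma>v: "\<gamma> v \<in> Hom (q + 1 + i) C A" using \<gamma> v by (simp add: admissible_def)
  have "ghat \<gamma> (\<iota> v * b) \<in> Hom (i + p + (q + 2)) C A"
  proof (rule HomI)
    show "lin (ghat \<gamma> (\<iota> v * b))" unfolding ghat_mult[OF \<gamma>, abs_def]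
      by (intro module_hom_plus module_hom_ksign lin_cons f_lin HomD(1)[OF \<gamma>v]
          module_hom_comp[OF mult_hom(1) HomD(1)[OF y']])
    fix l x assume x: "x \<in> gr C l"
    have "f (cons (tw A 1 (\<iota> v)) (cons b x)) \<in> gr A (l + (i + p + (q + 2)))"
      using HomD(2)[OF f e[OF tw_in_gr[OF graded TA.gen_gr[OF v]] e[OF b x]]] by (simp add: algebra_simps)
    moreover have "tw A q (\<iota> v) * ghat \<gamma> b x \<in> gr A (l + (i + p + (q + 2)))"
      using mult_gr[OF tw_in_gr[OF graded TA.gen_gr[OF v]] HomD(2)[OF y' x]] by (simp add: algebra_simps)
    moreover have "\<gamma> v (cons b x) \<in> gr A (l + (i + p + (q + 2)))"
      using HomD(2)[OF \<gamma>v e[OF b x]] by (simp add: algebra_simps)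
    ultimately show "ghat \<gamma> (\<iota> v * b) x \<in> gr A (l + (i + p + (q + 2)))"
      unfolding ghat_mult[OF \<gamma>] by (intro gr_add gr_diff gr_ksign)
  qed
  then show "ghat \<gamma> (\<iota> v * b) \<in> gr CA (i + p + (q + 2))" by (simp add: gr_CA)
qed

definition next_\<gamma> :: "('v \<Rightarrow> 'c \<Rightarrow> 'a) \<Rightarrow> 'v \<Rightarrow> 'c \<Rightarrow> 'a" where
  "next_\<gamma> \<gamma> v = ghat \<gamma> (d (tw A 1 (\<iota> v)))"

lemma admissible_next:
  assumes \<gamma>: "admissible \<gamma>" shows "admissible (next_\<gamma> \<gamma>)"
  unfolding admissible_def
proof (intro conjI allI ballI)
  show "module_hom (smul V) (smul CA) (next_\<gamma> \<gamma>)" unfolding next_\<gamma>_def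
    by (rule module_hom_comp[OF ghat_hom[OF \<gamma>] module_hom_comp[OF dD(2) module_hom_comp[OF tw_hom[OF graded] TA.gen_hom]]])
  fix i v assume "v \<in> gr V i"
  then have "d (tw A 1 (\<iota> v)) \<in> gr A (i - 1)"
    using dD(3)[OF tw_in_gr[OF graded TA.gen_gr]] by simp
  from HomD(2)[OF ghat_Hom[OF \<gamma>] this] show "next_\<gamma> \<gamma> v \<in> Hom (q + 1 + i) C A"
    by (simp add: next_\<gamma>_def gr_CA algebra_simps)
qed

definition iter :: "nat \<Rightarrow> 'v \<Rightarrow> 'c \<Rightarrow> 'a" where "iter k = (next_\<gamma> ^^ k) (\<lambda>v x. 0)"

lemma admissible_iter: "admissible (iter k)"
proof (induction k)
  case 0
  show ?case unfolding admissible_def iter_def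
    by (auto intro!: module_homI HomI simp: graded_module_module[OF V_graded] module_CA smul_CA
        C_module module smul_rules gr_zero zero_fun_def[symmetric] fun_eq_iff)
next
  case (Suc k)
  then show ?case using admissible_next by (simp add: iter_def)
qed

text \<open>
  The recursion on a word only calls \<open>\<gamma>\<close> on letters of this word.
\<close>

lemma ghat_local:
  assumes \<gamma>: "admissible \<gamma>" and \<gamma>': "admissible \<gamma>'" and eq: "\<And>v j. v \<in> F k j \<Longrightarrow> \<gamma> v = \<gamma>' v"
    and a: "a \<in> module.span (smul A) {prod_list (map \<iota> vs) | vs. set vs \<subseteq> (\<Union>j. F k j)}"
  shows "ghat \<gamma> a = ghat \<gamma>' a"
proof (rule module.span_induct[OF module a])
  show "module.subspace (smul A) {a. ghat \<gamma> a = ghat \<gamma>' a}"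
    using module_hom.subspace_kernel[OF module_hom_plus(2)[OF ghat_hom[OF \<gamma>] ghat_hom[OF \<gamma>']]] by simp
  fix a assume "a \<in> {prod_list (map \<iota> vs) | vs. set vs \<subseteq> (\<Union>j. F k j)}"
  then obtain vs where a: "a = prod_list (map \<iota> vs)" and vs: "set vs \<subseteq> (\<Union>j. F k j)" by blast
  show "ghat \<gamma> a = ghat \<gamma>' a" unfolding a using vs
  proof (induction vs)
    case Nil
    show ?case by (simp add: fun_eq_iff ghat_1[OF \<gamma>] ghat_1[OF \<gamma>'])
  next
    case (Cons v vs)
    then show ?case using eq by (auto simp add: fun_eq_iff ghat_mult[OF \<gamma>] ghat_mult[OF \<gamma>'])
  qed
qed

lemma F_homog: "v \<in> F k i \<Longrightarrow> v \<in> gr V i"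
  using F_gr by blast

lemma d_tw:
  assumes "v \<in> F k i" shows "d (tw A 1 (\<iota> v)) = ksign i (d (\<iota> v))"
  using tw_gr[OF graded TA.gen_gr[OF F_homog[OF assms]], of 1] by (simp add: dD(10))

lemma d_tw_span:
  assumes "v \<in> F (Suc k) i"
  shows "d (tw A 1 (\<iota> v)) \<in> module.span (smul A) {prod_list (map \<iota> vs) | vs. set vs \<subseteq> (\<Union>j. F k j)}"
  unfolding d_tw[OF assms]
  by (rule ksign_subspace[OF module module.subspace_span[OF module] F_Suc[OF assms]])

text \<open>
  For \<open>v\<close> of level \<open>k + 1\<close>, the element \<open>d v\<close> is a combination of words of level \<open>k\<close>, on whose letters the
  iterates have already become stationary.
\<close>

lemma iter_stable: "v \<in> F k i \<Longrightarrow> k \<le> j \<Longrightarrow> iter j v = iter k v"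
proof (induction k arbitrary: v i j)
  case 0
  have "iter j v = (\<lambda>x. 0)"
  proof (cases j)
    case (Suc j')
    have "iter j v = ghat (iter j') (d (tw A 1 (\<iota> v)))" by (simp add: iter_def Suc next_\<gamma>_def)
    also have "\<dots> = 0" unfolding d_tw[OF 0(1)] F0[OF 0(1)] ksign_simps
      by (rule module_hom.zero[OF ghat_hom[OF admissible_iter]])
    finally show ?thesis by (simp add: zero_fun_def)
  qed (simp add: iter_def)
  then show ?case by (simp add: iter_def)
next
  case (Suc k)
  then obtain j' where j: "j = Suc j'" "k \<le> j'" by (cases j) auto
  have "iter (Suc l) v = ghat (iter l) (d (tw A 1 (\<iota> v)))" for l by (simp add: iter_def next_\<gamma>_def)
  moreover have "ghat (iter j') (d (tw A 1 (\<iota> v))) = ghat (iter k) (d (tw A 1 (\<iota> v)))"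
    by (rule ghat_local[OF admissible_iter admissible_iter _ d_tw_span[OF Suc.prems(1)]])
       (rule Suc.IH[OF _ j(2)])
  ultimately show ?case by (simp only: j)
qed

lemma eventually_stable: "\<exists>k. \<forall>j\<ge>k. iter j v = iter k v"
proof (induction v rule: graded_induct[OF V_graded])
  case (1 i v)
  then obtain k where "v \<in> F k i" using F_gr by blast
  then show ?case using iter_stable by blast
next
  case (2 v v')
  obtain a where a: "\<forall>j\<ge>a. iter j v = iter a v" using 2(1) ..
  obtain b where b: "\<forall>j\<ge>b. iter j v' = iter b v'" using 2(2) ..
  note k = a[rule_format] b[rule_format]
  have h: "module_hom (smul V) (smul CA) (iter j)" for j
    using admissible_iter by (simp add: admissible_def)
  show ?case
  proof (intro exI[of _ "max a b"] allI impI)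
    fix j assume "max a b \<le> j"
    then show "iter j (v + v') = iter (max a b) (v + v')"
      using k(1)[of j] k(1)[of "max a b"] k(2)[of j] k(2)[of "max a b"]
      by (simp add: module_hom.add[OF h])
  qed
qed

definition limit_\<gamma> :: "'v \<Rightarrow> 'c \<Rightarrow> 'a" where
  "limit_\<gamma> v = iter (SOME k. \<forall>j\<ge>k. iter j v = iter k v) v"

lemma limit_eq:
  assumes "\<And>j. j \<ge> k \<Longrightarrow> iter j v = iter k v" shows "limit_\<gamma> v = iter k v"
proof -
  define l where "l = (SOME k. \<forall>j\<ge>k. iter j v = iter k v)"
  have st: "\<forall>j\<ge>l. iter j v = iter l v" unfolding l_def by (rule someI_ex[OF eventually_stable])
  have "iter (max k l) v = iter l v" by (rule st[rule_format]) simp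
  moreover have "iter (max k l) v = iter k v" by (rule assms) simp
  ultimately show ?thesis unfolding limit_\<gamma>_def l_def[symmetric] by simp
qed

lemma limit_common:
  "\<exists>k. limit_\<gamma> v = iter k v \<and> limit_\<gamma> v' = iter k v' \<and> limit_\<gamma> v'' = iter k v''"
proof -
  obtain a where a: "\<forall>j\<ge>a. iter j v = iter a v" using eventually_stable[of v] ..
  obtain b where b: "\<forall>j\<ge>b. iter j v' = iter b v'" using eventually_stable[of v'] ..
  obtain c where c: "\<forall>j\<ge>c. iter j v'' = iter c v''" using eventually_stable[of v''] ..
  note k = a[rule_format] b[rule_format] c[rule_format]
  let ?k = "max a (max b c)"
  have "limit_\<gamma> v = iter ?k v" using limit_eq[OF k(1)] k(1)[of ?k] by (simp only: max.cobounded1 simp_thms)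
  moreover have "limit_\<gamma> v' = iter ?k v'" using limit_eq[OF k(2)] k(2)[of ?k] by (simp only: le_max_iff_disj order_refl simp_thms)
  moreover have "limit_\<gamma> v'' = iter ?k v''" using limit_eq[OF k(3)] k(3)[of ?k] by (simp only: le_max_iff_disj order_refl simp_thms)
  ultimately show ?thesis by (intro exI[of _ ?k] conjI)
qed

lemma admissible_limit: "admissible limit_\<gamma>"
  unfolding admissible_def
proof (intro conjI allI ballI)
  have h: "module_hom (smul V) (smul CA) (iter j)" for j
    using admissible_iter by (simp add: admissible_def)
  show "module_hom (smul V) (smul CA) limit_\<gamma>"
  proof (rule module_homI[OF graded_module_module[OF V_graded] module_CA])
    fix v v' c
    obtain k where "limit_\<gamma> v = iter k v" "limit_\<gamma> v' = iter k v'" "limit_\<gamma> (v + v') = iter k (v + v')"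
      using limit_common[of v v' "v + v'"] by (elim exE conjE)
    then show "limit_\<gamma> (v + v') = limit_\<gamma> v + limit_\<gamma> v'" by (simp only: module_hom.add[OF h])
    obtain k where "limit_\<gamma> v = iter k v" "limit_\<gamma> (smul V c v) = iter k (smul V c v)"
      using limit_common[of v "smul V c v" v] by (elim exE conjE)
    then show "limit_\<gamma> (smul V c v) = smul CA c (limit_\<gamma> v)" by (simp only: module_hom.scale[OF h])
  qed
  fix i v assume v: "v \<in> gr V i"
  obtain k where "limit_\<gamma> v = iter k v" using limit_common[of v v v] by (elim exE conjE)
  then show "limit_\<gamma> v \<in> Hom (q + 1 + i) C A" using admissible_iter v by (simp add: admissible_def)
qed

lemma limit_F: "v \<in> F k i \<Longrightarrow> limit_\<gamma> v = iter k v"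
  by (rule limit_eq) (rule iter_stable)

abbreviation "gh \<equiv> ghat limit_\<gamma>"

text \<open>
  On a generator of given level the limit is a late iterate, and so is the limit on the letters of its
  differential.
\<close>

lemma limit_fixed:
  assumes v: "v \<in> gr V i" shows "limit_\<gamma> v = gh (d (tw A 1 (\<iota> v)))"
proof -
  obtain k where k: "v \<in> F k i" using v F_gr by blast
  show ?thesis
  proof (cases k)
    case 0
    have "gh (d (tw A 1 (\<iota> v))) = 0" unfolding d_tw[OF k[unfolded 0]] F0[OF k[unfolded 0]] ksign_simps
      by (rule module_hom.zero[OF ghat_hom[OF admissible_limit]])
    then show ?thesis using limit_F[OF k] by (simp add: 0 iter_def zero_fun_def)
  next
    case (Suc l)
    have "gh (d (tw A 1 (\<iota> v))) = ghat (iter l) (d (tw A 1 (\<iota> v)))"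
      by (rule ghat_local[OF admissible_limit admissible_iter limit_F d_tw_span[OF k[unfolded Suc]]])
    then show ?thesis using limit_F[OF k] by (simp add: Suc iter_def next_\<gamma>_def)
  qed
qed

lemma gh_linear:
  "gh (a + b) x = gh a x + gh b x" "gh (- a) x = - gh a x" "gh 0 x = 0"
  "gh (smul A k a) x = smul A k (gh a x)" "gh (ksign n a) x = ksign n (gh a x)"
  "gh (a - b) x = gh a x - gh b x"
proof -
  note h = ghat_hom[OF admissible_limit]
  show "gh (a + b) x = gh a x + gh b x" "gh (smul A k a) x = smul A k (gh a x)"
    by (simp_all add: module_hom.add[OF h] module_hom.scale[OF h] smul_CA)
  show n: "gh (- a) x = - gh a x" by (simp add: module_hom.neg[OF h])
  show "gh 0 x = 0" by (simp add: module_hom.zero[OF h])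
  show "gh (ksign n a) x = ksign n (gh a x)" by (simp add: ksign_def n)
  show "gh (a - b) x = gh a x - gh b x" by (simp add: module_hom.diff[OF h])
qed

lemma gh_lin: "lin (gh a)"
proof (induction a rule: graded_induct[OF graded])
  case (1 i a)
  then show ?case using HomD(2)[OF ghat_Hom[OF admissible_limit]] by (auto simp: gr_CA dest: HomD(1))
next
  case (2 a b)
  have "gh (a + b) = (\<lambda>x. gh a x + gh b x)" by (simp add: fun_eq_iff gh_linear)
  then show ?case using module_hom_plus(1)[OF 2] by simp
qed

definition g :: "'c \<Rightarrow> 'a" where "g = C.tfold (smul A) 0 (\<lambda>a x y. gh a x)"

lemma g_lin: "lin g" and g_u: "g u = 0" and g_cons: "g (cons a x) = gh a x"
proof -
  have "C.rec_step (smul A) (\<lambda>a x y. gh a x)"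
    by (rule rec_stepI[OF module]) (simp_all add: gh_linear linD[OF gh_lin])
  from C.tfold[OF this] show "lin g" "g u = 0" "g (cons a x) = gh a x" unfolding g_def by auto
qed

lemma g_Hom: "g \<in> Hom (q + 1) C A"
proof (rule C.HomI_rec[OF g_lin subspace_gr])
  show "g u \<in> gr A (q + 1)" by (simp add: g_u gr_zero)
  fix i p a x assume a: "a \<in> gr (susp A) i" and x: "x \<in> gr C p"
  have "gh a \<in> Hom (i - 1 + (q + 2)) C A"
    using HomD(2)[OF ghat_Hom[OF admissible_limit], of a "i - 1"] a by (simp add: gr_CA)
  from HomD(2)[OF this x] show "g (cons a x) \<in> gr A (i + p + (q + 1))"
    by (simp add: g_cons algebra_simps)
qed

text \<open>
  Only words with at least two letters are considered: in length 1 the cochain \<open>f\<close> may be a derivation,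
  and these survive in homology.
\<close>

definition solves :: "'a \<Rightarrow> bool" where
  "solves a \<longleftrightarrow> (\<forall>b x. hdiff (q + 1) g (cons a (cons b x)) = f (cons a (cons b x)))"

lemma hdiff_g:
  assumes c: "c = cons e x"
  shows "hdiff (q + 1) g (cons a c) = - d (gh a c) + tws (q + 1) a * gh e x - rmul (gh a) c
     - ksign (q + 1) (gh (tw A 1 a) (\<delta> c) + gh (d a) c + gh (tw A 1 a * e) x)"
proof -
  have "rmul g (cons a c) = rmul (gh a) c"
    using rmul_cons[OF g_lin, of a c] by (simp add: c g_cons)
  then show ?thesis unfolding hdiff_cons[OF g_lin] by (simp add: g_cons) (simp add: c g_cons)
qed

lemma solves_1: "solves 1"
  unfolding solves_def
proof (intro allI)
  fix e x
  define c where "c = cons e x"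
  have cc: "counit c = 0" by (simp add: c_def)
  have lm: "lmul 1 c = c" by (simp add: c_def)
  have f11: "lin (\<lambda>y. f (cons 1 (cons 1 y)))" by (rule lin_cons[OF lin_cons[OF f_lin]])
  have gh1: "gh 1 = (\<lambda>y. ksign (q + 1) (f (cons 1 (cons 1 y))))"
    by (simp add: fun_eq_iff ghat_1[OF admissible_limit] ksign_def)
  have tq: "tws k 1 = ksign k 1" for k by (simp add: tw_susp[OF graded])
  have r1: "rmul (gh 1) c = ksign (q + 1) (rmul (\<lambda>y. f (cons 1 (cons 1 y))) c)"
    unfolding gh1 by (rule rmul_linear(3)[OF f11 f11])
  have "hdiff q f (cons 1 (cons 1 c)) = 0" unfolding c_def by (rule cocycle)
  then have E: "- d (f (cons 1 (cons 1 c))) + tws q 1 * f (cons 1 c) - rmul (\<lambda>y. f (cons 1 (cons 1 y))) c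
      - ksign q (f (cons 1 (- cons 1 (\<delta> c) - c)) + f (cons 0 (cons 1 c)) + f (cons 1 c)) = 0" (is "?E = 0")
    unfolding hdiff_cons[OF f_lin] rmul_cons[OF f_lin] rmul_cons[OF lin_cons[OF f_lin]] \<delta>_cons
    by (simp add: cc lm dD(11) cons_linear)
  have "f (cons 1 c) = f (cons 1 c) - ksign q ?E" unfolding E by simp
  also have "\<dots> = ksign q (d (f (cons 1 (cons 1 c))) + rmul (\<lambda>y. f (cons 1 (cons 1 y))) c)
      - f (cons 1 (cons 1 (\<delta> c)))"
    by (cases "even q") (simp_all add: ksign_def tq cons_linear f_simps algebra_simps)
  finally have L: "f (cons 1 c) = \<dots>" .
  show "hdiff (q + 1) g (cons 1 (cons e x)) = f (cons 1 (cons e x))"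
    unfolding c_def[symmetric] hdiff_g[OF c_def] r1 L
    by (cases "even q")
      (simp_all add: gh1 tq dD(7,8,11) gh_linear ksign_def algebra_simps)
qed

text \<open>
  The recursion for \<open>ghat\<close> on \<open>\<iota> v * b\<close> expresses the differential of \<open>g\<close> in terms of values of \<open>f\<close> and of
  \<open>ghat\<close> on \<open>b\<close> and \<open>d v\<close>. Three equations reduce it to an identity: the cocycle condition for \<open>f\<close> on
  \<open>[v|b|\<dots>]\<close>, the claim for \<open>b\<close>, and the claim for \<open>d v\<close> on \<open>[d v|b|\<dots>]\<close>.
\<close>

lemma solves_mult:
  assumes v: "v \<in> gr V i" and b: "solves b" and dv: "solves (d (\<iota> v))"
  shows "solves (\<iota> v * b)"
  unfolding solves_def
proof (intro allI)
  fix e x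
  define w where "w = \<iota> v"
  define c where "c = cons e x"
  have w: "w \<in> gr A i" unfolding w_def by (rule TA.gen_gr[OF v])
  have dw: "d w \<in> gr A (i - 1)" using dD(3)[OF w] by simp
  have cc: "counit c = 0" by (simp add: c_def)
  have lm: "lmul a c = cons (a * e) x" for a by (simp add: c_def)
  have tw: "tw A k w = ksign (k * i) w" for k by (rule tw_gr[OF graded w])
  have tdw: "tw A 1 (d w) = - ksign i (d w)" using tw_gr[OF graded dw, of 1] by (simp add: ksign_def)
  have tsw: "tws q w = ksign (q * i + q) w" by (simp add: tw_susp[OF graded] tw add.commute)
  have tsdw: "tws (q + 1) (d w) = ksign (q * i + i) (d w)"
    using tw_gr[OF C.graded_V, of "d w" i "q + 1"] dw by (simp add: algebra_simps)
  have tswb: "tws (q + 1) (w * b) = ksign (q * i + i) (w * tws (q + 1) b)"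
    by (simp add: tw_susp[OF graded] tw_mult tw ksign_mult algebra_simps)
  have twb: "tw A 1 (w * a) = ksign i (w * tw A 1 a)" for a by (simp add: tw_mult tw ksign_mult)
  have dwb: "d (w * a) = d w * a + ksign i (w * d a)" for a
    by (simp add: dD(4) tw ksign_mult) (simp add: ksign_def)
  have lim: "limit_\<gamma> v y = ksign i (gh (d w) y)" for y
    unfolding limit_fixed[OF v] w_def[symmetric] by (simp add: tw dD(10) gh_linear)
  have M: "gh (w * a) y = ksign (q + i) (f (cons w (cons a y))) + ksign (q * i) (w * gh a y)
      - ksign i (gh (d w) (cons a y))" for a y
    by (simp add: ghat_mult[OF admissible_limit, of v a y, folded w_def] lim tw cons_ksign f_simps ksign_mult)
  have rf: "rmul (\<lambda>y. f (cons w (cons b y))) c = rmul f (cons w (cons b c))"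
    by (simp add: rmul_cons[OF f_lin] rmul_cons[OF lin_cons[OF f_lin]] cc)
  have rg: "rmul (\<lambda>y. gh (d w) (cons b y)) c = rmul (gh (d w)) (cons b c)"
    by (simp add: rmul_cons[OF gh_lin] cc)
  note lf = lin_cons[OF lin_cons[OF f_lin]] and lg = lin_cons[OF gh_lin]
    and lw = module_hom_comp[OF mult_hom(1) gh_lin]
  have R: "rmul (gh (w * b)) c = ksign (q + i) (rmul f (cons w (cons b c)))
      + ksign (q * i + i) (w * rmul (gh b) c) - ksign i (rmul (gh (d w)) (cons b c))"
  proof -
    have "gh (w * b) = (\<lambda>y. (ksign (q + i) (f (cons w (cons b y))) + ksign (q * i) (w * gh b y))
      - ksign i (gh (d w) (cons b y)))" using M by (simp add: fun_eq_iff)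
    then have "rmul (gh (w * b)) c = ksign (q + i) (rmul (\<lambda>y. f (cons w (cons b y))) c)
      + ksign (q * i) (tw A 1 w * rmul (gh b) c) - ksign i (rmul (\<lambda>y. gh (d w) (cons b y)) c)"
      by (simp only: rmul_linear(1)[OF module_hom_ksign[OF lf] module_hom_ksign[OF lw]]
          rmul_linear(2)[OF module_hom_plus(1)[OF module_hom_ksign[OF lf] module_hom_ksign[OF lw]] module_hom_ksign[OF lg]]
          rmul_linear(3)[OF lf lf] rmul_linear(3)[OF lg lg] rmul_linear(3)[OF lw lw] rmul_linear(4)[OF gh_lin gh_lin])
    then show ?thesis unfolding rf rg by (simp add: tw ksign_mult add.commute)
  qed
  have \<delta>b: "\<delta> (cons b c) = - cons (tw A 1 b) (\<delta> c) - cons (d b) c - cons (tw A 1 b * e) x"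
    by (simp add: \<delta>_cons lm)
  have "hdiff q f (cons w (cons b c)) = 0" unfolding c_def by (rule cocycle)
  then have E: "- d (f (cons w (cons b c))) + ksign (q * i + q) (w * f (cons b c))
      - rmul f (cons w (cons b c)) - ksign q (ksign i (f (cons w (\<delta> (cons b c))))
      + f (cons (d w) (cons b c)) + ksign i (f (cons (w * b) c))) = 0" (is "?E = 0")
    by (simp add: hdiff_cons[OF f_lin] tsw tw cons_ksign f_simps ksign_mult)
  \<comment> \<open>The multiple of the cocycle condition is chosen so that \<open>f [w b|c]\<close> cancels.\<close>
  have "f (cons (w * b) c) = f (cons (w * b) c) + ksign (q + i) ?E" unfolding E by simp
  also have "\<dots> = ksign (q + i) (- d (f (cons w (cons b c)))
      + ksign (q * i + q) (w * f (cons b c)) - rmul f (cons w (cons b c))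
      - ksign q (f (cons (d w) (cons b c)))) + f (cons w (cons (tw A 1 b) (\<delta> c)))
      + f (cons w (cons (d b) c)) + f (cons w (cons (tw A 1 b * e) x))"
    unfolding \<delta>b
    by (cases "even q"; cases "even i") (simp_all add: ksign_def cons_linear f_simps algebra_simps)
  finally have L: "f (cons (w * b) c) = \<dots>" .
  have B: "f (cons b c) = - d (gh b c) + tws (q + 1) b * gh e x - rmul (gh b) c
     - ksign (q + 1) (gh (tw A 1 b) (\<delta> c) + gh (d b) c + gh (tw A 1 b * e) x)"
  proof -
    have "hdiff (q + 1) g (cons b c) = f (cons b c)" using b by (simp add: solves_def c_def)
    then show ?thesis unfolding hdiff_g[OF c_def] by (rule sym)
  qed
  have D: "f (cons (d w) (cons b c)) = - d (gh (d w) (cons b c)) + ksign (q * i + i) (d w * gh b c)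
     - rmul (gh (d w)) (cons b c) + ksign (q + 1 + i) (gh (d w) (\<delta> (cons b c)) + gh (d w * b) c)"
    using dv hdiff_g[OF refl, of "d w" b c]
    by (cases "even q"; cases "even i")
       (simp_all add: solves_def w_def[symmetric] tdw tsdw gh_linear ksign_def ksign_mult)
  have "hdiff (q + 1) g (cons (w * b) c) = f (cons (w * b) c)"
    unfolding hdiff_g[OF c_def] L B D R tswb twb dwb \<delta>b
    by (cases "even q"; cases "even i")
       (simp_all add: ksign_def M gh_linear dD(5-7) dwb linD[OF gh_lin] algebra_simps)
  then show "hdiff (q + 1) g (cons (\<iota> v * b) (cons e x)) = f (cons (\<iota> v * b) (cons e x))"
    by (simp only: w_def c_def)
qed

lemma solves_subspace: "module.subspace (smul A) {a. solves a}"
proof -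
  note l = linD[OF HomD(1)[OF hdiff_Hom[OF g_Hom]]]
  have "solves 0" by (simp add: solves_def cons_linear l f_simps)
  moreover have "solves (a + b)" if "solves a" "solves b" for a b
    using that by (simp add: solves_def cons_linear l f_simps)
  moreover have "solves (smul A k a)" if "solves a" for k a
    using that by (simp add: solves_def cons_linear l f_simps)
  ultimately show ?thesis by (intro module.subspaceI[OF module]) auto
qed

text \<open>
  Induction on the level. The induction hypothesis provides the assumption of \<open>solves_mult\<close> for the letters
  of the words in \<open>d v\<close>.
\<close>

lemma solves_d_generator: "v \<in> F k i \<Longrightarrow> solves (d (\<iota> v))"
proof (induction k arbitrary: v i)
  case 0
  show ?case unfolding F0[OF 0] using module.subspace_0[OF module solves_subspace] by simp
next
  case (Suc k)
  show ?case
  proof (rule module.span_induct[OF module F_Suc[OF Suc.prems] solves_subspace])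
    fix a assume "a \<in> {prod_list (map \<iota> vs) | vs. set vs \<subseteq> (\<Union>j. F k j)}"
    then obtain vs where a: "a = prod_list (map \<iota> vs)" and vs: "set vs \<subseteq> (\<Union>j. F k j)" by blast
    show "solves a" unfolding a using vs
    proof (induction vs)
      case (Cons v vs)
      then obtain j where v: "v \<in> F k j" by auto
      show ?case using solves_mult[OF F_homog[OF v] _ Suc.IH[OF v]] Cons by simp
    qed (simp add: solves_1)
  qed
qed

lemma solves: "solves a"
proof (rule TA.word_spanning[OF solves_subspace])
  show "solves (prod_list (map \<iota> vs))" if "homog V is vs" for "is" vs
    using that
  proof (induction vs arbitrary: "is")
    case (Cons v vs)
    then obtain i js where *: "v \<in> gr V i" "homog V js vs" by (auto simp: TA.homog_Cons)
    then obtain k where "v \<in> F k i" using F_gr by blast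
    then show ?case using solves_mult[OF *(1) Cons.IH[OF *(2)] solves_d_generator] by simp
  qed (simp add: solves_1)
qed

end

context free_hochschild
begin

text \<open>
  If the differential of \<open>f\<close> lies in the image of \<open>\<Phi>\<close>, it vanishes on words of length at least 3. So there
  is \<open>g\<close> such that \<open>f\<close> minus the differential of \<open>g\<close> is concentrated in lengths 0 and 1, and \<open>\<Phi>_image\<close> applies.
\<close>

theorem injective_quasi_iso_\<Phi>: "injective_quasi_iso TD H \<Phi>"
proof (rule injective_quasi_isoI[OF is_dgl_TD is_dgl_H is_dgl_hom_\<Phi> \<Phi>_inj])
  fix n f assume "f \<in> lcar H n" and im: "ldiff H n f \<in> \<Phi> (n - 1) ` lcar TD (n - 1)"
  then have f: "f \<in> Hom (n - 1) C A" by (simp add: lcar_H)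
  obtain z where z: "z \<in> lcar TD (n - 1)" "hdiff (n - 1) f = \<Phi> (n - 1) z"
    using im by (auto simp: ldiff_H[OF f])
  have z0: "hdiff (n - 1) f (cons a (cons b x)) = 0" for a b x
    by (simp add: z(2) \<Phi>_cons[OF z(1)])
  interpret hochschild_cochain A C bar sc2 t cons V \<iota> F "n - 1" f
    by unfold_locales (fact f, rule z0)
  have g: "g \<in> Hom n C A" using g_Hom by simp
  have dg: "hdiff n g \<in> Hom (n - 1) C A" using hdiff_Hom[OF g] .
  have ldg: "ldiff H (n + 1) g = hdiff n g" using ldiff_H[of g "n + 1"] g by simp
  have ddg: "hdiff (n - 1) (hdiff n g) = 0"
  proof -
    have "g \<in> lcar H (n + 1)" using g by (simp add: lcar_H)
    from is_dglD(5)[OF is_dgl_H this] show ?thesis using ldiff_H[OF dg] by (simp add: ldg)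
  qed
  define f' where "f' = f - hdiff n g"
  have f'_H: "f' \<in> Hom (n - 1) C A" unfolding f'_def
    by (rule module.subspace_diff[OF module_pointwise[OF module] Hom_subspace f dg])
  have "f' \<in> \<Phi> n ` lcar TD n"
  proof (rule \<Phi>_image[OF f'_H])
    show "f' (cons a (cons b c)) = 0" for a b c
      using solves by (simp add: f'_def solves_def)
    have "hdiff (n - 1) f' = hdiff (n - 1) f - hdiff (n - 1) (hdiff n g)"
      using ldiff_diff[OF is_dgl_H, of f n "hdiff n g"] f dg f'_H
      by (simp add: lcar_H ldiff_H f'_def)
    then show "hdiff (n - 1) f' (cons a (cons b u)) = 0" for a b
      by (simp add: ddg z0)
  qed
  then show "\<exists>g' \<in> lcar H (n + 1). f - ldiff H (n + 1) g' \<in> \<Phi> n ` lcar TD n"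
    using g by (intro bexI[of _ g]) (simp_all add: lcar_H ldg f'_def)
qed

end


section \<open>The algebra on \<open>V \<oplus> \<k>\<epsilon>\<close>\<close>

lemma graded_module_add_eps:
  fixes V :: "('k::comm_ring_1, 'v::ab_group_add) gmod"
  assumes V: "graded_module V" shows "graded_module (add_eps V)"
proof -
  note m = graded_module_module[OF V] and sub = graded_module_subspace[OF V]
  obtain \<pi> where \<pi>: "(\<forall>p. module_hom (smul V) (smul V) (\<pi> p)) \<and>
    (\<forall>p q. \<forall>x\<in>gr V q. \<pi> p x = (if p = q then x else 0)) \<and> (\<forall>p x. \<pi> p x \<in> gr V p) \<and>
    (\<forall>x. \<exists>S. finite S \<and> (\<forall>S'. finite S' \<longrightarrow> S \<subseteq> S' \<longrightarrow> (\<Sum>p\<in>S'. \<pi> p x) = x))"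
    using graded_projections[OF V] ..
  have M: "module (smul (add_eps V))"
    unfolding add_eps_def gmod.select_convs by (rule module_times[OF m module_self])
  show ?thesis
  proof (rule graded_moduleI[where \<pi> = "\<lambda>p (v, r). (\<pi> p v, if p = - 1 then r else 0)"])
    show "module (smul (add_eps V))" by (rule M)
    show "module.subspace (smul (add_eps V)) (gr (add_eps V) i)" for i
      by (rule module.subspaceI[OF M])
         (auto simp: add_eps_def zero_prod_def module.subspace_0[OF m sub] module.subspace_add[OF m sub]
            module.subspace_scale[OF m sub] split: if_splits)
    show "module_hom (smul (add_eps V)) (smul (add_eps V)) (\<lambda>(v, r). (\<pi> p v, if p = - 1 then r else 0))" for p
    proof (rule module_homI[OF M M])
      have h: "module_hom (smul V) (smul V) (\<pi> p)" using \<pi> by simp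
      fix x y c
      show "(\<lambda>(v, r). (\<pi> p v, if p = - 1 then r else 0)) (x + y) =
          (\<lambda>(v, r). (\<pi> p v, if p = - 1 then r else 0)) x + (\<lambda>(v, r). (\<pi> p v, if p = - 1 then r else 0)) y"
        "(\<lambda>(v, r). (\<pi> p v, if p = - 1 then r else 0)) (smul (add_eps V) c x) =
          smul (add_eps V) c ((\<lambda>(v, r). (\<pi> p v, if p = - 1 then r else 0)) x)"
        by (cases x; cases y; simp add: add_eps_def module_hom.add[OF h] module_hom.scale[OF h])+
    qed
    show "(\<lambda>(v, r). (\<pi> p v, if p = - 1 then r else 0)) x = (if p = q then x else 0)"
      if "x \<in> gr (add_eps V) q" for p q x
      using that \<pi> by (auto simp: add_eps_def zero_prod_def split: if_splits)
    show "(\<lambda>(v, r). (\<pi> p v, if p = - 1 then r else 0)) x \<in> gr (add_eps V) p" for p x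
      using \<pi> by (auto simp: add_eps_def split: prod.splits)
    show "\<exists>S. finite S \<and> (\<forall>S'. finite S' \<longrightarrow> S \<subseteq> S' \<longrightarrow>
        (\<Sum>p\<in>S'. (\<lambda>(v, r). (\<pi> p v, if p = - 1 then r else 0)) x) = x)" for x
    proof -
      obtain v r where x: "x = (v, r)" by (cases x)
      have "\<exists>S. finite S \<and> (\<forall>S'. finite S' \<longrightarrow> S \<subseteq> S' \<longrightarrow> (\<Sum>p\<in>S'. \<pi> p v) = v)" using \<pi> by simp
      then obtain S where S: "finite S \<and> (\<forall>S'. finite S' \<longrightarrow> S \<subseteq> S' \<longrightarrow> (\<Sum>p\<in>S'. \<pi> p v) = v)" ..
      then show ?thesis
        by (intro exI[of _ "insert (- 1) S"]) (simp add: x prod_eq_iff fst_sum snd_sum)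
    qed
  qed
qed

locale tilde =
  TA: tensor_alg V A \<iota> + TB: tensor_alg "add_eps V" B \<iota>'
  for V :: "('k::comm_ring_1, 'v::ab_group_add) gmod"
    and A :: "('k, 'a::ring_1) dga" and \<iota> :: "'v \<Rightarrow> 'a"
    and B :: "('k, 'b::ring_1) gmod" and \<iota>' :: "'v \<times> 'k \<Rightarrow> 'b" +
  assumes dga: "is_dga A"
begin

abbreviation "d \<equiv> diff A"

lemmas dD = TA.DerD[OF is_dgaD(1)[OF dga]]
lemmas dd [simp] = is_dgaD(2)[OF dga]

lemma add_eps_simps [simp]:
  "smul (add_eps V) c (v, r) = (smul V c v, c * r)"
  "(v, r) \<in> gr (add_eps V) i \<longleftrightarrow> v \<in> gr V i \<and> (i = - 1 \<or> r = 0)"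
  by (auto simp: add_eps_def)

definition eps :: 'b ("\<epsilon>") where "\<epsilon> = \<iota>' (0, 1)"

definition gen :: "'v \<Rightarrow> 'b" where "gen v = \<iota>' (v, 0)"

lemma gen'_split: "\<iota>' (v, r) = gen v + smul B r \<epsilon>"
proof -
  have "\<iota>' (v, r) = \<iota>' ((v, 0) + smul (add_eps V) r (0, 1))"
    by (simp add: module.scale_zero_right[OF TA.module_V])
  then show ?thesis
    by (simp only: module_hom.add[OF TB.gen_hom] module_hom.scale[OF TB.gen_hom] gen_def eps_def)
qed

lemma gen_hom: "module_hom (smul V) (smul B) gen"
proof (rule module_homI[OF TA.module_V TB.module])
  fix v v' c
  show "gen (v + v') = gen v + gen v'"
    using module_hom.add[OF TB.gen_hom, of "(v, 0)" "(v', 0)"] by (simp add: gen_def)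
  show "gen (smul V c v) = smul B c (gen v)"
    using module_hom.scale[OF TB.gen_hom, of c "(v, 0)"] by (simp add: gen_def)
qed

lemma gen_simps: "gen (v + v') = gen v + gen v'" "gen (smul V c v) = smul B c (gen v)"
  "gen (- v) = - gen v" "gen (ksign n v) = ksign n (gen v)" "gen 0 = 0"
  using module_hom.add[OF gen_hom] module_hom.scale[OF gen_hom] module_hom.neg[OF gen_hom]
    ksign_hom[OF gen_hom] module_hom.zero[OF gen_hom] by auto

lemma gen_gr: "v \<in> gr V i \<Longrightarrow> gen v \<in> gr B i"
  unfolding gen_def by (rule TB.gen_gr) simp

lemma eps_gr: "\<epsilon> \<in> gr B (- 1)"
  unfolding eps_def by (rule TB.gen_gr) (simp add: module.subspace_0[OF TA.module_V graded_module_subspace[OF TA.graded_V]])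

lemma tw_eps: "tw B n \<epsilon> = ksign n \<epsilon>"
  using tw_gr[OF TB.graded eps_gr, of n] by (simp add: ksign_def)

lemma tw_gen: "tw B n (gen v) = gen (tw V n v)"
  by (rule graded_hom_eq[OF TA.graded_V module_hom_comp[OF tw_hom[OF TB.graded] gen_hom]
        module_hom_comp[OF gen_hom tw_hom[OF TA.graded_V]]])
     (simp add: tw_gr[OF TB.graded gen_gr] tw_gr[OF TA.graded_V] gen_simps)

lemma smulB_rules: "smul B c 0 = 0" "smul B 0 x = 0" "smul B 1 x = x" "smul B c (- x) = - smul B c x"
  "smul B c (x + y) = smul B c x + smul B c y" "smul B c (x - y) = smul B c x - smul B c y"
  "smul B (b + c) x = smul B b x + smul B c x" "smul B b (smul B c x) = smul B (b * c) x"
  "smul B (- c) x = - smul B c x" "smul B c (ksign n x) = ksign n (smul B c x)"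
  using module.scale_zero_right[OF TB.module] module.scale_zero_left[OF TB.module]
    module.scale_one[OF TB.module] module.scale_minus_right[OF TB.module]
    module.scale_minus_left[OF TB.module] ksign_scale[OF TB.module]
    module.scale_right_distrib[OF TB.module] module.scale_right_diff_distrib[OF TB.module]
    module.scale_left_distrib[OF TB.module] module.scale_scale[OF TB.module] by auto

lemma smulA_rules: "smul A c 0 = 0" "smul A 0 x = 0" "smul A 1 x = x"
  "smul A c (x + y) = smul A c x + smul A c y" "smul A b (smul A c x) = smul A (b * c) x"
  using module.scale_zero_right[OF TA.module] module.scale_zero_left[OF TA.module]
    module.scale_one[OF TA.module] module.scale_right_distrib[OF TA.module]
    module.scale_scale[OF TA.module] by auto

lemma B_induct [case_names one gen eps add scale]:
  assumes "P 1" "\<And>v x. P x \<Longrightarrow> P (gen v * x)" "\<And>x. P x \<Longrightarrow> P (\<epsilon> * x)"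
    and "\<And>x y. P x \<Longrightarrow> P y \<Longrightarrow> P (x + y)" "\<And>c x. P x \<Longrightarrow> P (smul B c x)"
  shows "P x"
proof (induction x rule: TB.cons_induct)
  case (cons w x)
  obtain v r where "w = (v, r)" by (cases w)
  then show ?case using assms(2-5) cons by (simp add: gen'_split distrib_right TB.smul_mult)
qed (use assms in auto)

text \<open>The inclusion of \<open>A\<close> and the retraction of \<open>B\<close> onto \<open>A\<close> that sends \<open>\<epsilon>\<close> to 0.\<close>

definition j :: "'a \<Rightarrow> 'b" where "j = TA.tfold (smul B) 1 (\<lambda>v x y. gen v * y)"

definition \<rho> :: "'b \<Rightarrow> 'a" where "\<rho> = TB.tfold (smul A) 1 (\<lambda>w x y. \<iota> (fst w) * y)"

lemma j_hom: "module_hom (smul A) (smul B) j" and j_1 [simp]: "j 1 = 1"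
  and j_cons: "j (\<iota> v * x) = gen v * j x"
proof -
  have "TA.rec_step (smul B) (\<lambda>v x y. gen v * y)"
    by (simp add: TA.rec_step_def TB.module gen_simps distrib_right distrib_left TB.smul_mult)
  from TA.tfold[OF this, of 1] show "module_hom (smul A) (smul B) j" "j 1 = 1"
    "j (\<iota> v * x) = gen v * j x" unfolding j_def by auto
qed

lemma j_simps: "j (x + y) = j x + j y" "j (x - y) = j x - j y" "j (- x) = - j x" "j 0 = 0"
  "j (smul A c x) = smul B c (j x)" "j (ksign n x) = ksign n (j x)"
  using module_hom.add[OF j_hom] module_hom.diff[OF j_hom] module_hom.neg[OF j_hom]
    module_hom.zero[OF j_hom] module_hom.scale[OF j_hom] ksign_hom[OF j_hom] by auto

lemma j_gen: "j (\<iota> v) = gen v"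
  using j_cons[of v 1] by simp

lemma j_mult: "j (x * y) = j x * j y"
proof (induction x rule: TA.cons_induct)
  case (cons v x)
  then show ?case by (simp add: mult.assoc j_cons)
qed (simp_all add: distrib_right j_simps TB.smul_mult TA.smul_mult)

lemma j_Hom: "j \<in> Hom 0 A B"
proof (rule TA.HomI_rec[OF j_hom TB.subspace_gr])
  show "j (TA.word []) \<in> gr B 0" by (simp add: TB.one_gr)
  show "j (\<iota> v * x) \<in> gr B (i + p + 0)" if "v \<in> gr V i" "x \<in> gr A p" "j x \<in> gr B (p + 0)" for i p v x
    using TB.mult_gr[OF gen_gr[OF that(1)] that(3)] by (simp add: j_cons)
qed

lemma j_tw: "tw B n (j x) = j (tw A n x)"
  using Hom_tw[OF TA.graded TB.graded j_Hom, of n x] by simp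

lemma \<rho>_hom: "module_hom (smul B) (smul A) \<rho>" and \<rho>_1 [simp]: "\<rho> 1 = 1"
  and \<rho>_gen: "\<rho> (gen v * x) = \<iota> v * \<rho> x" and \<rho>_eps: "\<rho> (\<epsilon> * x) = 0"
proof -
  have i: "\<iota> (v + v') = \<iota> v + \<iota> v'" "\<iota> (smul V c v) = smul A c (\<iota> v)" "\<iota> 0 = 0" for v v' c
    using module_hom.add[OF TA.gen_hom] module_hom.scale[OF TA.gen_hom] module_hom.zero[OF TA.gen_hom] by auto
  have "TB.rec_step (smul A) (\<lambda>w x y. \<iota> (fst w) * y)"
    by (simp add: TB.rec_step_def TA.module i distrib_right distrib_left TA.smul_mult split_paired_All)
  note f = TB.tfold[OF this, of 1, folded \<rho>_def]
  show "module_hom (smul B) (smul A) \<rho>" "\<rho> 1 = 1" using f(1,2) by auto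
  show "\<rho> (gen v * x) = \<iota> v * \<rho> x" "\<rho> (\<epsilon> * x) = 0"
    using f(3)[of "(v, 0)" x] f(3)[of "(0, 1)" x] by (simp_all add: gen_def eps_def i)
qed

lemma \<rho>_simps: "\<rho> (x + y) = \<rho> x + \<rho> y" "\<rho> (x - y) = \<rho> x - \<rho> y" "\<rho> (- x) = - \<rho> x" "\<rho> 0 = 0"
  "\<rho> (smul B c x) = smul A c (\<rho> x)" "\<rho> (ksign n x) = ksign n (\<rho> x)"
  using module_hom.add[OF \<rho>_hom] module_hom.diff[OF \<rho>_hom] module_hom.neg[OF \<rho>_hom]
    module_hom.zero[OF \<rho>_hom] module_hom.scale[OF \<rho>_hom] ksign_hom[OF \<rho>_hom] by auto

lemma \<rho>_mult: "\<rho> (x * y) = \<rho> x * \<rho> y"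
proof (induction x rule: B_induct)
  case (gen v x)
  then show ?case by (simp add: mult.assoc \<rho>_gen)
qed (simp_all add: mult.assoc \<rho>_eps distrib_right \<rho>_simps TB.smul_mult TA.smul_mult)

lemma \<rho>_j [simp]: "\<rho> (j x) = x"
proof (induction x rule: TA.cons_induct)
  case (cons v x)
  then show ?case by (simp add: j_cons \<rho>_gen)
qed (simp_all add: j_simps \<rho>_simps)

lemma \<rho>_Hom: "\<rho> \<in> Hom 0 B A"
proof (rule TB.HomI_rec[OF \<rho>_hom TA.subspace_gr])
  show "\<rho> (TB.word []) \<in> gr A 0" by (simp add: TA.one_gr)
  fix i p w x assume *: "w \<in> gr (add_eps V) i" "\<rho> x \<in> gr A (p + 0)"
  obtain v r where w: "w = (v, r)" by (cases w)
  have "v \<in> gr V i" using * w by simp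
  from TA.mult_gr[OF TA.gen_gr[OF this] *(2)] show "\<rho> (\<iota>' w * x) \<in> gr A (i + p + 0)"
    by (simp add: w gen'_split distrib_right \<rho>_simps \<rho>_gen TB.smul_mult \<rho>_eps smulA_rules)
qed

lemma tensor_incl_eq: "tensor_incl A \<iota> B \<iota>' = j"
  unfolding tensor_incl_def
proof (rule the_equality)
  have w: "j (TA.word vs) = prod_list (map (\<lambda>v. \<iota>' (v, 0)) vs)" for vs
    by (induction vs) (simp_all add: j_cons gen_def)
  then show "module_hom (smul A) (smul B) j \<and> (\<forall>vs. j (TA.word vs) = prod_list (map (\<lambda>v. \<iota>' (v, 0)) vs))"
    using j_hom by simp
  fix k assume k: "module_hom (smul A) (smul B) k \<and> (\<forall>vs. k (TA.word vs) = prod_list (map (\<lambda>v. \<iota>' (v, 0)) vs))"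
  show "k = j"
  proof
    show "k x = j x" for x
      by (rule presented_hom_eq[OF TA.presented conjunct1[OF k] j_hom]) (simp add: k w)
  qed
qed

definition ext :: "int \<Rightarrow> ('v \<Rightarrow> 'b) \<Rightarrow> 'b \<Rightarrow> 'b \<Rightarrow> 'b" where
  "ext n \<alpha> \<beta> = TB.der n (\<lambda>w. \<alpha> (fst w) + smul B (snd w) \<beta>)"

lemma ext:
  assumes \<alpha>: "module_hom (smul V) (smul B) \<alpha>" "\<And>i v. v \<in> gr V i \<Longrightarrow> \<alpha> v \<in> gr B (i + n)"
    and \<beta>: "\<beta> \<in> gr B (n - 1)"
  shows ext_Der: "ext n \<alpha> \<beta> \<in> Der n B" and ext_gen: "ext n \<alpha> \<beta> (gen v) = \<alpha> v"
    and ext_eps: "ext n \<alpha> \<beta> \<epsilon> = \<beta>"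
proof -
  have 1: "module_hom (smul (add_eps V)) (smul B) (\<lambda>w. \<alpha> (fst w) + smul B (snd w) \<beta>)"
    by (rule module_homI[OF TB.module_V TB.module])
       (auto simp: add_eps_def module_hom.add[OF \<alpha>(1)] module_hom.scale[OF \<alpha>(1)] smulB_rules)
  have 2: "\<alpha> (fst w) + smul B (snd w) \<beta> \<in> gr B (i + n)" if "w \<in> gr (add_eps V) i" for i w
  proof -
    obtain v r where w: "w = (v, r)" by (cases w)
    have "smul B r \<beta> \<in> gr B (i + n)"
    proof (cases "i = - 1")
      case True then show ?thesis using TB.gr_scale[OF \<beta>, of r] by simp
    next
      case False then show ?thesis using that w by (simp add: smulB_rules TB.gr_zero)
    qed
    then show ?thesis using \<alpha>(2)[of v i] that by (simp add: w TB.gr_add)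
  qed
  show "ext n \<alpha> \<beta> \<in> Der n B" unfolding ext_def by (rule TB.der_Der[OF 1 2])
  have dg: "TB.der n (\<lambda>w. \<alpha> (fst w) + smul B (snd w) \<beta>) (\<iota>' w) = \<alpha> (fst w) + smul B (snd w) \<beta>" for w
    by (rule TB.der_gen[OF 1 2])
  show "ext n \<alpha> \<beta> (gen v) = \<alpha> v" "ext n \<alpha> \<beta> \<epsilon> = \<beta>"
    unfolding ext_def gen_def eps_def dg using module_hom.zero[OF \<alpha>(1)] by (simp_all add: smulB_rules)
qed

lemma B_Der_unique:
  assumes "X \<in> Der n B" "Y \<in> Der n B" and g: "\<And>v i. v \<in> gr V i \<Longrightarrow> X (gen v) = Y (gen v)" and e: "X \<epsilon> = Y \<epsilon>"
  shows "X = Y"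
proof (rule TB.Der_unique[OF assms(1,2)])
  fix w i assume w: "w \<in> gr (add_eps V) i"
  obtain v r where vr: "w = (v, r)" by (cases w)
  have "v \<in> gr V i" using w by (simp add: vr)
  from g[OF this] show "X (\<iota>' w) = Y (\<iota>' w)"
    by (simp add: vr gen'_split TB.DerD(5,9)[OF assms(1)] TB.DerD(5,9)[OF assms(2)] e)
qed

definition dt :: "'b \<Rightarrow> 'b" where
  "dt = ext (- 1) (\<lambda>v. j (d (\<iota> v)) + \<epsilon> * gen v - tw B 1 (gen v) * \<epsilon>) (\<epsilon> * \<epsilon>)"

lemma dt_Der: "dt \<in> Der (- 1) B" and dt_gen: "dt (gen v) = j (d (\<iota> v)) + \<epsilon> * gen v - tw B 1 (gen v) * \<epsilon>"
  and dt_eps: "dt \<epsilon> = \<epsilon> * \<epsilon>"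
proof -
  have 1: "module_hom (smul V) (smul B) (\<lambda>v. j (d (\<iota> v)) + \<epsilon> * gen v - tw B 1 (gen v) * \<epsilon>)"
    by (rule module_hom_plus(2)[OF module_hom_plus(1)[OF module_hom_comp[OF j_hom module_hom_comp[OF dD(2) TA.gen_hom]]
         module_hom_comp[OF TB.mult_hom(1) gen_hom]] module_hom_comp[OF TB.mult_hom(2) module_hom_comp[OF tw_hom[OF TB.graded] gen_hom]]])
  have 2: "j (d (\<iota> v)) + \<epsilon> * gen v - tw B 1 (gen v) * \<epsilon> \<in> gr B (i + - 1)" if "v \<in> gr V i" for v i
    using HomD(2)[OF j_Hom dD(3)[OF TA.gen_gr[OF that]]] TB.mult_gr[OF eps_gr gen_gr[OF that]]
      TB.mult_gr[OF tw_in_gr[OF TB.graded gen_gr[OF that]] eps_gr]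
    by (intro TB.gr_diff TB.gr_add) simp_all
  have 3: "\<epsilon> * \<epsilon> \<in> gr B (- 1 - 1)" using TB.mult_gr[OF eps_gr eps_gr] by simp
  show "dt \<in> Der (- 1) B" unfolding dt_def by (rule ext_Der[OF 1 2 3])
  show "dt (gen v) = j (d (\<iota> v)) + \<epsilon> * gen v - tw B 1 (gen v) * \<epsilon>"
    unfolding dt_def by (rule ext_gen[OF 1 2 3])
  show "dt \<epsilon> = \<epsilon> * \<epsilon>" unfolding dt_def by (rule ext_eps[OF 1 2 3])
qed

lemmas dtD = TB.DerD[OF dt_Der]

lemma tilde_diff_eq: "tilde_diff V A \<iota> B \<iota>' = dt"
  unfolding tilde_diff_def tensor_incl_eq gen_def[symmetric] eps_def[symmetric]
proof (rule the_equality)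
  have t: "tw B 1 (gen v) * \<epsilon> = ksign i (gen v * \<epsilon>)" if "v \<in> gr V i" for v i
    using tw_gr[OF TB.graded gen_gr[OF that], of 1] by (simp add: ksign_mult)
  then show "dt \<in> Der (- 1) B \<and> dt \<epsilon> = \<epsilon> * \<epsilon> \<and> (\<forall>i. \<forall>v\<in>gr V i. dt (gen v) =
      j (d (\<iota> v)) + \<epsilon> * gen v - ksign i (gen v * \<epsilon>))"
    by (simp add: dt_Der dt_eps dt_gen)
  fix X assume X: "X \<in> Der (- 1) B \<and> X \<epsilon> = \<epsilon> * \<epsilon> \<and> (\<forall>i. \<forall>v\<in>gr V i. X (gen v) =
      j (d (\<iota> v)) + \<epsilon> * gen v - ksign i (gen v * \<epsilon>))"
  show "X = dt"
    by (rule B_Der_unique[OF conjunct1[OF X] dt_Der]) (use X t in \<open>simp_all add: dt_eps dt_gen\<close>)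
qed

text \<open>
  On \<open>A\<close> the new differential is \<open>d + [\<epsilon>, -]\<close>. It is convenient to subtract the inner derivation:
  \<open>dp = dt - [\<epsilon>, -]\<close> extends \<open>d\<close> and sends \<open>\<epsilon>\<close> to \<open>-\<epsilon>\<^sup>2\<close>.
\<close>

definition dp :: "'b \<Rightarrow> 'b" where "dp x = dt x - (\<epsilon> * x - tw B 1 x * \<epsilon>)"

lemma tw_m1: "tw B (- 1) x = tw B 1 x"
  by (rule tw_parity[OF TB.graded]) simp

lemma dp_Der: "dp \<in> Der (- 1) B"
proof -
  have "(\<lambda>x. \<epsilon> * x - tw B 1 x * \<epsilon>) \<in> Der (- 1) B"
    using TB.inner_derivation[OF eps_gr] by (simp add: tw_m1)
  from module.subspace_diff[OF module_pointwise[OF TB.module] TB.Der_subspace dt_Der this]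
  show ?thesis by (simp add: dp_def[abs_def] fun_diff_def)
qed

lemmas dpD = TB.DerD[OF dp_Der]

lemma dp_gen: "dp (gen v) = j (d (\<iota> v))"
  by (simp add: dp_def dt_gen)

lemma dp_eps: "dp \<epsilon> = - (\<epsilon> * \<epsilon>)"
  by (simp add: dp_def dt_eps tw_eps ksign_def)

lemma dp_j: "dp (j a) = j (d a)"
proof (induction a rule: TA.cons_induct)
  case (cons v x)
  have "tw A (- 1) (\<iota> v) = \<iota> (tw V (- 1) v)" by (rule TA.tw_gen)
  then show ?case using cons
    by (simp add: dpD(4) dp_gen dD(4) j_simps j_mult j_gen tw_gen)
qed (simp_all add: dpD dD j_simps)

lemma dt_j: "dt (j a) = j (d a) + \<epsilon> * j a - tw B 1 (j a) * \<epsilon>"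
  using dp_j[of a] by (simp add: dp_def algebra_simps)

text \<open>
  The square of \<open>dt\<close> is a derivation, so it suffices to check the generators.
\<close>

lemma dt_dt [simp]: "dt (dt x) = 0"
proof -
  have "(\<lambda>x. dt (dt x)) = (\<lambda>x. 0)"
  proof (rule B_Der_unique[OF TB.Der_square[OF dt_Der]])
    show "(\<lambda>x. 0) \<in> Der (- 1 + - 1) B"
      using module.subspace_0[OF module_pointwise[OF TB.module] TB.Der_subspace] by (simp add: zero_fun_def)
    show "dt (dt \<epsilon>) = 0" by (simp add: dt_eps dtD(4) tw_eps ksign_def mult.assoc)
    fix v i assume v: "v \<in> gr V i"
    have "tw B 1 (j (d (\<iota> v))) = - ksign i (j (d (\<iota> v)))"
      using tw_gr[OF TB.graded HomD(2)[OF j_Hom dD(3)[OF TA.gen_gr[OF v]]], of 1] by (simp add: ksign_def)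
    moreover have "tw B 1 (gen v) = ksign i (gen v)" using tw_gr[OF TB.graded gen_gr[OF v], of 1] by simp
    ultimately show "dt (dt (gen v)) = 0"
      by (cases "even i")
         (simp_all add: dt_gen dtD(4-7) dt_j dt_eps tw_eps tw_m1 ksign_def j_simps algebra_simps)
  qed simp
  then show ?thesis by (rule fun_cong)
qed

abbreviation "BD \<equiv> tilde_dga V A \<iota> B \<iota>'"

lemma BD_simps [simp]: "smul BD = smul B" "gr BD = gr B" "diff BD = dt"
  by (simp_all add: tilde_dga_def tilde_diff_eq)

lemma Hom_BD [simp]: "Hom n BD BD = Hom n B B" and Der_BD [simp]: "Der n BD = Der n B"
  by (simp_all add: Hom_def Der_def)

theorem is_dga_BD: "is_dga BD"
  using TB.graded TB.algebra_scale TB.one_gr TB.mult_gr dt_Der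
  by (simp add: is_dga_def graded_module_def)


section \<open>Contracting the ideal generated by \<open>\<epsilon>\<close>\<close>

abbreviation "\<eta> \<equiv> TA.counit"

text \<open>
  The ideal generated by \<open>\<epsilon>\<close> is spanned by the words \<open>a\<^sub>0 \<epsilon> a\<^sub>1 \<epsilon> \<dots> \<epsilon> a\<^sub>n\<close> with \<open>a\<^sub>i \<in> A\<close>. The summand of
  \<open>dp\<close> that raises \<open>n\<close> replaces \<open>\<epsilon>\<close> by \<open>\<epsilon> 1 \<epsilon>\<close>. So it inserts 1 into \<open>a\<^sub>1, \<dots>, a\<^bsub>n-1\<^esub>\<close> at all positions,
  as in the Amitsur complex of \<open>\<k> \<rightarrow> A\<close>. It would be contracted by applying
  the augmentation \<open>\<eta>\<close> to \<open>a\<^sub>1\<close>. As \<open>\<eta>\<close> need not commute with \<open>d\<close>, this is corrected to \<open>\<Sum>\<^sub>k \<plusminus> \<eta>(d a\<^sub>1) \<dots> \<eta>(d a\<^bsub>k-1\<^esub>) \<eta>(a\<^sub>k) a\<^sub>0 \<epsilon> a\<^bsub>k+1\<^esub> \<epsilon> \<dots> \<epsilon> a\<^sub>n\<close>. The recursion computes this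
  together with two auxiliary maps: \<open>G\<close> treats the word after the first \<open>\<epsilon>\<close>, and \<open>G0\<close> is used inside \<open>G\<close>
  once \<open>d\<close> has been applied to a letter of \<open>a\<^sub>1\<close>.
\<close>

definition scale3 :: "'k \<Rightarrow> 'b \<times> 'b \<times> 'b \<Rightarrow> 'b \<times> 'b \<times> 'b" where
  "scale3 c = (\<lambda>(x, y). (smul B c x, (\<lambda>(x, y). (smul B c x, smul B c y)) y))"

definition hGG :: "'b \<Rightarrow> 'b \<times> 'b \<times> 'b" where
  "hGG = TB.tfold scale3 0 (\<lambda>w x y.
     (tw B 1 (gen (fst w)) * fst y + smul B (snd w) (fst (snd y)),
      - smul B (\<eta> (d (\<iota> (fst w)))) (snd (snd y)) - smul B (snd w) (\<epsilon> * x),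
      smul B (snd w) (fst (snd y))))"

definition h :: "'b \<Rightarrow> 'b" where "h x = fst (hGG x)"

definition G :: "'b \<Rightarrow> 'b" where "G x = fst (snd (hGG x))"

definition G0 :: "'b \<Rightarrow> 'b" where "G0 x = snd (snd (hGG x))"

lemma \<eta>_simps: "\<eta> (x + y) = \<eta> x + \<eta> y" "\<eta> (- x) = - \<eta> x" "\<eta> (smul A c x) = c * \<eta> x" "\<eta> 0 = 0"
  using module_hom.add[OF TA.counit_hom] module_hom.neg[OF TA.counit_hom]
    module_hom.scale[OF TA.counit_hom] module_hom.zero[OF TA.counit_hom] by auto

lemma \<iota>_simps: "\<iota> (v + v') = \<iota> v + \<iota> v'" "\<iota> (smul V c v) = smul A c (\<iota> v)" "\<iota> 0 = 0"
  using module_hom.add[OF TA.gen_hom] module_hom.scale[OF TA.gen_hom] module_hom.zero[OF TA.gen_hom] by auto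

lemma module_scale3: "module scale3"
  unfolding scale3_def[abs_def] by (rule module_times[OF TB.module module_times[OF TB.module TB.module]])

lemma
  shows hGG_hom: "module_hom (smul B) scale3 hGG" and hGG_1: "hGG 1 = 0"
    and hGG_cons: "hGG (\<iota>' w * x) = (tw B 1 (gen (fst w)) * h x + smul B (snd w) (G x),
      - smul B (\<eta> (d (\<iota> (fst w)))) (G0 x) - smul B (snd w) (\<epsilon> * x), smul B (snd w) (G x))"
proof -
  have "TB.rec_step scale3 (\<lambda>w x y.
     (tw B 1 (gen (fst w)) * fst y + smul B (snd w) (fst (snd y)),
      - smul B (\<eta> (d (\<iota> (fst w)))) (snd (snd y)) - smul B (snd w) (\<epsilon> * x),
      smul B (snd w) (fst (snd y))))"
    unfolding TB.rec_step_def
    by (simp add: module_scale3 split_paired_All)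
       (simp add: scale3_def gen_simps TB.tw_linear distrib_right distrib_left TB.smul_mult smulB_rules
          \<iota>_simps dD \<eta>_simps mult.commute algebra_simps)
  from TB.tfold[OF this, of 0, folded hGG_def]
  show "module_hom (smul B) scale3 hGG" "hGG 1 = 0"
    "hGG (\<iota>' w * x) = (tw B 1 (gen (fst w)) * h x + smul B (snd w) (G x),
      - smul B (\<eta> (d (\<iota> (fst w)))) (G0 x) - smul B (snd w) (\<epsilon> * x), smul B (snd w) (G x))"
    by (auto simp: h_def G_def G0_def)
qed

lemma h_hom: "module_hom (smul B) (smul B) h" and G_hom: "module_hom (smul B) (smul B) G"
  and G0_hom: "module_hom (smul B) (smul B) G0"
  by (rule module_homI[OF TB.module TB.module];
      simp add: h_def G_def G0_def module_hom.add[OF hGG_hom] module_hom.scale[OF hGG_hom] scale3_def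
        case_prod_beta)+

lemma hG_simps:
  "h (x + y) = h x + h y" "h (- x) = - h x" "h (x - y) = h x - h y" "h 0 = 0" "h (smul B c x) = smul B c (h x)"
  "h (ksign n x) = ksign n (h x)"
  "G (x + y) = G x + G y" "G (- x) = - G x" "G (x - y) = G x - G y" "G 0 = 0" "G (smul B c x) = smul B c (G x)"
  "G0 (x + y) = G0 x + G0 y" "G0 (- x) = - G0 x" "G0 (x - y) = G0 x - G0 y" "G0 0 = 0"
  "G0 (smul B c x) = smul B c (G0 x)"
  using module_hom.add[OF h_hom] module_hom.neg[OF h_hom] module_hom.diff[OF h_hom] module_hom.zero[OF h_hom]
    module_hom.scale[OF h_hom] ksign_hom[OF h_hom]
    module_hom.add[OF G_hom] module_hom.neg[OF G_hom] module_hom.diff[OF G_hom] module_hom.zero[OF G_hom]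
    module_hom.scale[OF G_hom]
    module_hom.add[OF G0_hom] module_hom.neg[OF G0_hom] module_hom.diff[OF G0_hom] module_hom.zero[OF G0_hom]
    module_hom.scale[OF G0_hom] by auto

lemma hG_rec [simp]:
  "h 1 = 0" "G 1 = 0" "G0 1 = 0"
  "h (gen v * x) = tw B 1 (gen v) * h x" "h (\<epsilon> * x) = G x"
  "G (gen v * x) = - smul B (\<eta> (d (\<iota> v))) (G0 x)" "G (\<epsilon> * x) = - (\<epsilon> * x)"
  "G0 (gen v * x) = 0" "G0 (\<epsilon> * x) = G x"
  using hGG_1 hGG_cons[of "(v, 0)" x, folded gen_def] hGG_cons[of "(0, 1)" x, folded eps_def]
  by (auto simp: h_def G_def G0_def smulB_rules gen_simps TB.tw_linear \<iota>_simps dD \<eta>_simps)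

lemma h_Hom: "h \<in> Hom 1 B B"
proof -
  define N :: "('k, 'b \<times> 'b \<times> 'b) gmod" where
    "N = \<lparr>smul = scale3, gr = (\<lambda>i. gr B (i + 1) \<times> gr B i \<times> gr B (i + 1))\<rparr>"
  have N: "smul N = scale3" "gr N i = gr B (i + 1) \<times> gr B i \<times> gr B (i + 1)" for i by (simp_all add: N_def)
  have "hGG \<in> Hom 0 B N"
  proof (rule TB.HomI_rec)
    show "module_hom (smul B) (smul N) hGG" unfolding N by (rule hGG_hom)
    show "module.subspace (smul N) (gr N i)" for i unfolding N
      by (rule module.subspaceI[OF module_scale3])
         (auto simp: scale3_def zero_prod_def TB.gr_zero TB.gr_add TB.gr_scale)
    show "hGG (TB.word []) \<in> gr N 0" by (simp add: hGG_1 N zero_prod_def TB.gr_zero)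
    fix i p w x assume w: "w \<in> gr (add_eps V) i" and x: "x \<in> gr B p" and y: "hGG x \<in> gr N (p + 0)"
    obtain v r where vr: "w = (v, r)" by (cases w)
    have v: "v \<in> gr V i" and r: "i = - 1 \<or> r = 0" using w by (auto simp: vr)
    have y': "h x \<in> gr B (p + 1)" "G x \<in> gr B p" "G0 x \<in> gr B (p + 1)"
      using y by (auto simp: N h_def G_def G0_def mem_Times_iff)
    have 1: "smul B r (G x) \<in> gr B (i + p + 1)" using r
      by (elim disjE) (simp_all add: TB.gr_scale y' smulB_rules TB.gr_zero)
    have 2: "smul B r (\<epsilon> * x) \<in> gr B (i + p)" using r TB.mult_gr[OF eps_gr x]
      by (elim disjE) (simp_all add: TB.gr_scale smulB_rules TB.gr_zero)
    have 3: "smul B (\<eta> (d (\<iota> v))) (G0 x) \<in> gr B (i + p)"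
    proof (cases "i = 1")
      case True
      then show ?thesis using y'(3) by (simp add: TB.gr_scale add.commute)
    next
      case False
      then show ?thesis using TA.counit_gr[OF dD(3)[OF TA.gen_gr[OF v]]]
        by (simp add: smulB_rules TB.gr_zero)
    qed
    have 4: "tw B 1 (gen v) * h x \<in> gr B (i + p + 1)"
      using TB.mult_gr[OF tw_in_gr[OF TB.graded gen_gr[OF v]] y'(1)] by (simp add: add.assoc)
    show "hGG (\<iota>' w * x) \<in> gr N (i + p + 0)"
      using 1 2 3 4 by (simp add: hGG_cons N vr TB.gr_add TB.gr_diff TB.gr_neg)
  qed
  from HomD(2)[OF this] show ?thesis
    by (intro HomI[OF h_hom]) (auto simp: h_def N mem_Times_iff)
qed

lemma hG_left:
  "h (j a * x) = tw B 1 (j a) * h x" "G0 (j a * x) = smul B (\<eta> a) (G0 x)"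
  "G (j a * x) = smul B (\<eta> a) (G x) - smul B (\<eta> (d a)) (G0 x)"
proof -
  show "h (j a * x) = tw B 1 (j a) * h x"
  proof (induction a rule: TA.cons_induct)
    case (cons v a) then show ?case by (simp add: j_cons mult.assoc TB.tw_mult)
  qed (simp_all add: j_simps distrib_right hG_simps TB.tw_linear TB.smul_mult)
  show G0: "G0 (j a * x) = smul B (\<eta> a) (G0 x)" for a
  proof (induction a rule: TA.cons_induct)
    case (cons v a) then show ?case by (simp add: j_cons mult.assoc smulB_rules)
  qed (simp_all add: j_simps distrib_right hG_simps TB.smul_mult \<eta>_simps smulB_rules)
  show "G (j a * x) = smul B (\<eta> a) (G x) - smul B (\<eta> (d a)) (G0 x)"
  proof (induction a rule: TA.cons_induct)
    case (cons v a)
    have "\<eta> (d (\<iota> v * a)) = \<eta> (d (\<iota> v)) * \<eta> a"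
      by (simp add: dD(4) \<eta>_simps TA.counit_mult TA.tw_gen TA.counit_gen[of _ 1, simplified])
    then show ?case by (simp add: j_cons mult.assoc G0 smulB_rules)
  next
    case (scale c a)
    then show ?case by (simp add: j_simps TB.smul_mult hG_simps \<eta>_simps dD smulB_rules)
  qed (simp_all add: j_simps distrib_right hG_simps \<eta>_simps smulB_rules dD)
qed

lemma hG_j: "h (j a) = 0" "G (j a) = 0" "G0 (j a) = 0"
  using hG_left[of a 1] by (simp_all add: smulB_rules)

lemma h_right: "h (x * j a) = h x * j a"
proof -
  have "h (x * j a) = h x * j a \<and> G (x * j a) = G x * j a \<and> G0 (x * j a) = G0 x * j a"
  proof (induction x rule: B_induct)
    case one show ?case by (simp add: hG_j)
  qed (simp_all add: distrib_right hG_simps TB.smul_mult mult.assoc)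
  then show ?thesis by simp
qed

lemma dp_cons:
  "dp (gen v * x) = j (d (\<iota> v)) * x + tw B 1 (gen v) * dp x"
  "dp (\<epsilon> * x) = - (\<epsilon> * (\<epsilon> * x)) - \<epsilon> * dp x"
  by (simp_all add: dpD(4) dp_gen dp_eps tw_m1 tw_eps mult.assoc) (simp add: ksign_def)

lemma \<eta>_d_tw: "\<eta> (d (\<iota> (tw V 1 v))) = - \<eta> (d (\<iota> v))"
proof -
  have "d (tw A 1 (\<iota> v)) = - tw A 1 (d (\<iota> v))" by (simp add: dD(12) ksign_def)
  then show ?thesis by (simp add: TA.tw_gen[symmetric] \<eta>_simps TA.counit_tw)
qed

text \<open>
  Each of the two identities is needed for the other one: the step for a generator in the first uses the
  second, and the step for \<open>\<epsilon>\<close> in the second uses the first.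
\<close>

lemma dp_G: "dp (G x) = G (dp x) \<and> dp (G0 x) + G0 (dp x) = - G x"
proof (induction x rule: B_induct)
  case one
  then show ?case by (simp add: dpD hG_simps)
next
  case (gen v x)
  have "G0 (dp x) = - G x - dp (G0 x)" using gen by (simp add: eq_diff_eq add.commute)
  then show ?case
    by (simp add: dp_cons hG_simps hG_left tw_gen \<eta>_d_tw dpD(7-9) smulB_rules \<eta>_simps)
next
  case (eps x)
  then show ?case by (simp add: dp_cons dpD(7) hG_simps)
next
  case (add x y)
  have "dp (G0 (x + y)) + G0 (dp (x + y)) = (dp (G0 x) + G0 (dp x)) + (dp (G0 y) + G0 (dp y))"
    by (simp add: dpD(5) hG_simps)
  then show ?case using add by (simp add: dpD(5) hG_simps)
next
  case (scale c x)
  have "dp (G0 (smul B c x)) + G0 (dp (smul B c x)) = smul B c (dp (G0 x) + G0 (dp x))"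
    by (simp add: dpD(9) hG_simps smulB_rules)
  then show ?case using scale by (simp add: dpD(9) hG_simps smulB_rules)
qed

text \<open>
  \<open>h\<close> commutes up to sign with multiplication by \<open>A\<close> from the left, so the identity has to be checked only
  behind the first \<open>\<epsilon>\<close>, where it amounts to \<open>dp_G\<close>.
\<close>

lemma dp_h: "dp (h x) + h (dp x) = x - j (\<rho> x)"
proof (induction x rule: B_induct)
  case one
  then show ?case by (simp add: dpD hG_simps)
next
  case (gen v x)
  have "dp (tw B 1 (gen v) * h x) = - (tw B 1 (j (d (\<iota> v))) * h x) + gen v * dp (h x)"
    by (simp add: dpD(4,12) dp_gen tw_m1 tw_tw[OF TB.graded] tw_even[OF TB.graded]) (simp add: ksign_def)
  moreover have "h (dp (gen v * x)) = tw B 1 (j (d (\<iota> v))) * h x + gen v * h (dp x)"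
    using hG_rec(4)[of "tw V 1 v" "dp x"]
    by (simp add: dp_cons hG_simps hG_left tw_gen tw_tw[OF TA.graded_V] tw_even[OF TA.graded_V])
  ultimately have "dp (h (gen v * x)) + h (dp (gen v * x)) = gen v * (dp (h x) + h (dp x))"
    by (simp add: distrib_left)
  then show ?case unfolding gen by (simp add: right_diff_distrib \<rho>_gen j_cons)
next
  case (eps x)
  then show ?case using dp_G[of x] by (simp add: dp_cons hG_simps \<rho>_eps j_simps)
next
  case (add x y)
  have "dp (h (x + y)) + h (dp (x + y)) = (dp (h x) + h (dp x)) + (dp (h y) + h (dp y))"
    by (simp add: dpD(5) hG_simps)
  then show ?case unfolding add by (simp add: \<rho>_simps j_simps)
next
  case (scale c x)
  have "dp (h (smul B c x)) + h (dp (smul B c x)) = smul B c (dp (h x) + h (dp x))"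
    by (simp add: dpD(9) hG_simps smulB_rules)
  then show ?case unfolding scale by (simp add: \<rho>_simps j_simps smulB_rules)
qed


section \<open>Embedding the derivations of \<open>A\<close> into those of the extended algebra\<close>

abbreviation "TD \<equiv> tDer_dgl A"

text \<open>
  The sign at \<open>\<epsilon>\<close> makes the commutator with \<open>dt\<close> produce \<open>-ad\<^sub>x\<close> on \<open>A\<close>.
\<close>

definition \<Psi> :: "int \<Rightarrow> ('a \<Rightarrow> 'a) \<times> 'a \<Rightarrow> 'b \<Rightarrow> 'b" where
  "\<Psi> n z = ext n (\<lambda>v. j (fst z (\<iota> v))) (ksign n (j (snd z)))"

lemma lcar_TD: "z \<in> lcar TD n \<longleftrightarrow> fst z \<in> Der n A \<and> snd z \<in> gr A (n - 1)"
  by (cases z) (simp add: tDer_dgl_def)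

lemma \<Psi>:
  assumes z: "z \<in> lcar TD n"
  shows \<Psi>_Der: "\<Psi> n z \<in> Der n B" and \<Psi>_gen: "\<Psi> n z (gen v) = j (fst z (\<iota> v))"
    and \<Psi>_eps: "\<Psi> n z \<epsilon> = ksign n (j (snd z))"
proof -
  have \<theta>: "fst z \<in> Der n A" and x: "snd z \<in> gr A (n - 1)" using z by (auto simp: lcar_TD)
  have 1: "module_hom (smul V) (smul B) (\<lambda>v. j (fst z (\<iota> v)))"
    by (rule module_hom_comp[OF j_hom module_hom_comp[OF TA.DerD(2)[OF \<theta>] TA.gen_hom]])
  have 2: "j (fst z (\<iota> v)) \<in> gr B (i + n)" if "v \<in> gr V i" for i v
    using HomD(2)[OF j_Hom TA.DerD(3)[OF \<theta> TA.gen_gr[OF that]]] by simp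
  have 3: "ksign n (j (snd z)) \<in> gr B (n - 1)"
    using TB.gr_ksign[OF HomD(2)[OF j_Hom x]] by simp
  show "\<Psi> n z \<in> Der n B" unfolding \<Psi>_def by (rule ext_Der[OF 1 2 3])
  show "\<Psi> n z (gen v) = j (fst z (\<iota> v))" unfolding \<Psi>_def by (rule ext_gen[OF 1 2 3])
  show "\<Psi> n z \<epsilon> = ksign n (j (snd z))" unfolding \<Psi>_def by (rule ext_eps[OF 1 2 3])
qed

lemma \<Psi>_j:
  assumes z: "z \<in> lcar TD n" shows "\<Psi> n z (j a) = j (fst z a)"
proof -
  have \<theta>: "fst z \<in> Der n A" using z by (auto simp: lcar_TD)
  note D = TB.DerD[OF \<Psi>_Der[OF z]]
  show ?thesis
    by (rule TA.Leibniz_unique[OF module_hom_comp[OF D(2) j_hom] module_hom_comp[OF j_hom TA.DerD(2)[OF \<theta>]],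
          where j = j and s = "\<lambda>x. j (tw A n x)"])
       (simp_all add: D(4,11) TA.DerD(4,11)[OF \<theta>] j_simps j_mult j_gen \<Psi>_gen[OF z] j_tw[symmetric])
qed

abbreviation "LB \<equiv> Der_dgl BD"

lemma LB_simps: "lcar LB n = Der n B" "ldiff LB n X = comm_br (- 1) n dt X" "lbr LB = comm_br"
  "lscale LB = (\<lambda>c X x. smul B c (X x))"
  by (simp_all add: Der_dgl_def)

lemma is_dgl_LB: "is_dgl LB"
  by (rule is_dgl_Der[OF is_dga_BD])

lemma comm_Der: "X \<in> Der k B \<Longrightarrow> Y \<in> Der n B \<Longrightarrow> comm_br k n X Y \<in> Der (k + n) B"
  by (rule TB.comm_br_Der)

lemma comm_dt_Der: "X \<in> Der n B \<Longrightarrow> comm_br (- 1) n dt X \<in> Der (n - 1) B"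
  using comm_Der[OF dt_Der, of X n] by simp

lemma \<Psi>_lbr:
  assumes z: "z \<in> lcar TD k" and z': "z' \<in> lcar TD n"
  shows "\<Psi> (k + n) (lbr TD k n z z') = comm_br k n (\<Psi> k z) (\<Psi> n z')"
proof (rule B_Der_unique)
  note c = tDer_closed(4)[OF dga z z']
  note s = TB.DerD(10)[OF \<Psi>_Der[OF z]] TB.DerD(10)[OF \<Psi>_Der[OF z']]
  show "\<Psi> (k + n) (lbr TD k n z z') \<in> Der (k + n) B" by (rule \<Psi>_Der[OF c])
  show "comm_br k n (\<Psi> k z) (\<Psi> n z') \<in> Der (k + n) B" by (rule comm_Der[OF \<Psi>_Der[OF z] \<Psi>_Der[OF z']])
  show "\<Psi> (k + n) (lbr TD k n z z') (gen v) = comm_br k n (\<Psi> k z) (\<Psi> n z') (gen v)" for v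
    unfolding \<Psi>_gen[OF c] by (cases z; cases z')
      (use \<Psi>_gen[OF z] \<Psi>_gen[OF z'] \<Psi>_j[OF z] \<Psi>_j[OF z'] in \<open>simp add: comm_br_def tDer_dgl_def j_simps\<close>)
  show "\<Psi> (k + n) (lbr TD k n z z') \<epsilon> = comm_br k n (\<Psi> k z) (\<Psi> n z') \<epsilon>"
    unfolding \<Psi>_eps[OF c] comm_br_def \<Psi>_eps[OF z] \<Psi>_eps[OF z'] s \<Psi>_j[OF z] \<Psi>_j[OF z']
    by (cases "even k"; cases "even n"; cases z; cases z') (simp_all add: tDer_dgl_def j_simps ksign_def)
qed

text \<open>
  The terms \<open>\<epsilon> X(v) \<plusminus> X(v) \<epsilon>\<close> of \<open>dt (X v)\<close> and of \<open>X (dt v)\<close> cancel. This is the reason to pass from \<open>dt\<close> to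
  \<open>dp\<close>.
\<close>

lemma comm_dt:
  assumes X: "X \<in> Der n B"
  shows "v \<in> gr V i \<Longrightarrow> comm_br (- 1) n dt X (gen v) = dp (X (gen v)) - ksign n (X (j (d (\<iota> v))))
      - ksign n (X \<epsilon> * gen v - ksign (i * n + i) (gen v * X \<epsilon>))"
    and "comm_br (- 1) n dt X \<epsilon> = dp (X \<epsilon>)"
proof -
  note D = TB.DerD[OF X]
  have dt: "dt x = dp x + \<epsilon> * x - tw B 1 x * \<epsilon>" for x by (simp add: dp_def)
  show "comm_br (- 1) n dt X (gen v) = dp (X (gen v)) - ksign n (X (j (d (\<iota> v))))
      - ksign n (X \<epsilon> * gen v - ksign (i * n + i) (gen v * X \<epsilon>))" if v: "v \<in> gr V i"
  proof -
    have t: "tw B k (gen v) = ksign (k * i) (gen v)" for k by (rule tw_gr[OF TB.graded gen_gr[OF v]])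
    have tX: "tw B 1 (X (gen v)) = ksign (i + n) (X (gen v))"
      using tw_gr[OF TB.graded D(3)[OF gen_gr[OF v]], of 1] by simp
    show ?thesis
      by (cases "even n"; cases "even i")
         (simp_all add: comm_br_def dt dp_gen D(4-7) t tX tw_eps ksign_def TB.tw_linear algebra_simps)
  qed
  have tX: "tw B 1 (X \<epsilon>) = ksign (n + 1) (X \<epsilon>)"
    using tw_gr[OF TB.graded D(3)[OF eps_gr], of 1] by (simp add: ksign_def)
  show "comm_br (- 1) n dt X \<epsilon> = dp (X \<epsilon>)"
    by (cases "even n") (simp_all add: comm_br_def dt dp_eps tX tw_eps D(4-7) ksign_def TB.tw_linear algebra_simps)
qed

lemma \<Psi>_ldiff:
  assumes z: "z \<in> lcar TD n"
  shows "\<Psi> (n - 1) (ldiff TD n z) = comm_br (- 1) n dt (\<Psi> n z)"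
proof (rule B_Der_unique)
  note c = tDer_closed(3)[OF dga z]
  have x: "snd z \<in> gr A (n - 1)" using z by (auto simp: lcar_TD)
  have dz: "snd (ldiff TD n z) = - d (snd z)" "fst (ldiff TD n z) a = d (fst z a) - ksign n (fst z (d a))
     - (snd z * a - tw A (n - 1) a * snd z)" for a
    by (cases z, simp add: tDer_dgl_def)
       (cases z, use ad_eq[OF dga x] in \<open>simp add: tDer_dgl_def comm_br_def ksign_def\<close>)
  show "\<Psi> (n - 1) (ldiff TD n z) \<in> Der (n - 1) B" by (rule \<Psi>_Der[OF c])
  show "comm_br (- 1) n dt (\<Psi> n z) \<in> Der (n - 1) B" by (rule comm_dt_Der[OF \<Psi>_Der[OF z]])
  show "\<Psi> (n - 1) (ldiff TD n z) (gen v) = comm_br (- 1) n dt (\<Psi> n z) (gen v)" if v: "v \<in> gr V i" for v i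
  proof -
    have "tw A (n - 1) (\<iota> v) = ksign (i * n + i) (\<iota> v)"
      using tw_gr[OF TA.graded TA.gen_gr[OF v], of "n - 1"]
      by (cases "even n"; cases "even i") (simp_all add: ksign_def)
    then show ?thesis
      unfolding comm_dt(1)[OF \<Psi>_Der[OF z] v] \<Psi>_gen[OF c] \<Psi>_gen[OF z] \<Psi>_eps[OF z] \<Psi>_j[OF z] dp_j dz
      by (cases "even n"; cases "even i") (simp_all add: j_simps j_mult j_gen ksign_def)
  qed
  show "\<Psi> (n - 1) (ldiff TD n z) \<epsilon> = comm_br (- 1) n dt (\<Psi> n z) \<epsilon>"
    unfolding comm_dt(2)[OF \<Psi>_Der[OF z]] \<Psi>_eps[OF c] \<Psi>_eps[OF z] dz dpD(10) dp_j
    by (simp add: j_simps ksign_def)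
qed

lemma \<Psi>_inj: "inj_on (\<Psi> n) (lcar TD n)"
proof (rule inj_onI)
  fix z z' assume z: "z \<in> lcar TD n" and z': "z' \<in> lcar TD n" and e: "\<Psi> n z = \<Psi> n z'"
  have "fst z a = fst z' a" for a
    using arg_cong[OF fun_cong[OF e, of "j a"], of \<rho>] by (simp add: \<Psi>_j[OF z] \<Psi>_j[OF z'])
  moreover have "snd z = snd z'"
    using arg_cong[OF fun_cong[OF e, of \<epsilon>], of "\<lambda>x. \<rho> (ksign n x)"]
    by (simp add: \<Psi>_eps[OF z] \<Psi>_eps[OF z']) (simp add: ksign_def)
  ultimately show "z = z'" by (simp add: prod_eq_iff fun_eq_iff)
qed

lemma is_dgl_hom_\<Psi>:
  assumes L: "is_dgl TD" shows "is_dgl_hom TD LB \<Psi>"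
  unfolding is_dgl_hom_def LB_simps
proof (intro conjI allI ballI)
  note sub = is_dglD(2)[OF L] and M = is_dglD(1)[OF L]
  show "\<Psi> n z \<in> Der n B" if "z \<in> lcar TD n" for n z by (rule \<Psi>_Der[OF that])
  show "\<Psi> (n - 1) (ldiff TD n z) = comm_br (- 1) n dt (\<Psi> n z)" if "z \<in> lcar TD n" for n z
    by (rule \<Psi>_ldiff[OF that])
  show "\<Psi> (k + n) (lbr TD k n z z') = comm_br k n (\<Psi> k z) (\<Psi> n z')"
    if "z \<in> lcar TD k" "z' \<in> lcar TD n" for k n z z' by (rule \<Psi>_lbr[OF that])
  note MB = module_pointwise[OF TB.module]
  show "\<Psi> n (z + z') = \<Psi> n z + \<Psi> n z'" if z: "z \<in> lcar TD n" "z' \<in> lcar TD n" for n z z'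
  proof (rule B_Der_unique)
    note c = module.subspace_add[OF M sub z]
    show "\<Psi> n (z + z') \<in> Der n B" by (rule \<Psi>_Der[OF c])
    show "\<Psi> n z + \<Psi> n z' \<in> Der n B"
      by (rule module.subspace_add[OF MB TB.Der_subspace \<Psi>_Der[OF z(1)] \<Psi>_Der[OF z(2)]])
  qed (simp_all add: \<Psi>_gen[OF module.subspace_add[OF M sub z]] \<Psi>_eps[OF module.subspace_add[OF M sub z]]
        \<Psi>_gen[OF z(1)] \<Psi>_gen[OF z(2)] \<Psi>_eps[OF z(1)] \<Psi>_eps[OF z(2)] j_simps ksign_add)
  show "\<Psi> n (lscale TD c z) = (\<lambda>x. smul B c (\<Psi> n z x))" if z: "z \<in> lcar TD n" for n c z
  proof (rule B_Der_unique)
    note s = module.subspace_scale[OF M sub z, of c]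
    have l: "fst (lscale TD c z) a = smul A c (fst z a)" "snd (lscale TD c z) = smul A c (snd z)" for a
      by (cases z, simp add: tDer_dgl_def)+
    show "\<Psi> n (lscale TD c z) \<in> Der n B" by (rule \<Psi>_Der[OF s])
    show "(\<lambda>x. smul B c (\<Psi> n z x)) \<in> Der n B"
      by (rule module.subspace_scale[OF MB TB.Der_subspace \<Psi>_Der[OF z]])
    show "\<Psi> n (lscale TD c z) (gen v) = smul B c (\<Psi> n z (gen v))" for v
      by (simp add: \<Psi>_gen[OF s] \<Psi>_gen[OF z] l j_simps)
    show "\<Psi> n (lscale TD c z) \<epsilon> = smul B c (\<Psi> n z \<epsilon>)"
      by (simp add: \<Psi>_eps[OF s] \<Psi>_eps[OF z] l j_simps smulB_rules)
  qed
qed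

lemma \<Psi>_image:
  assumes X: "X \<in> Der n B" and gen: "\<And>v i. v \<in> gr V i \<Longrightarrow> X (gen v) = j (\<rho> (X (gen v)))"
    and eps: "X \<epsilon> = j (\<rho> (X \<epsilon>))"
  shows "X \<in> \<Psi> n ` lcar TD n"
proof -
  note D = TB.DerD[OF X]
  have \<theta>: "(\<lambda>a. \<rho> (X (j a))) \<in> Der n A"
  proof (rule TA.DerI[OF HomI])
    show "module_hom (smul A) (smul A) (\<lambda>a. \<rho> (X (j a)))"
      by (rule module_hom_comp[OF \<rho>_hom module_hom_comp[OF D(2) j_hom]])
    show "\<rho> (X (j a)) \<in> gr A (i + n)" if "a \<in> gr A i" for i a
      using HomD(2)[OF \<rho>_Hom D(3)[OF HomD(2)[OF j_Hom that]]] by simp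
    show "\<rho> (X (j (a * b))) = \<rho> (X (j a)) * b + tw A n a * \<rho> (X (j b))" for a b
      by (simp add: j_mult D(4) \<rho>_simps \<rho>_mult j_tw)
  qed
  moreover have "\<rho> (ksign n (X \<epsilon>)) \<in> gr A (n - 1)"
    using HomD(2)[OF \<rho>_Hom TB.gr_ksign[OF D(3)[OF eps_gr]]] by simp
  ultimately have z: "(\<lambda>a. \<rho> (X (j a)), \<rho> (ksign n (X \<epsilon>))) \<in> lcar TD n" by (simp add: lcar_TD)
  have "X = \<Psi> n (\<lambda>a. \<rho> (X (j a)), \<rho> (ksign n (X \<epsilon>)))"
  proof (rule B_Der_unique[OF X \<Psi>_Der[OF z]])
    show "X (gen v) = \<Psi> n (\<lambda>a. \<rho> (X (j a)), \<rho> (ksign n (X \<epsilon>))) (gen v)" if "v \<in> gr V i" for v i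
      using gen[OF that] by (simp add: \<Psi>_gen[OF z] j_gen)
    show "X \<epsilon> = \<Psi> n (\<lambda>a. \<rho> (X (j a)), \<rho> (ksign n (X \<epsilon>))) \<epsilon>"
      by (rule trans[OF _ \<Psi>_eps[OF z, symmetric]], simp add: \<rho>_simps j_simps eps[symmetric])
         (simp add: ksign_def)
  qed
  then show ?thesis using z by (rule image_eqI)
qed

text \<open>
  Let the commutator of \<open>X\<close> with \<open>dt\<close> lie in the image of \<open>\<Psi>\<close>. The derivation \<open>Y\<close> with values \<open>h (X v)\<close> and \<open>h (X \<epsilon>)\<close>
  agrees with \<open>h \<circ> X\<close> on \<open>A\<close>, as \<open>h\<close> is linear over \<open>A\<close>. Since \<open>h\<close> vanishes on \<open>A\<close>, the homotopy
  identity \<open>dp_h\<close> shows that \<open>X\<close> minus the commutator of \<open>Y\<close> with \<open>dt\<close> takes \<open>V\<close> and \<open>\<epsilon>\<close> into \<open>A\<close>.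
\<close>

theorem injective_quasi_iso_\<Psi>:
  assumes L: "is_dgl TD" shows "injective_quasi_iso TD LB \<Psi>"
proof (rule injective_quasi_isoI[OF L is_dgl_LB is_dgl_hom_\<Psi>[OF L] \<Psi>_inj], unfold LB_simps)
  fix n X assume X: "X \<in> Der n B" and im: "comm_br (- 1) n dt X \<in> \<Psi> (n - 1) ` lcar TD (n - 1)"
  note D = TB.DerD[OF X]
  obtain z where z: "z \<in> lcar TD (n - 1)" "comm_br (- 1) n dt X = \<Psi> (n - 1) z" using im by blast
  have h_gen: "h (comm_br (- 1) n dt X (gen v)) = 0" for v
    unfolding z(2) \<Psi>_gen[OF z(1)] by (rule hG_j)
  have h_eps: "h (dp (X \<epsilon>)) = 0"
    unfolding comm_dt(2)[OF X, symmetric] z(2) \<Psi>_eps[OF z(1)] by (simp add: hG_simps hG_j)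
  have 1: "module_hom (smul V) (smul B) (\<lambda>v. h (X (gen v)))"
    by (rule module_hom_comp[OF h_hom module_hom_comp[OF D(2) gen_hom]])
  have 2: "h (X (gen v)) \<in> gr B (i + (n + 1))" if "v \<in> gr V i" for i v
    using HomD(2)[OF h_Hom D(3)[OF gen_gr[OF that]]] by (simp add: add.assoc)
  have 3: "h (X \<epsilon>) \<in> gr B (n + 1 - 1)" using HomD(2)[OF h_Hom D(3)[OF eps_gr]] by simp
  define Y where "Y = ext (n + 1) (\<lambda>v. h (X (gen v))) (h (X \<epsilon>))"
  have Y: "Y \<in> Der (n + 1) B" unfolding Y_def by (rule ext_Der[OF 1 2 3])
  have Y_gen: "Y (gen v) = h (X (gen v))" for v unfolding Y_def by (rule ext_gen[OF 1 2 3])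
  have Y_eps: "Y \<epsilon> = h (X \<epsilon>)" unfolding Y_def by (rule ext_eps[OF 1 2 3])
  note DY = TB.DerD[OF Y]
  have Y_j: "Y (j a) = h (X (j a))" for a
  proof (rule TA.Leibniz_unique[OF module_hom_comp[OF DY(2) j_hom] module_hom_comp[OF h_hom module_hom_comp[OF D(2) j_hom]],
        where j = j and s = "\<lambda>x. j (tw A (n + 1) x)"])
    show "Y (j (\<iota> v * x)) = Y (j (\<iota> v)) * j x + j (tw A (n + 1) (\<iota> v)) * Y (j x)" for v x
      by (simp add: j_mult DY(4) j_tw)
    show "h (X (j (\<iota> v * x))) = h (X (j (\<iota> v))) * j x + j (tw A (n + 1) (\<iota> v)) * h (X (j x))" for v x
      by (simp add: j_mult D(4) hG_simps h_right j_tw hG_left tw_tw[OF TA.graded] add.commute)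
  qed (simp_all add: D(11) DY(11) hG_simps j_gen Y_gen)
  define Z where "Z = X - comm_br (- 1) (n + 1) dt Y"
  have Z: "Z \<in> Der n B" unfolding Z_def
    using module.subspace_diff[OF module_pointwise[OF TB.module] TB.Der_subspace X comm_dt_Der[OF Y, simplified]] .
  have "Z \<in> \<Psi> n ` lcar TD n"
  proof (rule \<Psi>_image[OF Z])
    have "Z \<epsilon> = j (\<rho> (X \<epsilon>))"
      using dp_h[of "X \<epsilon>"] by (simp add: Z_def comm_dt(2)[OF Y] Y_eps h_eps)
    then show "Z \<epsilon> = j (\<rho> (Z \<epsilon>))" by simp
    fix v i assume v: "v \<in> gr V i"
    have t: "tw B k (gen v) = ksign (k * i) (gen v)" for k by (rule tw_gr[OF TB.graded gen_gr[OF v]])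
    have hv: "h (gen v * y) = ksign i (gen v * h y)" "h (y * gen v) = h y * gen v" for y
      using h_right[of y "\<iota> v"] by (simp_all add: t j_gen ksign_mult)
    have "comm_br (- 1) (n + 1) dt Y (gen v) + h (comm_br (- 1) n dt X (gen v)) =
        dp (h (X (gen v))) + h (dp (X (gen v)))"
      unfolding comm_dt(1)[OF Y v] comm_dt(1)[OF X v] Y_gen Y_j Y_eps
      by (cases "even n"; cases "even i") (simp_all add: hG_simps hv t ksign_def algebra_simps)
    then have "Z (gen v) = j (\<rho> (X (gen v)))"
      unfolding dp_h h_gen by (simp add: Z_def)
    then show "Z (gen v) = j (\<rho> (Z (gen v)))" by simp
  qed
  then show "\<exists>Y\<in>Der (n + 1) B. X - comm_br (- 1) (n + 1) dt Y \<in> \<Psi> n ` lcar TD n"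
    using Y unfolding Z_def by blast
qed

end

section \<open>The two quasi-isomorphisms\<close>

theorem theorem2:
  fixes V :: "('k::idom, 'v::ab_group_add) gmod"
    and A :: "('k, 'a::ring_1) dga" and \<iota> :: "'v \<Rightarrow> 'a"
    and B :: "('k, 'b::ring_1) gmod" and \<iota>' :: "'v \<times> 'k \<Rightarrow> 'b"
    and C :: "('k, 'c::ab_group_add) gmod" and bar :: "'a list \<Rightarrow> 'c"
    and sc2 :: "'k \<Rightarrow> 'e::ab_group_add \<Rightarrow> 'e" and t :: "'c \<Rightarrow> 'c \<Rightarrow> 'e"
  assumes A_free_model: "free_model V A \<iota>"
    and B_tensor: "tensor_algebra (add_eps V) B \<iota>'"
    and C_bar: "tensor_powers (susp A) C bar"
    and CC_tensor: "tensor_product (smul C) (smul C) sc2 t"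
  shows "is_dga (tilde_dga V A \<iota> B \<iota>') \<and>
    (\<exists>\<Phi>. injective_quasi_iso (tDer_dgl A) (hoch_dgl A C bar sc2 t) \<Phi>) \<and>
    (\<exists>\<Psi>. injective_quasi_iso (tDer_dgl A) (Der_dgl (tilde_dga V A \<iota> B \<iota>')) \<Psi>)"
proof -
  have V: "graded_module V" and A: "tensor_algebra V A \<iota>" "is_dga A"
    using A_free_model by (simp_all add: free_model_def)
  obtain F :: "nat \<Rightarrow> int \<Rightarrow> 'v set" where
    F: "\<And>i. gr V i = (\<Union>k. F k i)" "\<And>i v. v \<in> F 0 i \<Longrightarrow> diff A (\<iota> v) = 0"
      "\<And>k i v. v \<in> F (Suc k) i \<Longrightarrow> diff A (\<iota> v) \<in> module.span (smul A)
             {prod_list (map \<iota> vs) | vs. set vs \<subseteq> (\<Union>j. F k j)}"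
    using A_free_model unfolding free_model_def by auto
  interpret tilde V A \<iota> B \<iota>'
    by unfold_locales (fact V, fact A(1), rule graded_module_add_eps[OF V], fact B_tensor, fact A(2))
  obtain cons where cons: "bilin (smul A) (smul C) (smul C) cons" "\<And>a as. cons a (bar as) = bar (a # as)"
    using tensor_powers_cons[of "susp A" C bar] C_bar TA.module by auto
  interpret H: free_hochschild A C bar sc2 t cons V \<iota> F
    by unfold_locales (fact A(2) C_bar CC_tensor cons V A(1) F)+
  show ?thesis
    using is_dga_BD H.injective_quasi_iso_\<Phi> injective_quasi_iso_\<Psi>[OF H.is_dgl_TD] by blast
qed

end
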